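(* Let $q\ge 2$ and $d\ge 1$ be integers, let $A_0,\dots,A_{q-1}\in\mathbb{C}^{d\times d}$, and let $(v(n))_{n\ge0}$ be a sequence in $\mathbb{C}^d$ with $v(qn+r)=A_rv(n)$ for all $0\le r<q$, $n\ge0$. Let $x(n)$ be the first component of $v(n)$ and $X(N)=\sum_{0\le n<N}x(n)$. Fix a vector norm on $\mathbb{C}^d$ with its induced matrix norm, set $C=\sum_{r=0}^{q-1}A_r$, and let $R>0$ be such that $\|A_{r_1}\cdots A_{r_\ell}\|=O(R^\ell)$ for all $\ell\ge0$ and all $r_1,\dots,r_\ell\in\{0,\dots,q-1\}$. For $\lambda\in\mathbb{C}$ let $m(\lambda)$ be the size of the largest Jordan block of $C$ associated with $\lambda$ ($m(\lambda)=0$ if $\lambda\notin\sigma(C)$). Let $\mathcal{X}(s)=\sum_{n\ge1}n^{-s}x(n)$ and $\mathcal{V}(s)=\sum_{n\ge1}n^{-s}v(n)$. Then: (1) There are $1$-periodic continuous functions $\Phi_{\lambda k}$ such that $$X(N)=\sum_{\lambda\in\sigma(C),\,|\lambda|>R}N^{\log_q\lambda}\sum_{0\le k<m(\lambda)}(\log_qN)^k\Phi_{\lambda k}(\{\log_qN\})+O\big(N^{\log_qR}(\log N)^{\max\{m(\lambda):|\lambda|=R\}}\big);$$ if there are no eigenvalues $\lambda\in\sigma(C)$ with $|\lambda|\le R$, the $O$-term can be omitted. (2) For $|\lambda|>R$ and $0\le k<m(\lambda)$, $\Phi_{\lambda k}$ is Hölder continuous with any exponent smaller than $\log_q(|\lambda|/R)$.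 (3) $\mathcal{V}(s)$ converges absolutely and uniformly on compact subsets of $\operatorname{Re}s>\log_qR+1$, can be continued to a meromorphic function on $\operatorname{Re}s>\log_qR$, and satisfies for $\operatorname{Re}s>\log_qR$ $$(I-q^{-s}C)\mathcal{V}(s)=\sum_{n=1}^{q-1}n^{-s}v(n)+q^{-s}\sum_{r=0}^{q-1}A_r\sum_{k\ge1}\binom{-s}{k}\Big(\frac rq\Big)^k\mathcal{V}(s+k),$$ where the right side converges absolutely and uniformly on compact subsets of $\operatorname{Re}s>\log_qR$. In particular, $\mathcal{V}(s)$ can only have poles where $q^s\in\sigma(C)$. (4) For $\lambda\in\sigma(C)$ with $|\lambda|>\max\{R,1/q\}$, the Fourier series $\Phi_{\lambda k}(u)=\sum_{\ell\in\mathbb{Z}}\varphi_{\lambda k\ell}\exp(2\ell\pi iu)$ converges pointwise for $u\in\mathbb{R}$, where for $\ell\in\mathbb{Z}$, $0\le k<m(\lambda)$, $$\varphi_{\lambda k\ell}=\frac{(\log q)^k}{k!}\operatorname*{Res}_{s=\log_q\lambda+\frac{2\ell\pi i}{\log q}}\frac{(x(0)+\mathcal{X}(s))\big(s-\log_q\lambda-\frac{2\ell\pi i}{\log q}\big)^k}{s}.$$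
   Context: $\log$ denotes the principal value of the complex logarithm and $\log_q z=\log z/\log q$; $\{z\}=z-\lfloor z\rfloor$ is the fractional part; $\sigma(C)$ is the set of eigenvalues of $C$. *)

theory Defs
  imports "HOL-Complex_Analysis.Complex_Analysis" "HOL-Library.Landau_Symbols"
    "Jordan_Normal_Form.Jordan_Normal_Form" "Jordan_Normal_Form.Spectral_Radius"
begin

definition is_vec_norm :: "nat \<Rightarrow> (complex vec \<Rightarrow> real) \<Rightarrow> bool" where
  "is_vec_norm d nv \<longleftrightarrow>
     (\<forall>x\<in>carrier_vec d. nv x \<ge> 0 \<and> (nv x = 0 \<longleftrightarrow> x = 0\<^sub>v d)) \<and>
     (\<forall>c. \<forall>x\<in>carrier_vec d. nv (c \<cdot>\<^sub>v x) = cmod c * nv x) \<and>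
     (\<forall>x\<in>carrier_vec d. \<forall>y\<in>carrier_vec d. nv (x + y) \<le> nv x + nv y)"

definition induced_mat_norm :: "nat \<Rightarrow> (complex vec \<Rightarrow> real) \<Rightarrow> complex mat \<Rightarrow> real" where
  "induced_mat_norm d nv M = Sup {nv (M *\<^sub>v x) | x. x \<in> carrier_vec d \<and> nv x = 1}"

definition mat_word_prod :: "nat \<Rightarrow> (nat \<Rightarrow> complex mat) \<Rightarrow> nat list \<Rightarrow> complex mat" where
  "mat_word_prod d A rs = foldr (\<lambda>r M. A r * M) rs (1\<^sub>m d)"

text \<open>Size of the largest Jordan block of C for eigenvalue lam (0 if lam is not an eigenvalue),
  taken from a Jordan normal form of C (unique up to the order of blocks).\<close>
definition max_jordan_block :: "complex mat \<Rightarrow> complex \<Rightarrow> nat" where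
  "max_jordan_block C lam =
     (let n_as = (SOME n_as. jordan_nf C n_as) in Max (insert 0 {n. (n, lam) \<in> set n_as}))"

definition holder_continuous :: "real \<Rightarrow> (real \<Rightarrow> complex) \<Rightarrow> bool" where
  "holder_continuous alpha f \<longleftrightarrow> (\<exists>L. \<forall>u w. cmod (f u - f w) \<le> L * \<bar>u - w\<bar> powr alpha)"

end

theory Submission
  imports Defs
begin

text \<open>
  A Jordan basis of \<open>C\<close> turns the recursion of the summatory function into scalar chains
  \<open>y p (q N + r) = \<lambda> y p N + y (p + 1) N + error\<close>, where the error has size
  \<open>N powr \<rho>\<close> with \<open>\<rho> = log_q R\<close>. If \<open>|\<lambda>| > R\<close>, then multiplying \<open>y\<close> at
  \<open>\<lfloor>t q^j\<rfloor>\<close> by the \<open>-j\<close>-th power of the Jordan block gives a Cauchy sequence whose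
  limit \<open>G t\<close> satisfies \<open>G (q t) = J (G t)\<close>, agrees with \<open>y\<close> at integers and stays within
  \<open>O(t powr \<rho>)\<close> of it in between; dividing by \<open>J powr log_q t\<close> yields the periodic Hoelder
  functions. The remaining chains are absorbed in the error term.

  The Dirichlet series is continued by solving its functional equation in the Jordan basis.
  For the Fourier coefficients, summation by parts shows that \<open>(x 0 + X s) / s\<close> is, up to a function
  holomorphic on \<open>Re s > \<rho>\<close>, the Mellin transform of the explicit main term. That transform is
  a combination of derivatives of \<open>E z / (1 - exp (- z))\<close>, with \<open>E\<close> the Laplace transform of
  \<open>\<Phi>\<close> over one period, so its principal parts are read off from the values \<open>E (2 \<pi> i l)\<close>,
  which are the Fourier coefficients.
\<close>

unbundle no vec_syntax
no_notation fps_nth (infixl "$" 75)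

subsection \<open>Hoelder continuity\<close>

text \<open>A complete block of \<open>q\<close> consecutive indices sums without error:
  \<open>V (q N) = C V N\<close>; only incomplete blocks create the error of size
  \<open>N powr \<rho>\<close>. So the limit \<open>G\<close> reproduces the coordinates at integers
  exactly, and the error in the asymptotics comes only from eigenvalues of modulus at most
  \<open>R\<close>. Negative powers of a Jordan block carry a polynomial factor, which any
  \<open>\<theta>\<close> strictly below \<open>cmod lam\<close> absorbs; with
  \<open>\<theta> = R * q powr \<alpha>\<close> the geometric rate of convergence becomes Hoelder
  continuity with exponent \<open>\<alpha>\<close>. Counting words gives
  \<open>cmod lam \<le> q * R\<close>, hence all these exponents are at most 1, as the smooth
  factors require. The binomial expansion of \<open>(n + r/q) powr (- s)\<close> uses the Dirichlet
  series only at \<open>s + k\<close> with \<open>k \<ge> 1\<close>; on \<open>Re s > \<rho>\<close>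
  these points lie in the half-plane of convergence, so a single step continues the series. For the
  residues, the candidate poles form a closed countable set, whose complement in a half-plane is
  connected and carries an identity from far right to the point in question. An exponent
  \<open>\<rho>'\<close> slightly above \<open>\<rho>\<close> swallows the logarithms there.\<close>

definition holder_on :: "real \<Rightarrow> real set \<Rightarrow> (real \<Rightarrow> complex) \<Rightarrow> bool" where
  "holder_on \<alpha> S f \<longleftrightarrow> (\<exists>L\<ge>0. \<forall>u\<in>S. \<forall>w\<in>S. cmod (f u - f w) \<le> L * \<bar>u - w\<bar> powr \<alpha>)"

lemma holder_onI:
  assumes "\<And>u w. u \<in> S \<Longrightarrow> w \<in> S \<Longrightarrow> cmod (f u - f w) \<le> L * \<bar>u - w\<bar> powr \<alpha>"
  shows "holder_on \<alpha> S f"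
  unfolding holder_on_def
proof (intro exI[of _ "\<bar>L\<bar>"] conjI ballI)
  fix u w assume "u \<in> S" "w \<in> S"
  have "cmod (f u - f w) \<le> L * \<bar>u - w\<bar> powr \<alpha>" by (rule assms) fact+
  also have "\<dots> \<le> \<bar>L\<bar> * \<bar>u - w\<bar> powr \<alpha>" by (intro mult_right_mono) auto
  finally show "cmod (f u - f w) \<le> \<bar>L\<bar> * \<bar>u - w\<bar> powr \<alpha>" .
qed auto

lemma holder_on_const: "holder_on \<alpha> S (\<lambda>_. c)"
  by (rule holder_onI[of _ _ 0]) auto

lemma holder_on_add:
  assumes "holder_on \<alpha> S f" "holder_on \<alpha> S g"
  shows "holder_on \<alpha> S (\<lambda>u. f u + g u)"
proof -
  obtain L1 L2 where L: "\<And>u w. u \<in> S \<Longrightarrow> w \<in> S \<Longrightarrow> cmod (f u - f w) \<le> L1 * \<bar>u - w\<bar> powr \<alpha>"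
    "\<And>u w. u \<in> S \<Longrightarrow> w \<in> S \<Longrightarrow> cmod (g u - g w) \<le> L2 * \<bar>u - w\<bar> powr \<alpha>"
    using assms unfolding holder_on_def by metis
  show ?thesis
  proof (rule holder_onI[of _ _ "L1 + L2"])
    fix u w assume uw: "u \<in> S" "w \<in> S"
    have "cmod (f u + g u - (f w + g w)) = cmod ((f u - f w) + (g u - g w))"
      by (simp add: algebra_simps)
    also have "\<dots> \<le> cmod (f u - f w) + cmod (g u - g w)" by (rule norm_triangle_ineq)
    also have "\<dots> \<le> (L1 + L2) * \<bar>u - w\<bar> powr \<alpha>"
      using L[OF uw] by (simp add: algebra_simps)
    finally show "cmod (f u + g u - (f w + g w)) \<le> (L1 + L2) * \<bar>u - w\<bar> powr \<alpha>" .
  qed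
qed

lemma holder_on_bounded:
  assumes "holder_on \<alpha> S f" "bounded S" "\<alpha> \<ge> 0"
  obtains B where "B \<ge> 0" "\<And>u. u \<in> S \<Longrightarrow> cmod (f u) \<le> B"
proof (cases "S = {}")
  case True
  thus ?thesis using that[of 0] by auto
next
  case False
  then obtain w where w: "w \<in> S" by auto
  obtain L where L: "L \<ge> 0" "\<And>u w. u \<in> S \<Longrightarrow> w \<in> S \<Longrightarrow> cmod (f u - f w) \<le> L * \<bar>u - w\<bar> powr \<alpha>"
    using assms(1) unfolding holder_on_def by metis
  obtain D where D: "\<And>u. u \<in> S \<Longrightarrow> \<bar>u - w\<bar> \<le> D"
    using assms(2) by (metis bounded_any_center dist_real_def abs_minus_commute)
  have "cmod (f u) \<le> cmod (f w) + L * D powr \<alpha>" if u: "u \<in> S" for u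
  proof -
    have "cmod (f u) \<le> cmod (f w) + cmod (f u - f w)" by (metis norm_triangle_sub)
    also have "cmod (f u - f w) \<le> L * \<bar>u - w\<bar> powr \<alpha>" using L u w by blast
    also have "\<dots> \<le> L * D powr \<alpha>" using D[OF u] L assms(3) by (intro mult_left_mono powr_mono2) auto
    finally show ?thesis by simp
  qed
  thus ?thesis using L(1) by (intro that[of "cmod (f w) + L * D powr \<alpha>"]) auto
qed

text \<open>The product rule needs bounds for both factors, and a Hoelder function is bounded on a
  bounded set. For this reason products are formed on intervals and only the result is made
  periodic.\<close>

lemma holder_on_mult:
  assumes "holder_on \<alpha> S f" "holder_on \<alpha> S g" "bounded S" "\<alpha> \<ge> 0"
  shows "holder_on \<alpha> S (\<lambda>u. f u * g u)"
proof -
  obtain L1 L2 where L: "\<And>u w. u \<in> S \<Longrightarrow> w \<in> S \<Longrightarrow> cmod (f u - f w) \<le> L1 * \<bar>u - w\<bar> powr \<alpha>"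
    "\<And>u w. u \<in> S \<Longrightarrow> w \<in> S \<Longrightarrow> cmod (g u - g w) \<le> L2 * \<bar>u - w\<bar> powr \<alpha>"
    using assms unfolding holder_on_def by metis
  obtain B1 where B1: "B1 \<ge> 0" "\<And>u. u \<in> S \<Longrightarrow> cmod (f u) \<le> B1"
    using holder_on_bounded[OF assms(1,3,4)] by blast
  obtain B2 where B2: "B2 \<ge> 0" "\<And>u. u \<in> S \<Longrightarrow> cmod (g u) \<le> B2"
    using holder_on_bounded[OF assms(2,3,4)] by blast
  show ?thesis
  proof (rule holder_onI[of _ _ "L1 * B2 + B1 * L2"])
    fix u w assume uw: "u \<in> S" "w \<in> S"
    have "cmod (f u * g u - f w * g w) = cmod ((f u - f w) * g u + f w * (g u - g w))"
      by (simp add: algebra_simps)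
    also have "\<dots> \<le> cmod (f u - f w) * cmod (g u) + cmod (f w) * cmod (g u - g w)"
      by (metis norm_triangle_ineq norm_mult)
    also have "\<dots> \<le> (L1 * \<bar>u - w\<bar> powr \<alpha>) * B2 + B1 * (L2 * \<bar>u - w\<bar> powr \<alpha>)"
      using L[OF uw] B1 B2 uw by (intro add_mono mult_mono) (auto intro: order.trans[OF norm_ge_zero])
    finally show "cmod (f u * g u - f w * g w) \<le> (L1 * B2 + B1 * L2) * \<bar>u - w\<bar> powr \<alpha>"
      by (simp add: algebra_simps)
  qed
qed

lemma holder_on_sum:
  assumes "\<And>k. k \<in> I \<Longrightarrow> holder_on \<alpha> S (f k)"
  shows "holder_on \<alpha> S (\<lambda>u. \<Sum>k\<in>I. f k u)"
  using assms
proof (induction I rule: infinite_finite_induct)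
  case (insert x F)
  then show ?case using holder_on_add[of \<alpha> S "f x" "\<lambda>u. \<Sum>k\<in>F. f k u"] by auto
qed (auto intro: holder_on_const)

lemma holder_on_power:
  assumes "holder_on \<alpha> S f" "bounded S" "\<alpha> \<ge> 0"
  shows "holder_on \<alpha> S (\<lambda>u. f u ^ k)"
  by (induction k) (auto intro: holder_on_const holder_on_mult assms)

text \<open>On a bounded set the surplus factor \<open>\<bar>u - w\<bar> powr (1 - \<alpha>)\<close>
  is bounded by a power of the diameter. Here \<open>\<alpha> \<le> 1\<close> is essential.\<close>

lemma holder_on_lipschitz:
  assumes lip: "\<And>u w. u \<in> S \<Longrightarrow> w \<in> S \<Longrightarrow> cmod (f u - f w) \<le> L * \<bar>u - w\<bar>"
    and "bounded S" and \<alpha>: "0 < \<alpha>" "\<alpha> \<le> 1"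
  shows "holder_on \<alpha> S f"
proof (cases "S = {}")
  case True
  thus ?thesis by (auto simp: holder_on_def)
next
  case False
  then obtain x where x: "x \<in> S" by auto
  obtain D where D: "\<And>u. u \<in> S \<Longrightarrow> \<bar>u - x\<bar> \<le> D"
    using assms(2) by (metis bounded_any_center dist_real_def abs_minus_commute)
  show ?thesis
  proof (rule holder_onI[of _ _ "\<bar>L\<bar> * (2 * D) powr (1 - \<alpha>)"])
    fix u w assume uw: "u \<in> S" "w \<in> S"
    have d: "\<bar>u - w\<bar> \<le> 2 * D" using D[OF uw(1)] D[OF uw(2)] by linarith
    have "cmod (f u - f w) \<le> L * \<bar>u - w\<bar>" by (rule lip) fact+
    also have "\<dots> \<le> \<bar>L\<bar> * \<bar>u - w\<bar>" by (intro mult_right_mono) auto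
    also have "\<bar>u - w\<bar> = \<bar>u - w\<bar> powr (1 - \<alpha>) * \<bar>u - w\<bar> powr \<alpha>"
      by (auto simp flip: powr_add)
    also have "\<bar>L\<bar> * \<dots> \<le> \<bar>L\<bar> * ((2 * D) powr (1 - \<alpha>) * \<bar>u - w\<bar> powr \<alpha>)"
      using d \<alpha> by (intro mult_left_mono mult_right_mono powr_mono2) auto
    finally show "cmod (f u - f w) \<le> \<bar>L\<bar> * (2 * D) powr (1 - \<alpha>) * \<bar>u - w\<bar> powr \<alpha>"
      by (simp add: mult.assoc)
  qed
qed

lemma holder_on_C1:
  assumes der: "\<And>u. u \<in> {a..b} \<Longrightarrow> (f has_vector_derivative f' u) (at u within {a..b})"
    and cont: "continuous_on {a..b} f'" and \<alpha>: "0 < \<alpha>" "\<alpha> \<le> 1"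
  shows "holder_on \<alpha> {a..b} f"
proof -
  have "bounded (f' ` {a..b})"
    using cont by (intro compact_imp_bounded compact_continuous_image) auto
  then obtain L where L: "\<And>u. u \<in> {a..b} \<Longrightarrow> cmod (f' u) \<le> L"
    by (force simp: bounded_iff)
  show ?thesis
  proof (rule holder_on_lipschitz[of _ _ L])
    fix u w assume "u \<in> {a..b}" "w \<in> {a..b}"
    hence "norm (f u - f w) \<le> L * norm (u - w)"
      using der L
      by (intro differentiable_bound[of "{a..b}" f "\<lambda>x h. h *\<^sub>R f' x"])
         (auto simp: has_vector_derivative_def mult.commute[of L] intro!: onorm_le mult_left_mono)
    thus "cmod (f u - f w) \<le> L * \<bar>u - w\<bar>" by simp
  qed (use \<alpha> in auto)
qed

text \<open>Two points at distance at most 1 can be moved by one common integer into an interval of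
  length 2, which is why the estimate on \<open>{0..2}\<close> is assumed rather than on one period.
  For more distant points the fractional parts are closer together than the points
  themselves.\<close>

lemma holder_on_periodic_extension:
  assumes h: "holder_on \<alpha> {0..2} f" and \<alpha>: "0 < \<alpha>"
    and per: "\<And>u. u \<in> {0..1} \<Longrightarrow> f (u + 1) = f u"
  shows "holder_continuous \<alpha> (\<lambda>u. f (frac u))"
proof -
  obtain L where L: "L \<ge> 0" "\<And>u w. u \<in> {0..2} \<Longrightarrow> w \<in> {0..2} \<Longrightarrow> cmod (f u - f w) \<le> L * \<bar>u - w\<bar> powr \<alpha>"
    using h unfolding holder_on_def by metis
  have key: "cmod (f (frac u) - f (frac w)) \<le> L * \<bar>u - w\<bar> powr \<alpha>" if "u \<le> w" for u w :: real
  proof (cases "w - u \<le> 1")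
    case True
    define z where "z = frac u + (w - u)"
    have z: "z \<in> {0..2}" "frac u \<in> {0..2}"
      using True that frac_lt_1[of u] frac_ge_0[of u] by (auto simp: z_def)
    have fz: "frac w = frac z" using frac_unique_iff[of z "frac w"]
      by (auto simp: z_def frac_def)
    have "f (frac z) = f z"
    proof (cases "z < 1")
      case True
      thus ?thesis using z by (simp add: frac_eq)
    next
      case False
      hence *: "z - 1 \<in> {0..1}" using z by auto
      show ?thesis
      proof (cases "z = 2")
        case True
        have "f 1 = f 0" using per[of 0] by simp
        moreover have "f 2 = f 1" using per[of 1] by (simp add: one_add_one)
        ultimately show ?thesis using True by (simp add: frac_def)
      next
        case F: False
        hence "z - 1 < 1" using z by auto
        hence "frac (z - 1) = z - 1" using * by (simp add: frac_eq)
        hence "frac z = z - 1" by (simp add: frac_def)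
        moreover have "f (z - 1 + 1) = f (z - 1)" using * by (rule per)
        ultimately show ?thesis by simp
      qed
    qed
    hence "cmod (f (frac u) - f (frac w)) = cmod (f (frac u) - f z)" using fz by simp
    also have "\<dots> \<le> L * \<bar>frac u - z\<bar> powr \<alpha>" using L z by blast
    also have "\<bar>frac u - z\<bar> = \<bar>u - w\<bar>" by (simp add: z_def)
    finally show ?thesis .
  next
    case False
    have *: "frac u \<in> {0..2}" "frac w \<in> {0..2}" "\<bar>frac u - frac w\<bar> \<le> 1"
      using frac_lt_1[of u] frac_ge_0[of u] frac_lt_1[of w] frac_ge_0[of w]
      unfolding abs_le_iff atLeastAtMost_iff by linarith+
    have "cmod (f (frac u) - f (frac w)) \<le> L * \<bar>frac u - frac w\<bar> powr \<alpha>" using L * by blast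
    also have "\<dots> \<le> L * \<bar>u - w\<bar> powr \<alpha>" using * False \<alpha> L(1) by (intro mult_left_mono powr_mono2) auto
    finally show ?thesis .
  qed
  have "cmod (f (frac u) - f (frac w)) \<le> L * \<bar>u - w\<bar> powr \<alpha>" for u w
    using key[of u w] key[of w u] by (cases "u \<le> w") (auto simp: norm_minus_commute abs_minus_commute)
  thus ?thesis unfolding holder_continuous_def by blast
qed

lemma holder_continuous_sum:
  assumes "\<And>k. k \<in> I \<Longrightarrow> holder_continuous \<alpha> (f k)"
  shows "holder_continuous \<alpha> (\<lambda>u. \<Sum>k\<in>I. f k u)"
proof -
  have iff: "holder_continuous \<alpha> g \<longleftrightarrow> holder_on \<alpha> UNIV g" for g
    unfolding holder_continuous_def
    using holder_onI[of UNIV g _ \<alpha>] by (auto simp: holder_on_def)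
  show ?thesis using assms unfolding iff by (rule holder_on_sum)
qed

lemma holder_continuous_imp_continuous_on:
  assumes "holder_continuous \<alpha> f" "0 < \<alpha>"
  shows "continuous_on UNIV f"
proof -
  obtain L where L: "\<And>u w. cmod (f u - f w) \<le> L * \<bar>u - w\<bar> powr \<alpha>"
    using assms(1) unfolding holder_continuous_def by metis
  have "isCont f u" for u
  proof -
    have "((\<lambda>w. L * \<bar>w - u\<bar> powr \<alpha>) \<longlongrightarrow> L * \<bar>u - u\<bar> powr \<alpha>) (at u)"
      using assms(2) by (intro tendsto_intros) auto
    hence "((\<lambda>w. L * \<bar>w - u\<bar> powr \<alpha>) \<longlongrightarrow> 0) (at u)" by simp
    hence "((\<lambda>w. f w - f u) \<longlongrightarrow> 0) (at u)"
      by (rule Lim_null_comparison[rotated]) (use L in \<open>auto intro!: always_eventually\<close>)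
    thus ?thesis unfolding isCont_def by (simp add: LIM_zero_iff)
  qed
  thus ?thesis by (simp add: continuous_at_imp_continuous_on)
qed

subsection \<open>Real powers of a Jordan block\<close>

text \<open>The entry at distance \<open>p\<close> above the diagonal in the \<open>z\<close>-th power of a Jordan block;
  Vandermonde convolution makes these powers a one-parameter group.\<close>
definition jordan_coeff :: "complex \<Rightarrow> real \<Rightarrow> nat \<Rightarrow> complex" where
  "jordan_coeff lam z p = exp (of_real z * Ln lam) * (of_real z gchoose p) / lam ^ p"

lemma jordan_coeff_convolution:
  "(\<Sum>p\<le>n. jordan_coeff lam a p * jordan_coeff lam b (n - p)) = jordan_coeff lam (a + b) n"
proof -
  have "(\<Sum>p\<le>n. jordan_coeff lam a p * jordan_coeff lam b (n - p))
      = (\<Sum>p\<le>n. exp (of_real (a + b) * Ln lam) / lam ^ n *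
           ((of_real a gchoose p) * (of_real b gchoose (n - p))))"
    by (intro sum.cong refl)
       (auto simp: jordan_coeff_def field_simps exp_add simp flip: power_add)
  also have "\<dots> = exp (of_real (a + b) * Ln lam) / lam ^ n * (of_real (a + b) gchoose n)"
    using gbinomial_Vandermonde[of "complex_of_real a" "of_real b" n]
    by (simp only: sum_distrib_left[symmetric] atMost_atLeast0 of_real_add)
  finally show ?thesis by (simp add: jordan_coeff_def)
qed

lemma jordan_coeff_0: "jordan_coeff lam 0 p = (if p = 0 then 1 else 0)"
  by (cases p) (auto simp: jordan_coeff_def)

lemma jordan_coeff_1:
  assumes "lam \<noteq> 0"
  shows "jordan_coeff lam 1 p = (if p = 0 then lam else if p = 1 then 1 else 0)"
proof -
  have "(1::complex) gchoose p = of_nat (1 choose p)" using binomial_gbinomial[of 1 p, where ?'a=complex] by simp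
  thus ?thesis using assms by (auto simp: jordan_coeff_def binomial_eq_0)
qed

text \<open>The action of the \<open>z\<close>-th power of a Jordan block on a coordinate sequence.
  It behaves like a power only on sequences vanishing from index \<open>M\<close> on.\<close>

definition jordan_power :: "complex \<Rightarrow> nat \<Rightarrow> real \<Rightarrow> (nat \<Rightarrow> complex) \<Rightarrow> nat \<Rightarrow> complex" where
  "jordan_power lam M z f p = (\<Sum>k<M. jordan_coeff lam z k * f (p + k))"

lemma jordan_power_vanish:
  "(\<And>p. p \<ge> M \<Longrightarrow> f p = 0) \<Longrightarrow> p \<ge> M \<Longrightarrow> jordan_power lam M z f p = 0"
  by (auto simp: jordan_power_def)

text \<open>Since \<open>f\<close> vanishes from \<open>M\<close> on, the square of index pairs may
  be cut down to the triangle \<open>i + j < M\<close>; summing it along the diagonals produces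
  exactly the convolution of the coefficients.\<close>

lemma jordan_power_compose:
  assumes "\<And>p. p \<ge> M \<Longrightarrow> f p = 0"
  shows "jordan_power lam M a (jordan_power lam M b f) = jordan_power lam M (a + b) f"
proof
  fix p
  let ?g = "\<lambda>i j. jordan_coeff lam a i * jordan_coeff lam b j * f (p + i + j)"
  have "jordan_power lam M a (jordan_power lam M b f) p = (\<Sum>i<M. \<Sum>j<M. ?g i j)"
    by (simp add: jordan_power_def sum_distrib_left mult_ac)
  also have "\<dots> = (\<Sum>(i,j)\<in>{..<M}\<times>{..<M}. ?g i j)" by (rule sum.cartesian_product)
  also have "\<dots> = (\<Sum>(i,j)\<in>{(i,j). i + j < M}. ?g i j)"
    by (rule sum.mono_neutral_right) (auto intro!: assms)
  also have "\<dots> = (\<Sum>n<M. \<Sum>i\<le>n. ?g i (n - i))" by (rule sum.triangle_reindex)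
  also have "\<dots> = (\<Sum>n<M. (\<Sum>i\<le>n. jordan_coeff lam a i * jordan_coeff lam b (n - i)) * f (p + n))"
    by (simp add: sum_distrib_right)
  finally show "jordan_power lam M a (jordan_power lam M b f) p = jordan_power lam M (a + b) f p"
    by (simp add: jordan_coeff_convolution jordan_power_def)
qed

lemma jordan_power_0:
  assumes "\<And>p. p \<ge> M \<Longrightarrow> f p = 0"
  shows "jordan_power lam M 0 f = f"
proof
  fix p
  have "jordan_power lam M 0 f p = (\<Sum>k<M. if k = 0 then f p else 0)"
    unfolding jordan_power_def by (rule sum.cong) (auto simp: jordan_coeff_0)
  thus "jordan_power lam M 0 f p = f p" using assms[of p] by (cases "M = 0") (auto simp: sum.delta)
qed

lemma jordan_power_1:
  assumes "\<And>p. p \<ge> M \<Longrightarrow> f p = 0" "lam \<noteq> 0"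
  shows "jordan_power lam M 1 f = (\<lambda>p. lam * f p + f (Suc p))"
proof
  fix p
  have "jordan_power lam M 1 f p =
      (\<Sum>k<M. (if k = 0 then lam * f p else 0) + (if k = 1 then f (Suc p) else 0))"
    unfolding jordan_power_def by (rule sum.cong) (auto simp: jordan_coeff_1[OF assms(2)])
  also have "\<dots> = (if 0 < M then lam * f p else 0) + (if 1 < M then f (Suc p) else 0)"
    by (subst sum.distrib) (simp add: sum.delta)
  also have "\<dots> = lam * f p + f (Suc p)"
    using assms(1)[of p] assms(1)[of "Suc p"] by auto
  finally show "jordan_power lam M 1 f p = lam * f p + f (Suc p)" .
qed

lemma jordan_power_diff:
  "jordan_power lam M z (\<lambda>p. f p - g p) p = jordan_power lam M z f p - jordan_power lam M z g p"
  by (simp add: jordan_power_def algebra_simps sum_subtractf)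

text \<open>The numerator has \<open>p\<close> factors of modulus at most \<open>j + p\<close>, and
  dropping the factorial only enlarges the value. Polynomial growth in \<open>j\<close> is all that
  is wanted.\<close>

lemma gbinomial_neg_nat_bound: "cmod ((- of_nat j :: complex) gchoose p) \<le> (real j + real p) ^ p"
proof -
  have "cmod ((- of_nat j :: complex) gchoose p) = (\<Prod>i<p. cmod (- of_nat j - of_nat i)) / fact p"
    by (simp add: gbinomial_prod_rev norm_divide prod_norm atLeast0LessThan)
  also have "\<dots> \<le> (\<Prod>i<p. cmod (- of_nat j - of_nat i))"
    using prod_nonneg[of "{..<p}" "\<lambda>i. cmod (- of_nat j - of_nat i)"]
    by (simp add: divide_le_eq mult_le_cancel_left1 not_less)
  also have "\<dots> \<le> (\<Prod>i<p. real j + real p)"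
  proof (intro prod_mono conjI)
    fix i assume "i \<in> {..<p}"
    have "- of_nat j - of_nat i = (- of_nat (j + i) :: complex)" by simp
    hence "cmod (- of_nat j - of_nat i) = cmod (- of_nat (j + i))" by (rule arg_cong)
    also have "\<dots> = real (j + i)" by (metis norm_minus_cancel norm_of_nat)
    finally show "cmod (- of_nat j - of_nat i) \<le> real j + real p" using \<open>i \<in> {..<p}\<close> by simp
  qed auto
  finally show ?thesis by simp
qed

text \<open>The coefficient is \<open>1 / lam ^ j\<close> times a polynomial in \<open>j\<close>,
  and a polynomial loses against the ratio of \<open>\<theta>\<close> and \<open>cmod lam\<close>.
  The gap between the two is the source of the strict inequality in the Hoelder exponents.\<close>

lemma jordan_coeff_neg_bound:
  assumes \<theta>: "0 < \<theta>" "\<theta> < cmod lam"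
  obtains c where "c \<ge> 0" "\<And>j p. p < M \<Longrightarrow> cmod (jordan_coeff lam (- real j) p) \<le> c / \<theta> ^ j"
proof -
  have lam: "lam \<noteq> 0" using \<theta> by auto
  have "\<exists>c. \<forall>j. cmod (jordan_coeff lam (- real j) p) \<le> c / \<theta> ^ j" for p
  proof -
    \<comment> \<open>The quotient below 1 that beats the polynomial. The bound is applied at
      \<open>j + p\<close>, not at \<open>j\<close>, which accounts for the division by
      \<open>b ^ p\<close> below.\<close>
    define b where "b = \<theta> / cmod lam"
    have b: "0 < b" "b < 1" using \<theta> lam by (simp_all add: b_def divide_less_eq)
    obtain C where C: "\<And>x. b ^ x * of_nat x ^ p \<le> C" using poly_exp_bound[OF b, of p] by auto
    have "cmod (jordan_coeff lam (- real j) p) \<le> (C / b ^ p / cmod lam ^ p) / \<theta> ^ j" for j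
    proof -
      have e: "exp (of_real (- real j) * Ln lam) = 1 / lam ^ j"
        using lam by (simp add: exp_minus exp_of_nat_mult divide_inverse)
      have "cmod (jordan_coeff lam (- real j) p) =
          cmod ((- of_nat j :: complex) gchoose p) / cmod lam ^ p / cmod lam ^ j"
        unfolding jordan_coeff_def e by (simp add: norm_mult norm_divide norm_power)
      also have "\<dots> \<le> (real j + real p) ^ p / cmod lam ^ p / cmod lam ^ j"
        by (intro divide_right_mono gbinomial_neg_nat_bound) auto
      also have "\<dots> = (b ^ (j + p) * of_nat (j + p) ^ p) / b ^ p / cmod lam ^ p / \<theta> ^ j"
        using \<theta> by (simp add: b_def power_add power_divide)
      also have "\<dots> \<le> C / b ^ p / cmod lam ^ p / \<theta> ^ j"
        using C[of "j + p"] b \<theta> by (intro divide_right_mono) auto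
      finally show ?thesis .
    qed
    thus ?thesis by blast
  qed
  then obtain c where c: "\<And>p j. cmod (jordan_coeff lam (- real j) p) \<le> c p / \<theta> ^ j" by metis
  show ?thesis
  proof (rule that[of "\<Sum>p<M. \<bar>c p\<bar>"])
    fix j p assume "p < M"
    have "c p \<le> \<bar>c p\<bar>" by simp
    also have "\<dots> \<le> (\<Sum>p<M. \<bar>c p\<bar>)" using \<open>p < M\<close> by (intro member_le_sum) auto
    finally have "c p / \<theta> ^ j \<le> (\<Sum>p<M. \<bar>c p\<bar>) / \<theta> ^ j" using \<theta> by (intro divide_right_mono) auto
    thus "cmod (jordan_coeff lam (- real j) p) \<le> (\<Sum>p<M. \<bar>c p\<bar>) / \<theta> ^ j" using c[of j p] by linarith
  qed (auto intro: sum_nonneg)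
qed

text \<open>This converts the binomial coefficients in a Jordan power into the powers of
  \<open>log_q N\<close> that the asymptotic formula displays. The degree bound guarantees that no
  power beyond the block size occurs.\<close>

lemma gbinomial_power_basis:
  obtains c :: "nat \<Rightarrow> complex" where "\<And>u. u gchoose p = (\<Sum>k\<le>p. c k * u ^ k)"
proof -
  have "\<exists>P :: complex poly. Polynomial.degree P \<le> p \<and> (\<forall>u. u gchoose p = poly P u)"
  proof (induction p)
    case 0
    show ?case by (intro exI[of _ 1]) auto
  next
    case (Suc p)
    then obtain P :: "complex poly" where P: "Polynomial.degree P \<le> p" "\<And>u. u gchoose p = poly P u" by auto
    let ?Q = "Polynomial.smult (1 / of_nat (Suc p)) (P * [:- of_nat p, 1:])"
    have "Polynomial.degree ?Q \<le> Suc p"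
      using degree_mult_le[of P "[:- of_nat p, 1:]"] P(1) by (auto intro: order.trans[OF degree_smult_le])
    moreover have "u gchoose Suc p = poly ?Q u" for u
    proof -
      have "of_nat (Suc p) * (u gchoose Suc p) = (u gchoose p) * (u - of_nat p)"
        using gbinomial_mult_1[of u p] by (simp add: algebra_simps)
      thus ?thesis by (simp add: P(2) field_simps del: of_nat_Suc)
    qed
    ultimately show ?case by blast
  qed
  then obtain P :: "complex poly" where P: "Polynomial.degree P \<le> p" "\<And>u. u gchoose p = poly P u" by auto
  have "u gchoose p = (\<Sum>k\<le>p. Polynomial.coeff P k * u ^ k)" for u
    unfolding P(2) poly_altdef using P(1)
    by (intro sum.mono_neutral_left) (auto simp: coeff_eq_0)
  thus ?thesis by (rule that)
qed

lemma jordan_coeff_holder: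
  assumes "0 < \<alpha>" "\<alpha> \<le> 1"
  shows "holder_on \<alpha> {a..b} (\<lambda>u. jordan_coeff lam (- u) p)"
proof -
  obtain c :: "nat \<Rightarrow> complex" where c: "\<And>u. u gchoose p = (\<Sum>k\<le>p. c k * u ^ k)"
    using gbinomial_power_basis by blast
  have b: "bounded {a..b}" "\<alpha> \<ge> 0" using assms by auto
  have e: "holder_on \<alpha> {a..b} (\<lambda>u. exp (of_real (- u) * Ln lam))"
  proof (rule holder_on_C1)
    show "((\<lambda>u. exp (of_real (- u) * Ln lam)) has_vector_derivative exp (of_real (- u) * Ln lam) * (- Ln lam)) (at u within {a..b})" for u
      using exp_scaleR_has_vector_derivative_right[of "- Ln lam" u "{a..b}"]
      by (simp add: scaleR_conv_of_real)
  qed (use assms in \<open>auto intro!: continuous_intros\<close>)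
  have u: "holder_on \<alpha> {a..b} (\<lambda>u. complex_of_real (- u))"
    by (rule holder_on_lipschitz[where L = 1])
       (use assms in \<open>auto simp flip: of_real_minus of_real_diff of_real_add simp del: of_real_add of_real_diff of_real_minus\<close>)
  have "holder_on \<alpha> {a..b} (\<lambda>u. exp (of_real (- u) * Ln lam) * (\<Sum>k\<le>p. c k * complex_of_real (- u) ^ k) * (1 / lam ^ p))"
    by (intro holder_on_mult holder_on_sum holder_on_power holder_on_const e u b)
  thus ?thesis unfolding jordan_coeff_def by (simp add: c)
qed

subsection \<open>Recursive chains\<close>

text \<open>Since \<open>q powr \<rho> = R\<close>, the number \<open>R ^ l\<close> is the value of
  the power function at \<open>q ^ l\<close>. The two \<open>max\<close> factors treat growing
  (\<open>R \<ge> 1\<close>) and decaying (\<open>R < 1\<close>) powers at once.\<close>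

lemma power_powr_compare:
  fixes q N l :: nat
  assumes "q \<ge> 2" "R > 0" "q ^ l \<le> N" "N < q ^ Suc l"
  shows "R ^ l \<le> max 1 (1 / R) * real N powr (ln R / ln (real q))"
    and "real N powr (ln R / ln (real q)) \<le> max 1 R * R ^ l"
proof -
  define \<rho> where "\<rho> = ln R / ln (real q)"
  have q: "real q powr \<rho> = R" using assms by (simp add: powr_def \<rho>_def)
  have e: "(real q ^ k) powr \<rho> = R ^ k" for k
    using assms by (simp add: powr_powr powr_power mult.commute flip: q powr_realpow)
  have N: "real q ^ l \<le> real N" "real N \<le> real q ^ Suc l"
    using assms(3,4) by (metis of_nat_le_iff of_nat_power, metis less_imp_le of_nat_le_iff of_nat_power)
  have qp: "real q ^ k > 0" for k using assms(1) by simp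
  have Np: "real N > 0" using N(1) qp[of l] by linarith
  have "R ^ l \<le> max 1 (1 / R) * real N powr \<rho> \<and> real N powr \<rho> \<le> max 1 R * R ^ l"
  proof (cases "R \<ge> 1")
    case True
    hence r: "\<rho> \<ge> 0" using assms by (simp add: \<rho>_def)
    have "R ^ l \<le> real N powr \<rho>" "real N powr \<rho> \<le> R ^ Suc l"
      unfolding e[symmetric] using N r qp Np by (intro powr_mono2; simp)+
    moreover have "max 1 (1 / R) = 1" "max 1 R = R" using True by (auto simp: max_def)
    ultimately show ?thesis by simp
  next
    case False
    hence r: "\<rho> \<le> 0" using assms by (simp add: \<rho>_def divide_le_0_iff)
    have "real N powr \<rho> \<le> R ^ l" "R ^ Suc l \<le> real N powr \<rho>"
      unfolding e[symmetric] using N r qp Np by (intro powr_mono2'; simp)+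
    thus ?thesis using False assms by (simp add: max_def field_simps)
  qed
  thus "R ^ l \<le> max 1 (1 / R) * real N powr (ln R / ln (real q))"
    "real N powr (ln R / ln (real q)) \<le> max 1 R * R ^ l"
    by (auto simp: \<rho>_def)
qed

lemma geometric_increments_limit:
  fixes a :: "nat \<Rightarrow> complex"
  assumes "\<And>j. cmod (a (Suc j) - a j) \<le> D * x ^ j" "0 < x" "x < 1"
  shows "a \<longlonglongrightarrow> lim a" "cmod (lim a - a j) \<le> D / (1 - x) * x ^ j"
proof -
  have geo: "(\<lambda>n. D * x ^ (n + j)) sums (D / (1 - x) * x ^ j)" for j
  proof -
    have "(\<lambda>n. D * x ^ j * x ^ n) sums (D * x ^ j * (1 / (1 - x)))"
      using assms(2,3) by (intro sums_mult geometric_sums) auto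
    thus ?thesis by (simp add: power_add mult_ac)
  qed
  define d where "d n = a (Suc n) - a n" for n
  have sm: "summable (\<lambda>n. norm (d (n + j)))" for j
    by (rule summable_comparison_test[OF _ sums_summable[OF geo[of j]]])
       (use assms(1) in \<open>auto simp: d_def\<close>)
  have tel: "(\<Sum>n<k. d (n + j)) = a (k + j) - a j" for k j
    by (induction k) (auto simp: d_def)
  have "(\<lambda>k. (\<Sum>n<k. d (n + j))) \<longlonglongrightarrow> (\<Sum>n. d (n + j))" for j
    using summable_LIMSEQ[OF summable_norm_cancel[OF sm[of j]]] .
  hence t: "(\<lambda>k. a (k + j) - a j) \<longlonglongrightarrow> (\<Sum>n. d (n + j))" for j unfolding tel .
  from tendsto_add[OF t[of 0] tendsto_const[of "a 0"]]
  have "convergent a" by (auto simp: convergent_def)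
  thus lim: "a \<longlonglongrightarrow> lim a" by (simp add: convergent_LIMSEQ_iff)
  have "(\<lambda>k. a (k + j) - a j) \<longlonglongrightarrow> lim a - a j"
    by (intro tendsto_intros LIMSEQ_ignore_initial_segment lim)
  hence eq: "lim a - a j = (\<Sum>n. d (n + j))" using t LIMSEQ_unique by blast
  have "cmod (\<Sum>n. d (n + j)) \<le> (\<Sum>n. norm (d (n + j)))" by (rule summable_norm[OF sm])
  also have "\<dots> \<le> (\<Sum>n. D * x ^ (n + j))"
    by (rule suminf_le[OF _ sm sums_summable[OF geo]]) (use assms(1) in \<open>auto simp: d_def\<close>)
  also have "\<dots> = D / (1 - x) * x ^ j" using geo sums_unique by metis
  finally show "cmod (lim a - a j) \<le> D / (1 - x) * x ^ j" unfolding eq .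
qed

text \<open>\<open>y 0, \<dots>, y (M - 1)\<close> are the coordinates belonging to one Jordan block of size \<open>M\<close>,
  padded by zeros so that the index \<open>p\<close> needs no bound.\<close>
locale jordan_chain =
  fixes q :: nat and R :: real and lam :: complex and M :: nat and K :: real
    and y :: "nat \<Rightarrow> nat \<Rightarrow> complex"
  assumes q: "q \<ge> 2" and R: "R > 0"
    and trunc: "\<And>p N. p \<ge> M \<Longrightarrow> y p N = 0"
    and exact: "\<And>p N. y p (q * N) = lam * y p N + y (Suc p) N"
    and step: "\<And>p N r. r < q \<Longrightarrow>
      cmod (y p (q * N + r) - (lam * y p N + y (Suc p) N)) \<le> K * real (max 1 N) powr (ln R / ln (real q))"
    and incr: "\<And>p N. cmod (y p (Suc N) - y p N) \<le> K * real (max 1 N) powr (ln R / ln (real q))"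
begin

abbreviation "\<rho> \<equiv> ln R / ln (real q)"

lemma K_nonneg: "K \<ge> 0"
proof -
  have "0 \<le> K * real (max 1 0) powr \<rho>" using incr[of 0 0] norm_ge_zero order.trans by blast
  thus ?thesis by simp
qed

text \<open>Two nested inductions: downwards along the block, where \<open>y (Suc p)\<close> acts as
  an inhomogeneity, and on the number of digits. If \<open>cmod lam < R\<close>, the inhomogeneities
  sum like a geometric series; if \<open>cmod lam = R\<close>, all of them have the same weight and
  each step along the block costs one factor \<open>l + 1\<close>.\<close>

lemma small_eigenvalue_digit_bound:
  assumes "cmod lam \<le> R"
  shows "\<exists>c\<ge>0. \<forall>l N. q ^ l \<le> N \<and> N < q ^ Suc l \<longrightarrow>
    cmod (y p N) \<le> c * R ^ l * (real l + 1) ^ (if cmod lam = R then M - p else 0)"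
proof (induction "M - p" arbitrary: p)
  case 0
  thus ?case using trunc[of p] R by (intro exI[of _ 0]) auto
next
  case (Suc n)
  have n: "n = M - Suc p" using Suc(2) by simp
  obtain c1 where c1: "c1 \<ge> 0" "\<And>l N. q ^ l \<le> N \<Longrightarrow> N < q ^ Suc l \<Longrightarrow>
    cmod (y (Suc p) N) \<le> c1 * R ^ l * (real l + 1) ^ (if cmod lam = R then n else 0)"
    using Suc(1)[OF n] unfolding n[symmetric] by blast
  have Mp: "M - p = Suc n" using Suc(2) by simp
  \<comment> \<open>\<open>B\<close> covers the one-digit arguments, the start of the induction on
    \<open>l\<close>; \<open>K1\<close> is the error of one step measured by \<open>R ^ l\<close>
    instead of a power of \<open>N\<close>.\<close>
  define B where "B = (\<Sum>N<q. cmod (y p N))"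
  define K1 where "K1 = K * max 1 R"
  have B: "cmod (y p N) \<le> B" if "N < q" for N unfolding B_def using that by (intro member_le_sum) auto
  have B0: "B \<ge> 0" unfolding B_def by (intro sum_nonneg) auto
  have K1: "K1 \<ge> 0" using K_nonneg by (simp add: K1_def)
  have rec: "cmod (y p N) \<le> cmod lam * cmod (y p (N div q)) + cmod (y (Suc p) (N div q)) + K1 * R ^ l"
    if "q ^ l \<le> N div q" "N div q < q ^ Suc l" for l N
  proof -
    define E where "E = y p (q * (N div q) + N mod q) - (lam * y p (N div q) + y (Suc p) (N div q))"
    have E: "cmod E \<le> K * real (max 1 (N div q)) powr \<rho>"
      unfolding E_def by (rule step) (use q in auto)
    have "y p N = lam * y p (N div q) + y (Suc p) (N div q) + E" by (simp add: E_def)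
    hence "cmod (y p N) \<le> cmod (lam * y p (N div q)) + cmod (y (Suc p) (N div q)) + cmod E"
      using norm_triangle_ineq[of "lam * y p (N div q) + y (Suc p) (N div q)" E]
        norm_triangle_ineq[of "lam * y p (N div q)" "y (Suc p) (N div q)"] by simp
    also have "\<dots> \<le> cmod lam * cmod (y p (N div q)) + cmod (y (Suc p) (N div q)) +
        K * real (max 1 (N div q)) powr \<rho>"
      using E by (simp add: norm_mult)
    also have "max 1 (N div q) = N div q" using that(1) q order.trans[of 1 "q ^ l" "N div q"] by simp
    also have "K * real (N div q) powr \<rho> \<le> K1 * R ^ l"
      using mult_left_mono[OF power_powr_compare(2)[OF q R that] K_nonneg] by (simp add: K1_def mult.assoc)
    finally show ?thesis by simp
  qed
  have div: "q ^ l \<le> N div q \<and> N div q < q ^ Suc l" if "q ^ Suc l \<le> N" "N < q ^ Suc (Suc l)" for l N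
    using that q by (simp add: less_eq_div_iff_mult_less_eq div_less_iff_less_mult mult.commute)
  show ?case
  proof (cases "cmod lam = R")
    case True
    \<comment> \<open>With this constant the new contribution is at most
      \<open>c * R ^ Suc l * (l + 1) ^ n\<close>, which raises one factor \<open>l + 1\<close> to
      \<open>l + 2\<close>.\<close>
    define c where "c = max B ((c1 + K1) / R)"
    have c: "c \<ge> B" "(c1 + K1) / R \<le> c" by (auto simp: c_def)
    hence c: "c \<ge> B" "c1 + K1 \<le> c * R" "c \<ge> 0" using B0 R by (simp_all add: divide_le_eq)
    have "\<forall>N. q ^ l \<le> N \<and> N < q ^ Suc l \<longrightarrow> cmod (y p N) \<le> c * R ^ l * (real l + 1) ^ Suc n" for l
    proof (induction l)
      case 0
      show ?case using B c by fastforce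
    next
      case (Suc l)
      show ?case
      proof (intro allI impI)
        fix N assume N: "q ^ Suc l \<le> N \<and> N < q ^ Suc (Suc l)"
        note d = div[OF conjunct1[OF N] conjunct2[OF N]]
        have "cmod (y p N) \<le> R * cmod (y p (N div q)) + cmod (y (Suc p) (N div q)) + K1 * R ^ l"
          using rec d True by metis
        also have "\<dots> \<le> R * (c * R ^ l * (real l + 1) ^ Suc n) + c1 * R ^ l * (real l + 1) ^ n
            + K1 * R ^ l * (real l + 1) ^ n"
        proof (intro add_mono mult_left_mono)
          show "cmod (y (Suc p) (N div q)) \<le> c1 * R ^ l * (real l + 1) ^ n"
            using c1(2)[of l "N div q"] d True by simp
          show "K1 * R ^ l \<le> K1 * R ^ l * (real l + 1) ^ n"
            using K1 R mult_left_mono[of 1 "(real l + 1) ^ n" "K1 * R ^ l"] by simp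
        qed (use Suc d R in auto)
        also have "\<dots> = c * R ^ Suc l * (real l + 1) ^ Suc n + (c1 + K1) * (R ^ l * (real l + 1) ^ n)"
          by (simp add: algebra_simps)
        also have "\<dots> \<le> c * R ^ Suc l * (real l + 1) ^ Suc n + (c * R) * (R ^ l * (real l + 1) ^ n)"
          using c R by (intro add_left_mono mult_right_mono) auto
        also have "\<dots> = c * R ^ Suc l * ((real l + 2) * (real l + 1) ^ n)"
          by (simp add: algebra_simps)
        also have "\<dots> \<le> c * R ^ Suc l * ((real l + 2) * (real l + 2) ^ n)"
          using c R by (intro mult_left_mono power_mono) auto
        finally show "cmod (y p N) \<le> c * R ^ Suc l * (real (Suc l) + 1) ^ Suc n"
          by (simp add: algebra_simps)
      qed
    qed
    thus ?thesis using c True Mp by auto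
  next
    case False
    hence lR: "cmod lam < R" using assms by simp
    \<comment> \<open>Chosen as a fixed point bound:
      \<open>cmod lam * c + (c1 + K1) \<le> c * R\<close>, so the induction reproduces the same
      constant.\<close>
    define c where "c = max B ((c1 + K1) / (R - cmod lam))"
    have c: "c \<ge> B" "(c1 + K1) / (R - cmod lam) \<le> c" by (auto simp: c_def)
    hence c: "c \<ge> B" "c1 + K1 \<le> c * (R - cmod lam)" "c \<ge> 0" using B0 lR
      by (simp_all add: divide_le_eq)
    have "\<forall>N. q ^ l \<le> N \<and> N < q ^ Suc l \<longrightarrow> cmod (y p N) \<le> c * R ^ l" for l
    proof (induction l)
      case 0
      show ?case using B c by fastforce
    next
      case (Suc l)
      show ?case
      proof (intro allI impI)
        fix N assume N: "q ^ Suc l \<le> N \<and> N < q ^ Suc (Suc l)"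
        note d = div[OF conjunct1[OF N] conjunct2[OF N]]
        have "cmod (y p N) \<le> cmod lam * cmod (y p (N div q)) + cmod (y (Suc p) (N div q)) + K1 * R ^ l"
          using rec d by metis
        also have "\<dots> \<le> cmod lam * (c * R ^ l) + c1 * R ^ l + K1 * R ^ l"
          using Suc d c1(2)[of l "N div q"] False K1 by (intro add_mono mult_left_mono) auto
        also have "\<dots> = (cmod lam * c + (c1 + K1)) * R ^ l" by (simp add: algebra_simps)
        also have "\<dots> \<le> (cmod lam * c + c * (R - cmod lam)) * R ^ l"
          using c R by (intro mult_right_mono) auto
        finally show "cmod (y p N) \<le> c * R ^ Suc l" by (simp add: algebra_simps)
      qed
    qed
    thus ?thesis using c False by auto
  qed
qed

text \<open>For \<open>N \<ge> 3\<close> the logarithm is at least 1, so the digit count is bounded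
  by a multiple of \<open>ln N\<close> and the exponent may be enlarged from \<open>M - p\<close> to
  \<open>M\<close>.\<close>

lemma small_eigenvalue_bound:
  assumes "cmod lam \<le> R"
  shows "\<exists>c\<ge>0. \<forall>N\<ge>3. cmod (y p N) \<le> c * real N powr \<rho> * ln (real N) ^ (if cmod lam = R then M else 0)"
proof -
  define e where "e = (if cmod lam = R then M - p else 0)"
  define e' where "e' = (if cmod lam = R then M else 0)"
  obtain c where c: "c \<ge> 0" "\<And>l N. q ^ l \<le> N \<Longrightarrow> N < q ^ Suc l \<Longrightarrow>
    cmod (y p N) \<le> c * R ^ l * (real l + 1) ^ e"
    using small_eigenvalue_digit_bound[OF assms, of p] unfolding e_def by blast
  define A where "A = 1 / ln (real q) + 1"
  have lnq: "ln (real q) > 0" using q by simp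
  have A: "A \<ge> 1" using lnq by (simp add: A_def)
  show ?thesis unfolding e'_def[symmetric]
  proof (intro exI[of _ "c * max 1 (1 / R) * A ^ e"] conjI allI impI)
    fix N :: nat assume N: "N \<ge> 3"
    obtain l where l: "q ^ l \<le> N" "N < q ^ Suc l" using ex_power_ivl1[of q N] q N by auto
    have lnN: "ln (real N) \<ge> 1"
    proof -
      have "exp 1 \<le> (3::real)" using exp_le by simp
      also have "3 \<le> real N" using N by simp
      finally show ?thesis using N by (subst ln_ge_iff) auto
    qed
    have "real l * ln (real q) = ln (real (q ^ l))" using q by (simp add: ln_realpow)
    also have "\<dots> \<le> ln (real N)" using l(1) q N by (subst ln_le_cancel_iff) auto
    finally have "real l \<le> ln (real N) / ln (real q)" using lnq by (simp add: field_simps)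
    hence "real l + 1 \<le> A * ln (real N)" using lnN by (simp add: A_def algebra_simps)
    hence "(real l + 1) ^ e \<le> (A * ln (real N)) ^ e" by (intro power_mono) auto
    also have "\<dots> = A ^ e * ln (real N) ^ e" by (rule power_mult_distrib)
    also have "\<dots> \<le> A ^ e * ln (real N) ^ e'"
      using lnN A by (intro mult_left_mono power_increasing) (auto simp: e_def e'_def)
    finally have le: "(real l + 1) ^ e \<le> A ^ e * ln (real N) ^ e'" .
    have "cmod (y p N) \<le> c * R ^ l * (real l + 1) ^ e" using c(2) l by blast
    also have "\<dots> \<le> c * (max 1 (1 / R) * real N powr \<rho>) * (A ^ e * ln (real N) ^ e')"
      using c(1) R A lnN le power_powr_compare(1)[OF q R l] by (intro mult_mono) auto
    finally show "cmod (y p N) \<le> c * max 1 (1 / R) * A ^ e * real N powr \<rho> * ln (real N) ^ e'"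
      by (simp add: mult_ac)
  qed (use c A in auto)
qed

end

text \<open>Dropping the last base-\<open>q\<close> digit commutes with scaling, hence the arguments
  of consecutive levels are linked by one step of the recursion.\<close>

lemma nat_floor_scale:
  fixes t :: real
  assumes "t \<ge> 0" "q \<ge> (1::nat)"
  shows "nat \<lfloor>t\<rfloor> = nat \<lfloor>real q * t\<rfloor> div q"
proof -
  have "nat \<lfloor>real q * t / real q\<rfloor> = nat \<lfloor>real q * t\<rfloor> div q"
    using floor_divide_real_eq_div[of "int q" "real q * t"] assms by (simp add: nat_div_distrib)
  thus ?thesis using assms by simp
qed

text \<open>Rounding down changes \<open>x \<ge> 1\<close> by a factor of at most 2. This matters
  for negative \<open>a\<close>, where rounding down enlarges the power.\<close>

lemma nat_floor_powr_bound:
  fixes x a :: real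
  assumes "x \<ge> 1"
  shows "real (max 1 (nat \<lfloor>x\<rfloor>)) powr a \<le> 2 powr \<bar>a\<bar> * x powr a"
proof -
  define n where "n = real (nat \<lfloor>x\<rfloor>)"
  have n: "n \<ge> 1" "n \<le> x" "x \<le> 2 * n"
  proof -
    have f: "n = of_int \<lfloor>x\<rfloor>" "\<lfloor>x\<rfloor> \<ge> 1" using assms by (auto simp: n_def)
    hence i: "1 \<le> n" by simp
    thus "n \<ge> 1" "n \<le> x" "x \<le> 2 * n"
      using real_of_int_floor_add_one_gt[of x] of_int_floor_le[of x] unfolding f(1) by linarith+
  qed
  have "n powr a \<le> 2 powr \<bar>a\<bar> * x powr a"
  proof (cases "a \<ge> 0")
    case True
    have "1 * n powr a \<le> 2 powr \<bar>a\<bar> * x powr a"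
      using n True by (intro mult_mono powr_mono2 ge_one_powr_ge_zero) auto
    thus ?thesis by simp
  next
    case False
    have "n powr a \<le> (x / 2) powr a" using n False by (intro powr_mono2') auto
    also have "\<dots> = 2 powr (- a) * x powr a" using assms
      by (simp add: powr_divide powr_minus_divide)
    also have "- a = \<bar>a\<bar>" using False by simp
    finally show ?thesis .
  qed
  moreover have "real (max 1 (nat \<lfloor>x\<rfloor>)) = n" using n(1) by (simp add: n_def max_def)
  ultimately show ?thesis by simp
qed

context jordan_chain
begin

lemma powr_q_rho: "real q powr \<rho> = R"
  using q R by (simp add: powr_def)

definition level :: "nat \<Rightarrow> real \<Rightarrow> nat \<Rightarrow> complex" where
  "level j t = (\<lambda>p. y p (nat \<lfloor>t * real q ^ j\<rfloor>))"

definition approx :: "nat \<Rightarrow> real \<Rightarrow> nat \<Rightarrow> complex" where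
  "approx j t = jordan_power lam M (- real j) (level j t)"

text \<open>Convergence is shown for \<open>t \<ge> 1\<close>, in \<open>G_rate\<close>; the
  statements that interpret this limit are restricted to that range.\<close>

definition G :: "nat \<Rightarrow> real \<Rightarrow> complex" where
  "G p t = lim (\<lambda>j. approx j t p)"

lemma level_vanish: "p \<ge> M \<Longrightarrow> level j t p = 0"
  by (simp add: level_def trunc)

lemma approx_vanish: "p \<ge> M \<Longrightarrow> approx j t p = 0"
  unfolding approx_def by (rule jordan_power_vanish[OF level_vanish])

lemma G_vanish: "p \<ge> M \<Longrightarrow> G p t = 0"
  by (simp add: G_def approx_vanish)

lemma jordan_power_neg_bound:
  assumes "0 < \<theta>" "\<theta> < cmod lam"
  shows "\<exists>c\<ge>0. \<forall>j f B p. (\<forall>k. cmod (f k) \<le> B) \<longrightarrow> cmod (jordan_power lam M (- real j) f p) \<le> c * B / \<theta> ^ j"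
proof -
  obtain c where c: "c \<ge> 0" "\<And>j p. p < M \<Longrightarrow> cmod (jordan_coeff lam (- real j) p) \<le> c / \<theta> ^ j"
    using jordan_coeff_neg_bound[OF assms, of M] by blast
  have "cmod (jordan_power lam M (- real j) f p) \<le> real M * c * B / \<theta> ^ j"
    if f: "\<forall>k. cmod (f k) \<le> B" for j f B p
  proof -
    have "cmod (jordan_power lam M (- real j) f p) \<le> (\<Sum>k<M. cmod (jordan_coeff lam (- real j) k * f (p + k)))"
      unfolding jordan_power_def by (rule norm_sum)
    also have "\<dots> \<le> (\<Sum>k<M. c / \<theta> ^ j * B)"
      unfolding norm_mult using f c assms by (intro sum_mono mult_mono) auto
    finally show ?thesis by (simp add: mult_ac)
  qed
  thus ?thesis using c(1) by (intro exI[of _ "real M * c"]) auto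
qed

lemma floor_bound:
  assumes "t \<ge> 1"
  shows "real (max 1 (nat \<lfloor>t * real q ^ j\<rfloor>)) powr \<rho> \<le> 2 powr \<bar>\<rho>\<bar> * t powr \<rho> * R ^ j"
proof -
  have x: "1 \<le> t * real q ^ j" using assms q mult_mono[of 1 t 1 "real q ^ j"] by simp
  have "(t * real q ^ j) powr \<rho> = t powr \<rho> * (real q powr \<rho>) ^ j"
    using assms q by (simp add: powr_mult powr_powr powr_power mult.commute flip: powr_realpow)
  thus ?thesis using nat_floor_powr_bound[OF x, of \<rho>] by (simp add: powr_q_rho mult.assoc)
qed

end

section \<open>Eigenvalues of modulus greater than R: the limit function, its regularity and its
  periodic factor\<close>

locale large_jordan_chain = jordan_chain +
  assumes large: "cmod lam > R"
begin

lemma lam_nonzero: "lam \<noteq> 0" using large R by auto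

text \<open>Writing level \<open>j\<close> with the exponent of level \<open>j + 1\<close> turns the
  increment of \<open>approx\<close> into one negative Jordan power applied to the error of the
  recursion.\<close>

lemma approx_shift:
  "approx j t = jordan_power lam M (- real (Suc j)) (\<lambda>p. lam * level j t p + level j t (Suc p))"
proof -
  have "jordan_power lam M (- real (Suc j)) (jordan_power lam M 1 (level j t)) = approx j t"
    unfolding approx_def by (subst jordan_power_compose[OF level_vanish]) auto
  thus ?thesis by (subst (asm) jordan_power_1[OF level_vanish lam_nonzero]) auto
qed

lemma level_step:
  assumes "t \<ge> 1"
  shows "cmod (level (Suc j) t p - (lam * level j t p + level j t (Suc p)))
    \<le> K * 2 powr \<bar>\<rho>\<bar> * t powr \<rho> * R ^ j"
proof -
  define N where "N = nat \<lfloor>t * real q ^ j\<rfloor>"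
  define N' where "N' = nat \<lfloor>t * real q ^ Suc j\<rfloor>"
  have "N = N' div q" using nat_floor_scale[of "t * real q ^ j" q] assms q
    by (simp add: N_def N'_def mult_ac)
  hence "N' = q * N + N' mod q" by simp
  moreover have "cmod (y p (q * N + N' mod q) - (lam * y p N + y (Suc p) N)) \<le> K * real (max 1 N) powr \<rho>"
    using q by (intro step) simp
  moreover have "K * real (max 1 N) powr \<rho> \<le> K * (2 powr \<bar>\<rho>\<bar> * t powr \<rho> * R ^ j)"
    unfolding N_def by (intro mult_left_mono floor_bound assms K_nonneg)
  ultimately have "cmod (y p N' - (lam * y p N + y (Suc p) N)) \<le> K * (2 powr \<bar>\<rho>\<bar> * t powr \<rho> * R ^ j)"
    by simp
  thus ?thesis by (simp add: level_def N_def N'_def mult.assoc)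
qed

text \<open>The recursion error at level \<open>j\<close> is of order
  \<open>t powr \<rho> * R ^ j\<close>, while the Jordan power contributes
  \<open>1 / \<theta> ^ j\<close>. As \<open>R < \<theta>\<close>, the increments decay
  geometrically.\<close>

lemma G_rate:
  assumes "R < \<theta>" "\<theta> < cmod lam"
  shows "\<exists>c\<ge>0. \<forall>t\<ge>1. \<forall>j p. cmod (G p t - approx j t p) \<le> c * t powr \<rho> * (R / \<theta>) ^ j"
    and "t \<ge> 1 \<Longrightarrow> (\<lambda>j. approx j t p) \<longlonglongrightarrow> G p t"
proof -
  have \<theta>: "0 < \<theta>" using assms R by simp
  obtain c where c: "c \<ge> 0" "\<And>j f B p. (\<forall>k. cmod (f k) \<le> B) \<Longrightarrow>
      cmod (jordan_power lam M (- real j) f p) \<le> c * B / \<theta> ^ j"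
    using jordan_power_neg_bound[OF \<theta> assms(2)] by blast
  \<comment> \<open>The division by \<open>\<theta>\<close> comes from the exponent
    \<open>Suc j\<close> in the increment between levels \<open>j\<close> and
    \<open>Suc j\<close>.\<close>
  define D where "D = c * (K * 2 powr \<bar>\<rho>\<bar>) / \<theta>"
  have D: "D \<ge> 0" using c K_nonneg \<theta> by (simp add: D_def)
  have x: "0 < R / \<theta>" "R / \<theta> < 1" using assms R \<theta> by auto
  have inc: "cmod (approx (Suc j) t p - approx j t p) \<le> D * t powr \<rho> * (R / \<theta>) ^ j" if t: "t \<ge> 1" for j t p
  proof -
    have "approx (Suc j) t p - approx j t p = jordan_power lam M (- real (Suc j))
       (\<lambda>p. level (Suc j) t p - (lam * level j t p + level j t (Suc p))) p"
      unfolding approx_shift[of j t] approx_def[of "Suc j" t] jordan_power_diff ..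
    also have "cmod \<dots> \<le> c * (K * 2 powr \<bar>\<rho>\<bar> * t powr \<rho> * R ^ j) / \<theta> ^ Suc j"
      by (intro c(2) allI level_step t)
    also have "\<dots> = D * t powr \<rho> * (R / \<theta>) ^ j" by (simp add: D_def power_divide)
    finally show ?thesis .
  qed
  have lim: "(\<lambda>j. approx j t p) \<longlonglongrightarrow> lim (\<lambda>j. approx j t p)"
    "cmod (lim (\<lambda>j. approx j t p) - approx j t p) \<le> D * t powr \<rho> / (1 - R / \<theta>) * (R / \<theta>) ^ j"
    if t: "t \<ge> 1" for t p j
    using geometric_increments_limit[where a = "\<lambda>j. approx j t p" and D = "D * t powr \<rho>" and x = "R / \<theta>", OF inc[OF t] x]
    by blast+
  show "(\<lambda>j. approx j t p) \<longlonglongrightarrow> G p t" if "t \<ge> 1" unfolding G_def by (rule lim(1)[OF that])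
  show "\<exists>c\<ge>0. \<forall>t\<ge>1. \<forall>j p. cmod (G p t - approx j t p) \<le> c * t powr \<rho> * (R / \<theta>) ^ j"
    using lim(2) D x unfolding G_def
    by (intro exI[of _ "D / (1 - R / \<theta>)"]) (auto simp: mult_ac)
qed

lemma G_lim: "t \<ge> 1 \<Longrightarrow> (\<lambda>j. approx j t p) \<longlonglongrightarrow> G p t"
  using G_rate(2)[of "(R + cmod lam) / 2"] large by simp

text \<open>Level \<open>j\<close> at \<open>q * t\<close> is level \<open>j + 1\<close> at
  \<open>t\<close>, so the approximations differ only by the missing inverse power; the finite sum
  in \<open>jordan_power\<close> passes to the limit.\<close>

lemma G_scale:
  assumes "t \<ge> 1"
  shows "(\<lambda>p. G p (real q * t)) = jordan_power lam M 1 (\<lambda>p. G p t)"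
proof
  fix p
  have e: "approx j (real q * t) = jordan_power lam M 1 (approx (Suc j) t)" for j
  proof -
    have "level j (real q * t) = level (Suc j) t" by (simp add: level_def mult_ac)
    thus ?thesis unfolding approx_def
      by (subst jordan_power_compose[OF level_vanish]) (auto simp: approx_def)
  qed
  have "(\<lambda>j. jordan_power lam M 1 (approx (Suc j) t) p) \<longlonglongrightarrow> jordan_power lam M 1 (\<lambda>p. G p t) p"
    unfolding jordan_power_def by (intro tendsto_intros LIMSEQ_Suc G_lim assms)
  moreover have "1 \<le> real q * t" using assms q mult_mono[of 1 "real q" 1 t] by simp
  hence "(\<lambda>j. approx j (real q * t) p) \<longlonglongrightarrow> G p (real q * t)" by (rule G_lim)
  ultimately show "G p (real q * t) = jordan_power lam M 1 (\<lambda>p. G p t) p"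
    unfolding e using LIMSEQ_unique by blast
qed

text \<open>At an integer all arguments \<open>N * q ^ j\<close> are reached by the exact recursion
  with digit 0, so the approximating sequence is constant. This is what later removes the error term
  when every eigenvalue is large.\<close>

lemma G_nat:
  assumes "N \<ge> 1"
  shows "G p (real N) = y p N"
proof -
  have l: "level j (real N) p = y p (N * q ^ j)" for j p
    unfolding level_def by (metis floor_of_nat nat_int of_nat_mult of_nat_power)
  have "approx j (real N) = level 0 (real N)" for j
  proof (induction j)
    case 0
    show ?case unfolding approx_def by (simp add: jordan_power_0[OF level_vanish])
  next
    case (Suc j)
    have "approx (Suc j) (real N) = approx j (real N)"
    proof -
      have "level (Suc j) (real N) = (\<lambda>p. lam * level j (real N) p + level j (real N) (Suc p))"
        using exact[of _ "N * q ^ j"] by (simp add: l mult_ac fun_eq_iff)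
      thus ?thesis unfolding approx_shift[of j] approx_def[of "Suc j"] by simp
    qed
    thus ?case using Suc by simp
  qed
  hence "(\<lambda>j. approx j (real N) p) \<longlonglongrightarrow> y p N" using l[of 0 p] by simp
  thus ?thesis using G_lim[of "real N" p] assms LIMSEQ_unique by fastforce
qed

text \<open>This is the convergence rate at \<open>j = 0\<close>, where the approximation is the
  coordinate itself at the integer part.\<close>

lemma G_floor_bound: "\<exists>c\<ge>0. \<forall>t\<ge>1. cmod (G p t - y p (nat \<lfloor>t\<rfloor>)) \<le> c * t powr \<rho>"
proof -
  have "approx 0 t p = y p (nat \<lfloor>t\<rfloor>)" for t
    unfolding approx_def by (simp add: jordan_power_0[OF level_vanish]) (simp add: level_def)
  moreover obtain c where c: "c \<ge> 0" "\<And>t j p. t \<ge> 1 \<Longrightarrow> cmod (G p t - approx j t p) \<le> c * t powr \<rho> * (R / ((R + cmod lam) / 2)) ^ j"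
    using G_rate(1)[of "(R + cmod lam) / 2"] large by auto
  ultimately show ?thesis using c(2)[of _ p 0] c(1) by auto
qed

text \<open>Both values of \<open>G\<close> are replaced by approximations at the level
  \<open>j\<close> at which the two points are about one unit apart after scaling by
  \<open>q ^ j\<close>. There the integer parts agree or are adjacent, so the bound
  \<open>incr\<close> on consecutive differences controls the rest.\<close>

lemma G_holder:
  assumes \<alpha>: "0 < \<alpha>" "\<alpha> \<le> 1" "\<alpha> < ln (cmod lam / R) / ln (real q)"
  shows "holder_on \<alpha> {1..b} (G p)"
proof -
  \<comment> \<open>With this choice \<open>(R / \<theta>) ^ j\<close> equals
    \<open>q powr (- \<alpha> * j)\<close>; the hypothesis on \<open>\<alpha>\<close> says exactly
    that \<open>\<theta> < cmod lam\<close>.\<close>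
  define \<theta> where "\<theta> = R * real q powr \<alpha>"
  have lnq: "ln (real q) > 0" using q by simp
  have \<theta>R: "R < \<theta>"
    using R q \<alpha> gr_one_powr[of "real q" \<alpha>] by (simp add: \<theta>_def)
  have "\<alpha> * ln (real q) < ln (cmod lam / R)" using \<alpha>(3) lnq by (simp add: field_simps)
  hence "exp (\<alpha> * ln (real q)) < exp (ln (cmod lam / R))" by simp
  also have "\<dots> = cmod lam / R" using lam_nonzero R by simp
  finally have "exp (\<alpha> * ln (real q)) < cmod lam / R" .
  hence \<theta>l: "\<theta> < cmod lam" using R q by (simp add: \<theta>_def powr_def field_simps)
  have \<theta>: "\<theta> > 0" using \<theta>R R by simp
  have ratio: "(R / \<theta>) ^ j = real q powr (- \<alpha> * real j)" for j
  proof -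
    have "R / \<theta> = real q powr (- \<alpha>)" using R by (simp add: \<theta>_def powr_minus inverse_eq_divide)
    thus ?thesis using q by (simp add: powr_power mult.commute)
  qed
  obtain c1 where c1: "c1 \<ge> 0" "\<And>t j p. t \<ge> 1 \<Longrightarrow> cmod (G p t - approx j t p) \<le> c1 * t powr \<rho> * (R / \<theta>) ^ j"
    using G_rate(1)[OF \<theta>R \<theta>l] by blast
  obtain c2 where c2: "c2 \<ge> 0" "\<And>j f B p. (\<forall>k. cmod (f k) \<le> B) \<Longrightarrow>
      cmod (jordan_power lam M (- real j) f p) \<le> c2 * B / \<theta> ^ j"
    using jordan_power_neg_bound[OF \<theta> \<theta>l] by blast
  \<comment> \<open>An upper bound for \<open>t powr \<rho>\<close> on \<open>{1..b}\<close> that is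
    independent of the sign of \<open>\<rho>\<close>.\<close>
  define T where "T = b powr \<bar>\<rho>\<bar>"
  have T: "t powr \<rho> \<le> T" if "1 \<le> t" "t \<le> b" for t
  proof -
    have "t powr \<rho> \<le> t powr \<bar>\<rho>\<bar>" using that by (intro powr_mono abs_ge_self) auto
    also have "\<dots> \<le> T" unfolding T_def using that by (intro powr_mono2) auto
    finally show ?thesis .
  qed
  have T0: "T \<ge> 0" by (simp add: T_def)
  define c3 where "c3 = c2 * (K * 2 powr \<bar>\<rho>\<bar> * T)"
  have c3: "c3 \<ge> 0" using c2 K_nonneg T0 by (simp add: c3_def)
  define L where "L = (2 * c1 * T + c3) * real q powr \<alpha>"
  have main: "cmod (G p t' - G p t) \<le> L * \<bar>t' - t\<bar> powr \<alpha>"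
    if t: "1 \<le> t" "t < t'" "t' \<le> b" "t' - t \<le> 1" for t t'
  proof -
    define d where "d = t' - t"
    have d: "0 < d" "d \<le> 1" using that by (auto simp: d_def)
    \<comment> \<open>The largest \<open>j\<close> with \<open>d * q ^ j \<le> 1\<close>. Maximality
      gives \<open>1 < d * q ^ Suc j\<close>, which converts the rate
      \<open>q powr (- \<alpha> * j)\<close> into \<open>d powr \<alpha>\<close>.\<close>
    define j where "j = nat \<lfloor>log (real q) (1 / d)\<rfloor>"
    have lg: "log (real q) (1 / d) \<ge> 0" using d q by simp
    have j: "real j \<le> log (real q) (1 / d)" "log (real q) (1 / d) < real j + 1"
      using lg unfolding j_def by linarith+
    have qj: "real q ^ j \<le> 1 / d" "1 / d < real q ^ Suc j"
    proof -
      have e: "real q powr log (real q) (1 / d) = 1 / d" using d q by (intro powr_log_cancel) auto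
      have "real q powr real j \<le> real q powr log (real q) (1 / d)" using j q by (intro powr_mono) auto
      thus "real q ^ j \<le> 1 / d" unfolding e using q by (simp add: powr_realpow)
      have "real q powr log (real q) (1 / d) < real q powr real (Suc j)" using j q by (intro powr_less_mono) auto
      thus "1 / d < real q ^ Suc j" unfolding e using q by (simp add: powr_realpow del: of_nat_Suc)
    qed
    have djq: "d * real q ^ j \<le> 1" using qj(1) d by (simp add: field_simps)
    define N where "N = nat \<lfloor>t * real q ^ j\<rfloor>"
    define N' where "N' = nat \<lfloor>t' * real q ^ j\<rfloor>"
    have t'q: "t' * real q ^ j = t * real q ^ j + d * real q ^ j" by (simp add: d_def algebra_simps)
    have dq0: "d * real q ^ j \<ge> 0" "t * real q ^ j \<ge> 0" using d t by auto
    have "\<lfloor>t' * real q ^ j\<rfloor> = \<lfloor>t * real q ^ j\<rfloor> \<or> \<lfloor>t' * real q ^ j\<rfloor> = \<lfloor>t * real q ^ j\<rfloor> + 1"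
      unfolding t'q using djq dq0(1) by linarith
    hence NN: "N' = N \<or> N' = Suc N" unfolding N_def N'_def using dq0(2)
      by (auto simp: nat_add_distrib)
    have lv: "cmod (level j t' k - level j t k) \<le> K * 2 powr \<bar>\<rho>\<bar> * T * R ^ j" for k
    proof -
      have "cmod (level j t' k - level j t k) \<le> K * real (max 1 N) powr \<rho>"
        using NN incr[of k N] K_nonneg by (auto simp: level_def N_def N'_def)
      also have "\<dots> \<le> K * (2 powr \<bar>\<rho>\<bar> * t powr \<rho> * R ^ j)"
        unfolding N_def using t by (intro mult_left_mono floor_bound K_nonneg)
      also have "\<dots> \<le> K * (2 powr \<bar>\<rho>\<bar> * T * R ^ j)"
        using t T[of t] R K_nonneg by (intro mult_left_mono mult_right_mono) auto
      finally show ?thesis by (simp add: mult.assoc)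
    qed
    have "approx j t' p - approx j t p = jordan_power lam M (- real j) (\<lambda>k. level j t' k - level j t k) p"
      by (simp add: approx_def jordan_power_diff)
    also have "cmod \<dots> \<le> c2 * (K * 2 powr \<bar>\<rho>\<bar> * T * R ^ j) / \<theta> ^ j"
      by (intro c2(2) allI lv)
    also have "\<dots> = c3 * (R / \<theta>) ^ j" by (simp add: c3_def power_divide)
    finally have a: "cmod (approx j t' p - approx j t p) \<le> c3 * (R / \<theta>) ^ j" .
    have Rj: "(R / \<theta>) ^ j \<ge> 0" using R \<theta> by simp
    have g: "cmod (G p s - approx j s p) \<le> c1 * T * (R / \<theta>) ^ j" if "1 \<le> s" "s \<le> b" for s
    proof -
      have "cmod (G p s - approx j s p) \<le> c1 * s powr \<rho> * (R / \<theta>) ^ j" using c1 that by blast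
      also have "\<dots> \<le> c1 * T * (R / \<theta>) ^ j" using T[OF that] c1 Rj by (intro mult_left_mono mult_right_mono) auto
      finally show ?thesis .
    qed
    have "G p t' - G p t = (G p t' - approx j t' p) + (approx j t' p - approx j t p) - (G p t - approx j t p)"
      by simp
    also have "cmod \<dots> \<le> cmod (G p t' - approx j t' p) + cmod (approx j t' p - approx j t p) + cmod (G p t - approx j t p)"
      using norm_triangle_ineq4[of "G p t' - approx j t' p + (approx j t' p - approx j t p)" "G p t - approx j t p"]
        norm_triangle_ineq[of "G p t' - approx j t' p" "approx j t' p - approx j t p"] by linarith
    also have "\<dots> \<le> c1 * T * (R / \<theta>) ^ j + c3 * (R / \<theta>) ^ j + c1 * T * (R / \<theta>) ^ j"
      using g[of t'] g[of t] a t by (intro add_mono) auto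
    also have "\<dots> = (2 * c1 * T + c3) * (R / \<theta>) ^ j" by (simp add: algebra_simps)
    also have "(R / \<theta>) ^ j \<le> real q powr \<alpha> * d powr \<alpha>"
    proof -
      have "1 \<le> d * real q ^ Suc j" using qj(2) d by (simp add: field_simps)
      hence "1 powr \<alpha> \<le> (d * real q ^ Suc j) powr \<alpha>" using \<alpha> by (intro powr_mono2) auto
      also have "\<dots> = d powr \<alpha> * real q powr \<alpha> * real q powr (\<alpha> * real j)"
        using d q by (simp add: powr_mult powr_powr mult_ac flip: powr_realpow)
      finally have "real q powr (- \<alpha> * real j) * 1 \<le>
          real q powr (- \<alpha> * real j) * (d powr \<alpha> * real q powr \<alpha> * real q powr (\<alpha> * real j))"
        by (intro mult_left_mono) auto
      also have "\<dots> = real q powr \<alpha> * d powr \<alpha>"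
        using q by (simp add: powr_minus)
      finally show ?thesis unfolding ratio by simp
    qed
    hence "(2 * c1 * T + c3) * (R / \<theta>) ^ j \<le> (2 * c1 * T + c3) * (real q powr \<alpha> * d powr \<alpha>)"
      using c1 c3 T0 by (intro mult_left_mono) auto
    also have "\<dots> = L * d powr \<alpha>" by (simp add: L_def mult.assoc)
    finally show ?thesis using d by (simp add: d_def)
  qed
  have main': "cmod (G p t' - G p t) \<le> L * \<bar>t' - t\<bar> powr \<alpha>"
    if "1 \<le> t" "1 \<le> t'" "t \<le> b" "t' \<le> b" "\<bar>t' - t\<bar> \<le> 1" for t t'
    using main[of t t'] main[of t' t] that
    by (cases t t' rule: linorder_cases) (auto simp: norm_minus_commute abs_minus_commute)
  have cmp: "cmod (G p t) \<le> c1 * T + Max (insert 0 ((\<lambda>n. cmod (y p n)) ` {..nat \<lfloor>b\<rfloor>}))"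
    if t: "t \<in> {1..b}" for t
  proof -
    have "cmod (G p t - approx 0 t p) \<le> c1 * t powr \<rho>" using c1(2)[of t p 0] t by simp
    also have "\<dots> \<le> c1 * T" using T[of t] t c1 by (intro mult_left_mono) auto
    finally have "cmod (G p t) \<le> c1 * T + cmod (approx 0 t p)"
      using norm_triangle_sub[of "G p t" "approx 0 t p"] by linarith
    also have "approx 0 t p = y p (nat \<lfloor>t\<rfloor>)"
      unfolding approx_def by (simp add: jordan_power_0[OF level_vanish]) (simp add: level_def)
    also have "cmod (y p (nat \<lfloor>t\<rfloor>)) \<le> Max (insert 0 ((\<lambda>n. cmod (y p n)) ` {..nat \<lfloor>b\<rfloor>}))"
      using t by (intro Max_ge) (auto intro!: imageI nat_mono floor_mono)
    finally show ?thesis by simp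
  qed
  \<comment> \<open>A bound for \<open>G p\<close> on the whole interval settles points at distance
    more than 1, where \<open>\<bar>u - w\<bar> powr \<alpha>\<close> is at least 1.\<close>
  define B where "B = c1 * T + Max (insert 0 ((\<lambda>n. cmod (y p n)) ` {..nat \<lfloor>b\<rfloor>}))"
  have B: "cmod (G p t) \<le> B" if "t \<in> {1..b}" for t using cmp[OF that] by (simp add: B_def)
  show ?thesis
  proof (rule holder_onI)
    fix u w assume uw: "u \<in> {1..b}" "w \<in> {1..b}"
    show "cmod (G p u - G p w) \<le> (\<bar>L\<bar> + 2 * \<bar>B\<bar>) * \<bar>u - w\<bar> powr \<alpha>"
    proof (cases "\<bar>u - w\<bar> \<le> 1")
      case True
      have "cmod (G p u - G p w) \<le> L * \<bar>u - w\<bar> powr \<alpha>" using main'[of w u] uw True by auto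
      also have "\<dots> \<le> (\<bar>L\<bar> + 2 * \<bar>B\<bar>) * \<bar>u - w\<bar> powr \<alpha>" by (intro mult_right_mono) auto
      finally show ?thesis .
    next
      case False
      have "cmod (G p u - G p w) \<le> cmod (G p u) + cmod (G p w)" by (rule norm_triangle_ineq4)
      also have "\<dots> \<le> 2 * \<bar>B\<bar>" using B[OF uw(1)] B[OF uw(2)] by linarith
      also have "\<dots> \<le> (\<bar>L\<bar> + 2 * \<bar>B\<bar>) * 1" by simp
      also have "1 \<le> \<bar>u - w\<bar> powr \<alpha>" using False \<alpha> by (intro ge_one_powr_ge_zero) auto
      hence "(\<bar>L\<bar> + 2 * \<bar>B\<bar>) * 1 \<le> (\<bar>L\<bar> + 2 * \<bar>B\<bar>) * \<bar>u - w\<bar> powr \<alpha>"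
        by (intro mult_left_mono) auto
      finally show ?thesis .
    qed
  qed
qed

definition H :: "nat \<Rightarrow> real \<Rightarrow> complex" where
  "H p u = jordan_power lam M (- u) (\<lambda>p. G p (real q powr u)) p"

lemma H_shift:
  assumes "u \<ge> 0"
  shows "H p (u + 1) = H p u"
proof -
  have "1 \<le> real q powr u" using q assms by (intro ge_one_powr_ge_zero) auto
  have "(\<lambda>p. G p (real q powr (u + 1))) = (\<lambda>p. G p (real q * real q powr u))"
    using q by (simp add: powr_add mult.commute)
  also have "\<dots> = jordan_power lam M 1 (\<lambda>p. G p (real q powr u))" by (rule G_scale) fact
  finally show ?thesis unfolding H_def
    by (simp add: jordan_power_compose[OF G_vanish])
qed

lemma H_shift_nat: "u \<ge> 0 \<Longrightarrow> H p (u + real n) = H p u"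
proof (induction n)
  case (Suc n)
  thus ?case using H_shift[of "u + real n" p] by (simp add: algebra_simps)
qed auto

lemma H_frac: assumes "u \<ge> 0" shows "H p (frac u) = H p u"
proof -
  have "u = frac u + real (nat \<lfloor>u\<rfloor>)" using assms by (simp add: frac_def)
  thus ?thesis using H_shift_nat[of "frac u" p "nat \<lfloor>u\<rfloor>"] by simp
qed

lemma G_eq_H:
  assumes "u \<ge> 0"
  shows "G p (real q powr u) = jordan_power lam M u (\<lambda>p. H p u) p"
proof -
  have "(\<lambda>p. H p u) = jordan_power lam M (- u) (\<lambda>p. G p (real q powr u))" by (simp add: H_def)
  thus ?thesis by (simp add: jordan_power_compose[OF G_vanish] jordan_power_0[OF G_vanish])
qed

text \<open>On \<open>{0..2}\<close> the exponential \<open>q powr u\<close> is Lipschitz and takes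
  values in \<open>{1..q powr 2}\<close>, so the regularity of \<open>G\<close> carries over; the
  coefficients of the Jordan power are smooth in \<open>u\<close>. Two periods are covered because
  the periodic extension needs them.\<close>

lemma H_holder:
  assumes \<alpha>: "0 < \<alpha>" "\<alpha> \<le> 1" "\<alpha> < ln (cmod lam / R) / ln (real q)"
  shows "holder_on \<alpha> {0..2} (H p)"
proof -
  obtain Lq where Lq: "\<And>u w. u \<in> {0..2} \<Longrightarrow> w \<in> {0..2} \<Longrightarrow> \<bar>real q powr u - real q powr w\<bar> \<le> Lq * \<bar>u - w\<bar>"
  proof (rule that)
    fix u w :: real assume "u \<in> {0..2}" "w \<in> {0..2}"
    thus "\<bar>real q powr u - real q powr w\<bar> \<le> (ln (real q) * real q powr 2) * \<bar>u - w\<bar>"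
      unfolding real_norm_def[symmetric]
    proof (intro field_differentiable_bound[where f' = "\<lambda>u. real q powr u * ln (real q)" and S = "{0..2}"])
      show "((\<lambda>u. real q powr u) has_field_derivative real q powr z * ln (real q)) (at z within {0..2})" for z
      proof -
        have "((\<lambda>u. exp (u * ln (real q))) has_field_derivative exp (z * ln (real q)) * ln (real q)) (at z within {0..2})"
          by (auto intro!: derivative_eq_intros)
        thus ?thesis using q by (simp add: powr_def)
      qed
      show "norm (real q powr z * ln (real q)) \<le> ln (real q) * real q powr 2" if "z \<in> {0..2}" for z
        using q that powr_mono[of z 2 "real q"] by (auto simp: abs_mult mult.commute intro!: mult_left_mono)
    qed auto
  qed
  have Lq0: "Lq \<ge> 0" using order.trans[OF abs_ge_zero Lq[of 0 1]] by simp
  have GH: "holder_on \<alpha> {0..2} (\<lambda>u. G p (real q powr u))" for p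
  proof -
    obtain L where L: "L \<ge> 0" "\<And>u w. u \<in> {1..real q powr 2} \<Longrightarrow> w \<in> {1..real q powr 2} \<Longrightarrow>
        cmod (G p u - G p w) \<le> L * \<bar>u - w\<bar> powr \<alpha>"
      using G_holder[OF \<alpha>, of "real q powr 2" p] unfolding holder_on_def by metis
    show ?thesis
    proof (rule holder_onI[of _ _ "L * Lq powr \<alpha>"])
      fix u w :: real assume uw: "u \<in> {0..2}" "w \<in> {0..2}"
      have i: "real q powr x \<in> {1..real q powr 2}" if "x \<in> {0..2}" for x
        using that q powr_mono[of x 2 "real q"] by (auto intro!: ge_one_powr_ge_zero)
      have "cmod (G p (real q powr u) - G p (real q powr w)) \<le> L * \<bar>real q powr u - real q powr w\<bar> powr \<alpha>"
        using L i uw by blast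
      also have "\<dots> \<le> L * (Lq * \<bar>u - w\<bar>) powr \<alpha>"
        using L Lq[OF uw] \<alpha> by (intro mult_left_mono powr_mono2) auto
      finally show "cmod (G p (real q powr u) - G p (real q powr w)) \<le> L * Lq powr \<alpha> * \<bar>u - w\<bar> powr \<alpha>"
        using Lq0 by (simp add: powr_mult mult.assoc)
    qed
  qed
  show ?thesis unfolding H_def jordan_power_def
    using \<alpha> by (intro holder_on_sum holder_on_mult jordan_coeff_holder GH) auto
qed

text \<open>Undoing the normalisation writes \<open>G\<close> as a Jordan power with real exponent
  \<open>u = log_q t\<close> applied to the periodic \<open>H\<close>; sorting the binomial
  polynomials in \<open>u\<close> by powers yields the coefficient functions.\<close>

lemma expansion:
  obtains \<phi> :: "nat \<Rightarrow> real \<Rightarrow> complex"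
  where "\<And>k u. \<phi> k (u + 1) = \<phi> k u"
    and "\<And>k \<alpha>. 0 < \<alpha> \<Longrightarrow> \<alpha> \<le> 1 \<Longrightarrow> \<alpha> < ln (cmod lam / R) / ln (real q) \<Longrightarrow> holder_continuous \<alpha> (\<phi> k)"
    and "\<And>t. t \<ge> 1 \<Longrightarrow> G 0 t = exp (of_real (ln t / ln (real q)) * Ln lam) *
           (\<Sum>k<M. of_real (ln t / ln (real q)) ^ k * \<phi> k (ln t / ln (real q)))"
proof -
  have "\<exists>c :: nat \<Rightarrow> complex. \<forall>u. u gchoose p = (\<Sum>k\<le>p. c k * u ^ k)" for p
    using gbinomial_power_basis by metis
  then obtain c :: "nat \<Rightarrow> nat \<Rightarrow> complex" where c: "\<And>p u. u gchoose p = (\<Sum>k\<le>p. c p k * u ^ k)" by metis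
  \<comment> \<open>Invariance of \<open>H\<close> under the shift by 1 is available only for
    \<open>u \<ge> 0\<close>; \<open>frac\<close> makes the functions periodic on the whole line
    without changing them there.\<close>
  define \<phi> where "\<phi> k u = (\<Sum>p\<in>{k..<M}. c p k / lam ^ p * H p (frac u))" for k u
  show ?thesis
  proof (rule that[of \<phi>])
    show "\<phi> k (u + 1) = \<phi> k u" for k u by (simp add: \<phi>_def frac_1_eq)
    show "holder_continuous \<alpha> (\<phi> k)" if \<alpha>: "0 < \<alpha>" "\<alpha> \<le> 1" "\<alpha> < ln (cmod lam / R) / ln (real q)" for k \<alpha>
      unfolding \<phi>_def
    proof (rule holder_continuous_sum)
      fix p
      show "holder_continuous \<alpha> (\<lambda>u. c p k / lam ^ p * H p (frac u))"
        using holder_on_mult[OF holder_on_const H_holder[OF \<alpha>, of p], of "c p k / lam ^ p"] \<alpha>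
        by (intro holder_on_periodic_extension[where f = "\<lambda>u. c p k / lam ^ p * H p u"])
           (auto simp: H_shift)
    qed
    show "G 0 t = exp (of_real (ln t / ln (real q)) * Ln lam) *
           (\<Sum>k<M. of_real (ln t / ln (real q)) ^ k * \<phi> k (ln t / ln (real q)))" if t: "t \<ge> 1" for t
    proof -
      define u where "u = ln t / ln (real q)"
      have u: "u \<ge> 0" "real q powr u = t" using t q by (simp_all add: u_def powr_def)
      have "G 0 t = (\<Sum>p<M. exp (of_real u * Ln lam) * (\<Sum>k\<le>p. of_real u ^ k * (c p k / lam ^ p * H p (frac u))))"
        using G_eq_H[OF u(1), of 0]
        by (simp add: u jordan_power_def jordan_coeff_def c H_frac sum_distrib_left sum_distrib_right sum_divide_distrib mult_ac)
      also have "\<dots> = exp (of_real u * Ln lam) * (\<Sum>p<M. \<Sum>k\<le>p. of_real u ^ k * (c p k / lam ^ p * H p (frac u)))"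
        by (simp add: sum_distrib_left)
      also have "(\<Sum>p<M. \<Sum>k\<le>p. of_real u ^ k * (c p k / lam ^ p * H p (frac u))) =
          (\<Sum>(p,k)\<in>(SIGMA p:{..<M}. {..p}). of_real u ^ k * (c p k / lam ^ p * H p (frac u)))"
        by (simp add: sum.Sigma)
      also have "\<dots> = (\<Sum>(k,p)\<in>(SIGMA k:{..<M}. {k..<M}). of_real u ^ k * (c p k / lam ^ p * H p (frac u)))"
        by (rule sum.reindex_bij_witness[of _ prod.swap prod.swap]) auto
      also have "\<dots> = (\<Sum>k<M. \<Sum>p\<in>{k..<M}. of_real u ^ k * (c p k / lam ^ p * H p (frac u)))"
        by (simp add: sum.Sigma)
      also have "\<dots> = (\<Sum>k<M. of_real u ^ k * \<phi> k u)" by (simp add: \<phi>_def sum_distrib_left)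
      finally show ?thesis by (simp add: u_def)
    qed
  qed
qed

end

subsection \<open>Fourier series of Hoelder continuous functions\<close>

text \<open>Uniform approximation by a polynomial function \<open>g\<close> costs at most half of
  \<open>\<epsilon>\<close>; for the differentiable \<open>g\<close>, integration by parts gives
  decay like \<open>1 / \<bar>w\<bar>\<close>.\<close>

lemma riemann_lebesgue:
  fixes k :: "real \<Rightarrow> complex"
  assumes k: "continuous_on {a..b} k" and "a \<le> b" and \<epsilon>: "\<epsilon> > 0"
  shows "\<exists>N>0. \<forall>w::real. \<bar>w\<bar> \<ge> N \<longrightarrow> cmod (integral {a..b} (\<lambda>x. k x * exp (\<i> * of_real (w * x)))) \<le> \<epsilon>"
proof -
  define \<epsilon>' where "\<epsilon>' = \<epsilon> / (2 * (b - a + 1))"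
  have \<epsilon>': "\<epsilon>' > 0" "\<epsilon>' * (b - a) \<le> \<epsilon> / 2" using assms by (auto simp: \<epsilon>'_def field_simps)
  obtain g where g: "polynomial_function g" "\<And>x. x \<in> {a..b} \<Longrightarrow> cmod (k x - g x) < \<epsilon>'"
    using Stone_Weierstrass_polynomial_function[OF _ k \<epsilon>'(1)] by auto
  obtain g' where g': "polynomial_function g'" "\<And>x. (g has_vector_derivative g' x) (at x)"
    using has_vector_derivative_polynomial_function[OF g(1)] by blast
  have cg: "continuous_on S g" "continuous_on S g'" for S
    using g(1) g'(1) by (auto intro: continuous_on_polymonial_function)
  have "bounded (g ` {a..b})" "bounded (g' ` {a..b})"
    by (intro compact_imp_bounded compact_continuous_image cg; simp)+
  then obtain B1 B2 where B: "\<And>x. x \<in> {a..b} \<Longrightarrow> cmod (g x) \<le> B1" "\<And>x. x \<in> {a..b} \<Longrightarrow> cmod (g' x) \<le> B2"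
    unfolding bounded_iff by (meson image_eqI)
  have Bn: "B1 \<ge> 0" "B2 \<ge> 0" using B[of a] assms(2) by (auto intro: order.trans[OF norm_ge_zero])
  \<comment> \<open>The two boundary terms contribute \<open>2 * B1\<close>, the integral with
    \<open>g'\<close> contributes \<open>B2 * (b - a)\<close>, and the added 1 makes the constant
    positive.\<close>
  define D where "D = 2 * B1 + B2 * (b - a) + 1"
  have D: "D > 0" using Bn assms(2) by (auto simp: D_def intro!: add_nonneg_pos)
  show ?thesis
  proof (intro exI[of _ "2 * D / \<epsilon>"] conjI allI impI)
    fix w :: real assume w: "2 * D / \<epsilon> \<le> \<bar>w\<bar>"
    have "2 * D / \<epsilon> > 0" using D \<epsilon> by simp
    hence w0: "w \<noteq> 0" using w by auto
    define e where "e x = exp (\<i> * of_real (w * x))" for x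
    have ne: "cmod (e x) = 1" for x unfolding e_def by (metis norm_exp_i_times)
    have ce: "continuous_on S e" for S unfolding e_def by (intro continuous_intros)
    have de: "(e has_vector_derivative \<i> * w * e x) (at x within S)" for x S
    proof -
      have "((\<lambda>x. exp (x *\<^sub>R (\<i> * w))) has_vector_derivative exp (x *\<^sub>R (\<i> * w)) * (\<i> * w)) (at x within S)"
        by (rule exp_scaleR_has_vector_derivative_right)
      thus ?thesis by (simp add: e_def[abs_def] scaleR_conv_of_real mult_ac)
    qed
    have "((\<lambda>x. g x * e x / (\<i> * w)) has_vector_derivative (g x * e x + g' x * e x / (\<i> * w))) (at x within {a..b})" for x
    proof -
      have "((\<lambda>x. g x * e x) has_vector_derivative (g x * (\<i> * w * e x) + g' x * e x)) (at x within {a..b})"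
        using has_vector_derivative_mult[OF has_vector_derivative_at_within[OF g'(2)] de] .
      hence "((\<lambda>x. g x * e x / (\<i> * w)) has_vector_derivative ((g x * (\<i> * w * e x) + g' x * e x) / (\<i> * w))) (at x within {a..b})"
        by (rule has_vector_derivative_divide)
      thus ?thesis using w0 by (simp add: add_divide_distrib)
    qed
    hence ftc: "((\<lambda>x. g x * e x + g' x * e x / (\<i> * w)) has_integral (g b * e b / (\<i> * w) - g a * e a / (\<i> * w))) {a..b}"
      by (intro fundamental_theorem_of_calculus assms(2))
    have int: "(\<lambda>x. g' x * e x / (\<i> * w)) integrable_on {a..b}" "(\<lambda>x. k x * e x) integrable_on {a..b}"
      "(\<lambda>x. g x * e x) integrable_on {a..b}" "(\<lambda>x. (k x - g x) * e x) integrable_on {a..b}"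
      using w0 by (auto intro!: integrable_continuous_real continuous_intros cg ce k)
    have "integral {a..b} (\<lambda>x. g x * e x) + integral {a..b} (\<lambda>x. g' x * e x / (\<i> * w)) = g b * e b / (\<i> * w) - g a * e a / (\<i> * w)"
      using integral_unique[OF ftc] int by (simp add: integral_add)
    hence "integral {a..b} (\<lambda>x. g x * e x) = g b * e b / (\<i> * w) - g a * e a / (\<i> * w) - integral {a..b} (\<lambda>x. g' x * e x / (\<i> * w))"
      by (simp add: algebra_simps)
    also have "cmod \<dots> \<le> cmod (g b * e b / (\<i> * w)) + cmod (g a * e a / (\<i> * w)) + cmod (integral {a..b} (\<lambda>x. g' x * e x / (\<i> * w)))"
      by (intro order.trans[OF norm_triangle_ineq4] add_mono order.refl)
    also have "\<dots> \<le> B1 / \<bar>w\<bar> + B1 / \<bar>w\<bar> + B2 / \<bar>w\<bar> * (b - a)"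
      using assms(2) B int(1) w0
      by (intro add_mono integral_bound) (auto simp: norm_mult norm_divide ne intro!: divide_right_mono continuous_intros cg ce)
    also have "\<dots> \<le> D / \<bar>w\<bar>" using w0 by (simp add: D_def field_simps)
    also have "\<dots> \<le> \<epsilon> / 2" using w w0 \<epsilon> D by (simp add: field_simps)
    finally have 1: "cmod (integral {a..b} (\<lambda>x. g x * e x)) \<le> \<epsilon> / 2" .
    have "cmod (integral {a..b} (\<lambda>x. (k x - g x) * e x)) \<le> \<epsilon>' * (b - a)"
      using assms(2) g(2) by (intro integral_bound) (auto simp: norm_mult ne intro!: less_imp_le continuous_intros cg ce k)
    hence 2: "cmod (integral {a..b} (\<lambda>x. (k x - g x) * e x)) \<le> \<epsilon> / 2" using \<epsilon>'(2) by simp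
    have "integral {a..b} (\<lambda>x. k x * e x) = integral {a..b} (\<lambda>x. g x * e x) + integral {a..b} (\<lambda>x. (k x - g x) * e x)"
      using int by (simp add: integral_add[symmetric] algebra_simps)
    also have "cmod \<dots> \<le> \<epsilon> / 2 + \<epsilon> / 2" by (intro order.trans[OF norm_triangle_ineq] add_mono 1 2)
    finally show "cmod (integral {a..b} (\<lambda>x. k x * exp (\<i> * of_real (w * x)))) \<le> \<epsilon>" by (simp add: e_def)
  qed (use D \<epsilon> in auto)
qed

abbreviation cis2pi :: "real \<Rightarrow> complex" where
  "cis2pi x \<equiv> exp (2 * pi * \<i> * of_real x)"

lemma cis2pi_int: "cis2pi (of_int n) = 1"
proof -
  have "2 * of_real pi * \<i> * of_real (of_int n) = of_int (2 * n) * of_real pi * \<i>" by simp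
  thus ?thesis unfolding exp_eq_1 by (auto simp: )
qed

lemma periodic_int_shift:
  fixes f :: "real \<Rightarrow> 'a"
  assumes "\<And>u. f (u + 1) = f u"
  shows "f (u + of_int n) = f u"
proof -
  have nat: "f (u + real m) = f u" for u m
  proof (induction m)
    case (Suc m)
    have "f (u + real (Suc m)) = f ((u + real m) + 1)" by (simp add: algebra_simps)
    thus ?case using assms[of "u + real m"] Suc by simp
  qed simp
  show ?thesis
  proof (cases "n \<ge> 0")
    case True
    thus ?thesis using nat[of u "nat n"] by simp
  next
    case False
    thus ?thesis using nat[of "u + of_int n" "nat (- n)"] by simp
  qed
qed

lemma integral_periodic_shift:
  fixes f :: "real \<Rightarrow> complex"
  assumes per: "\<And>u. f (u + 1) = f u" and cont: "continuous_on UNIV f"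
  shows "integral {0..1} (\<lambda>x. f (x + u)) = integral {0..1} f"
proof -
  define v where "v = frac u"
  have v: "0 \<le> v" "v \<le> 1" using frac_ge_0[of u] frac_lt_1[of u] by (auto simp: v_def)
  have int: "f integrable_on {a..b}" for a b
    by (intro integrable_continuous_real continuous_on_subset[OF cont]) auto
  have "f (x + u) = f (x + v)" for x
    using periodic_int_shift[of f "x + v" "\<lfloor>u\<rfloor>", OF per] by (simp add: v_def frac_def)
  hence "integral {0..1} (\<lambda>x. f (x + u)) = integral {0..1} (\<lambda>x. f (x + v))" by simp
  also have "\<dots> = integral {0+v..1+v} f"
    using integral_shift_Icc_real[of 0 1 f v] continuous_on_subset[OF cont] by (simp add: o_def add.commute)
  also have "\<dots> = integral {v..1} f + integral {1..1+v} f"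
    using v int by (simp add: Henstock_Kurzweil_Integration.integral_combine)
  also have "integral {1..1+v} f = integral {0..v} (\<lambda>x. f (x + 1))"
    using integral_shift_Icc_real[of 0 v f 1] continuous_on_subset[OF cont] by (simp add: o_def add.commute)
  also have "\<dots> = integral {0..v} f" by (simp add: per)
  also have "integral {v..1} f + integral {0..v} f = integral {0..1} f"
    using v int by (subst add.commute) (simp add: Henstock_Kurzweil_Integration.integral_combine)
  finally show ?thesis .
qed

text \<open>The majorant is what remains of a Hoelder difference after division by a simple zero,
  and it is integrable at 0 because \<open>\<alpha> > 0\<close>. Since \<open>0 powr a\<close> is 0,
  the hypothesis forces \<open>f 0 = 0\<close>.\<close>

lemma integral_powr_bound:
  fixes f :: "real \<Rightarrow> complex"
  assumes f: "continuous_on {0..\<delta>} f" and "\<delta> \<ge> 0" "\<alpha> > 0"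
    and le: "\<And>x. 0 \<le> x \<Longrightarrow> x \<le> \<delta> \<Longrightarrow> cmod (f x) \<le> L * x powr (\<alpha> - 1)"
  shows "cmod (integral {0..\<delta>} f) \<le> L * \<delta> powr \<alpha> / \<alpha>"
proof -
  have i: "((\<lambda>x. x powr (\<alpha> - 1)) has_integral \<delta> powr \<alpha> / \<alpha>) {0..\<delta>}"
    using has_integral_powr_from_0[of "\<alpha> - 1" \<delta>] assms by simp
  have "norm (integral {0..\<delta>} f) \<le> integral {0..\<delta>} (\<lambda>x. L * x powr (\<alpha> - 1))"
    using le has_integral_integrable[OF has_integral_mult_right[OF i, of L]]
    by (intro integral_norm_bound_integral integrable_continuous_real[OF f]) auto
  also have "\<dots> = L * (\<delta> powr \<alpha> / \<alpha>)"
    using has_integral_mult_right[OF i, of L] by (rule integral_unique)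
  finally show ?thesis by simp
qed

text \<open>The derivative at 0 has modulus \<open>2 * pi > 1\<close>, so near 0 the difference
  quotient exceeds 1.\<close>

lemma cis2pi_lower_bound:
  obtains \<delta> :: real where "\<delta> > 0" "\<And>x. \<bar>x\<bar> < \<delta> \<Longrightarrow> cmod (cis2pi x - 1) \<ge> \<bar>x\<bar>"
proof -
  have "((\<lambda>z. exp (2 * of_real pi * \<i> * z)) has_field_derivative (2 * of_real pi * \<i>)) (at 0)"
    by (auto intro!: derivative_eq_intros)
  hence "(\<lambda>z. (exp (2 * of_real pi * \<i> * z) - 1) / z) \<midarrow>0\<rightarrow> 2 * of_real pi * \<i>"
    by (simp add: DERIV_def)
  hence "(\<lambda>z. cmod ((exp (2 * of_real pi * \<i> * z) - 1) / z)) \<midarrow>0\<rightarrow> cmod (2 * of_real pi * \<i>)"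
    by (rule tendsto_norm)
  moreover have "cmod (2 * of_real pi * \<i>) > 1" using pi_gt3 by (simp add: norm_mult)
  ultimately have "eventually (\<lambda>z. cmod ((exp (2 * of_real pi * \<i> * z) - 1) / z) > 1) (at 0)"
    by (rule order_tendstoD(1))
  then obtain \<delta> where \<delta>: "\<delta> > 0" "\<And>z. z \<noteq> 0 \<Longrightarrow> cmod z < \<delta> \<Longrightarrow> cmod ((exp (2 * of_real pi * \<i> * z) - 1) / z) > 1"
    unfolding eventually_at by auto
  show ?thesis
  proof (rule that[OF \<delta>(1)])
    fix x :: real assume "\<bar>x\<bar> < \<delta>"
    thus "cmod (cis2pi x - 1) \<ge> \<bar>x\<bar>"
      using \<delta>(2)[of "of_real x"] by (cases "x = 0") (auto simp: norm_divide field_simps)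
  qed
qed

text \<open>Stated as a product, the closed form of the kernel also holds at integers, where the
  denominator would vanish.\<close>

lemma dirichlet_kernel:
  "(cis2pi x - 1) * (\<Sum>l\<in>{- int L..int L}. cis2pi (- of_int l * x)) = cis2pi (real (Suc L) * x) - cis2pi (- real L * x)"
proof (induction L)
  case 0
  show ?case by simp
next
  case (Suc L)
  have s: "{- int (Suc L)..int (Suc L)} = insert (- int (Suc L)) (insert (int (Suc L)) {- int L..int L})" by auto
  have "(cis2pi x - 1) * (\<Sum>l\<in>{- int (Suc L)..int (Suc L)}. cis2pi (- of_int l * x)) =
      (cis2pi x - 1) * (cis2pi (real (Suc L) * x) + cis2pi (- real (Suc L) * x)) +
      (cis2pi x - 1) * (\<Sum>l\<in>{- int L..int L}. cis2pi (- of_int l * x))"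
    unfolding s by (subst sum.insert; (subst sum.insert)?) (auto simp: algebra_simps)
  also have "\<dots> = (cis2pi x - 1) * (cis2pi (real (Suc L) * x) + cis2pi (- real (Suc L) * x)) +
      (cis2pi (real (Suc L) * x) - cis2pi (- real L * x))" unfolding Suc ..
  also have "cis2pi (- real L * x) = cis2pi x * cis2pi (- real (Suc L) * x)"
    by (subst exp_add[symmetric]) (simp add: algebra_simps)
  also have "(cis2pi x - 1) * (cis2pi (real (Suc L) * x) + cis2pi (- real (Suc L) * x)) +
      (cis2pi (real (Suc L) * x) - cis2pi x * cis2pi (- real (Suc L) * x)) =
      cis2pi x * cis2pi (real (Suc L) * x) - cis2pi (- real (Suc L) * x)" by (simp add: algebra_simps)
  also have "cis2pi x * cis2pi (real (Suc L) * x) = cis2pi (real (Suc (Suc L)) * x)"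
    by (subst exp_add[symmetric]) (simp add: algebra_simps)
  finally show ?case .
qed

lemma integral_cis2pi: "integral {0..1} (\<lambda>x. cis2pi (- of_int l * x)) = (if l = 0 then 1 else 0)"
proof (cases "l = 0")
  case False
  define c where "c = - 2 * pi * \<i> * of_int l"
  have c: "c \<noteq> 0" using False by (simp add: c_def)
  have "((\<lambda>x. exp (x *\<^sub>R c) / c) has_vector_derivative exp (x *\<^sub>R c)) (at x within {0..1})" for x
    using has_vector_derivative_divide[OF exp_scaleR_has_vector_derivative_right[of c x "{0..1}"], of c] c by simp
  hence "((\<lambda>x. exp (x *\<^sub>R c)) has_integral (exp (1 *\<^sub>R c) / c - exp (0 *\<^sub>R c) / c)) {0..1}"
    by (intro fundamental_theorem_of_calculus) auto
  moreover have "exp c = 1" using cis2pi_int[of "- l"] by (simp add: c_def mult_ac)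
  ultimately have "((\<lambda>x. exp (x *\<^sub>R c)) has_integral 0) {0..1}" by simp
  moreover have "(\<lambda>x. exp (x *\<^sub>R c)) = (\<lambda>x. cis2pi (- of_int l * x))"
    by (rule ext) (simp add: c_def scaleR_conv_of_real mult_ac)
  ultimately have "((\<lambda>x. cis2pi (- of_int l * x)) has_integral 0) {0..1}" by simp
  from integral_unique[OF this] False show ?thesis by simp
qed simp

text \<open>The Dini argument: a partial sum is \<open>f u\<close> plus the integral of
  \<open>g\<close> against the Dirichlet kernel, where \<open>g\<close> vanishes at both ends of the
  period at a Hoelder rate. Near the ends this rate beats the \<open>1 / x\<close> growth of the
  kernel uniformly in \<open>L\<close>; in between the kernel is a fixed continuous function times
  oscillations.\<close>

theorem fourier_series_holder:
  assumes hol: "holder_continuous \<alpha> f" and \<alpha>: "\<alpha> > 0" and per: "\<And>u. f (u + 1) = f u"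
    and cont: "continuous_on UNIV f"
  shows "(\<lambda>L. \<Sum>l\<in>{- int L..int L}. integral {0..1} (\<lambda>x. f x * cis2pi (- of_int l * x)) * cis2pi (of_int l * u)) \<longlonglongrightarrow> f u"
proof -
  define g where "g x = f (x + u) - f u" for x
  define D where "D L x = (\<Sum>l\<in>{- int L..int L}. cis2pi (- of_int l * x))" for L :: nat and x
  obtain H where H: "\<And>u w. cmod (f u - f w) \<le> H * \<bar>u - w\<bar> powr \<alpha>"
    using hol unfolding holder_continuous_def by metis
  have H0: "H \<ge> 0" using order.trans[OF norm_ge_zero H[of 0 1]] by simp
  have cg: "continuous_on S g" for S
    unfolding g_def by (intro continuous_intros continuous_on_compose2[OF cont]) auto
  have cD: "continuous_on S (D L)" for S L unfolding D_def by (intro continuous_intros)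
  have g0: "cmod (g x) \<le> H * \<bar>x\<bar> powr \<alpha>" for x unfolding g_def using H[of "x + u" u] by simp
  have g1: "cmod (g (1 - x)) \<le> H * \<bar>x\<bar> powr \<alpha>" for x
    using H[of "1 - x + u" "u + 1"] per[of u] by (simp add: g_def)
  have cfu: "continuous_on S (\<lambda>x. f (x + u))" for S
    by (intro continuous_on_compose2[OF cont] continuous_intros) auto
  have S: "(\<Sum>l\<in>{- int L..int L}. integral {0..1} (\<lambda>x. f x * cis2pi (- of_int l * x)) * cis2pi (of_int l * u)) =
      f u + integral {0..1} (\<lambda>x. g x * D L x)" for L
  proof -
    have t: "integral {0..1} (\<lambda>x. f x * cis2pi (- of_int l * x)) * cis2pi (of_int l * u) =
        integral {0..1} (\<lambda>x. f (x + u) * cis2pi (- of_int l * x))" for l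
    proof -
      define h where "h x = f x * cis2pi (- of_int l * (x - u))" for x
      have "cis2pi (- of_int l * (x + 1 - u)) = cis2pi (- of_int l * (x - u)) * cis2pi (of_int (- l))" for x
        by (subst exp_add[symmetric]) (simp add: algebra_simps)
      hence hp: "h (x + 1) = h x" for x by (simp only: h_def per cis2pi_int mult_1_right)
      have ch: "continuous_on UNIV h" unfolding h_def by (intro continuous_intros cont)
      have "integral {0..1} (\<lambda>x. f x * cis2pi (- of_int l * x)) * cis2pi (of_int l * u) =
          integral {0..1} (\<lambda>x. f x * cis2pi (- of_int l * x) * cis2pi (of_int l * u))"
        by (rule integral_mult_left[symmetric])
      also have "(\<lambda>x. f x * cis2pi (- of_int l * x) * cis2pi (of_int l * u)) = h"
        by (auto simp: h_def fun_eq_iff mult.assoc algebra_simps simp flip: exp_add)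
      also have "integral {0..1} h = integral {0..1} (\<lambda>x. h (x + u))"
        by (rule integral_periodic_shift[OF hp ch, symmetric])
      finally show ?thesis by (simp add: h_def)
    qed
    have i: "(\<lambda>x. g x * D L x) integrable_on {0..1}" "(\<lambda>x. f u * D L x) integrable_on {0..1}"
      by (intro integrable_continuous_real continuous_intros cg cD)+
    have ID: "integral {0..1} (D L) = 1"
    proof -
      have "integral {0..1} (D L) = (\<Sum>l\<in>{- int L..int L}. integral {0..1} (\<lambda>x. cis2pi (- of_int l * x)))"
        unfolding D_def by (intro integral_sum integrable_continuous_real continuous_intros) auto
      thus ?thesis unfolding integral_cis2pi by (simp add: sum.delta)
    qed
    have "(\<Sum>l\<in>{- int L..int L}. integral {0..1} (\<lambda>x. f x * cis2pi (- of_int l * x)) * cis2pi (of_int l * u)) =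
        (\<Sum>l\<in>{- int L..int L}. integral {0..1} (\<lambda>x. f (x + u) * cis2pi (- of_int l * x)))" unfolding t ..
    also have "\<dots> = integral {0..1} (\<lambda>x. \<Sum>l\<in>{- int L..int L}. f (x + u) * cis2pi (- of_int l * x))"
      by (rule integral_sum[symmetric]) (auto intro!: integrable_continuous_real continuous_intros cfu)
    also have "(\<lambda>x. \<Sum>l\<in>{- int L..int L}. f (x + u) * cis2pi (- of_int l * x)) = (\<lambda>x. g x * D L x + f u * D L x)"
      by (rule ext) (simp only: sum_distrib_left[symmetric] D_def[symmetric] distrib_right[symmetric], simp add: g_def)
    also have "integral {0..1} \<dots> = integral {0..1} (\<lambda>x. g x * D L x) + f u * integral {0..1} (D L)"
      using i by (simp add: integral_add)
    finally show ?thesis by (simp add: ID)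
  qed
  have lim: "(\<lambda>L. integral {0..1} (\<lambda>x. g x * D L x)) \<longlonglongrightarrow> 0"
  proof (rule LIMSEQ_I)
    fix \<epsilon> :: real assume \<epsilon>: "\<epsilon> > 0"
    obtain \<delta>0 where \<delta>0: "\<delta>0 > 0" "\<And>x. \<bar>x\<bar> < \<delta>0 \<Longrightarrow> cmod (cis2pi x - 1) \<ge> \<bar>x\<bar>"
      using cis2pi_lower_bound by blast
    have "((\<lambda>\<delta>. 2 * H * \<delta> powr \<alpha> / \<alpha>) \<longlongrightarrow> 2 * H * 0 powr \<alpha> / \<alpha>) (at_right 0)"
      using \<alpha> by (intro tendsto_intros) (auto intro: eventually_mono[OF eventually_at_right_less[of "0::real"]])
    hence "((\<lambda>\<delta>. 2 * H * \<delta> powr \<alpha> / \<alpha>) \<longlongrightarrow> 0) (at_right 0)" by simp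
    \<comment> \<open>Four contributions of \<open>\<epsilon> / 5\<close> arise: one from each end
      of the period and two from the frequencies in the middle. The fifth share leaves the final
      inequality strict.\<close>
    hence "eventually (\<lambda>\<delta>. 2 * H * \<delta> powr \<alpha> / \<alpha> < \<epsilon> / 5) (at_right 0)"
      by (rule order_tendstoD(2)) (use \<epsilon> in auto)
    moreover have "eventually (\<lambda>\<delta>. \<delta> \<in> {0<..<min \<delta>0 (1/2)}) (at_right (0::real))"
      using \<delta>0 by (intro eventually_at_right_real) auto
    ultimately have "eventually (\<lambda>\<delta>. 2 * H * \<delta> powr \<alpha> / \<alpha> < \<epsilon> / 5 \<and> \<delta> \<in> {0<..<min \<delta>0 (1/2)}) (at_right 0)"
      by eventually_elim auto
    then obtain \<delta> where \<delta>: "2 * H * \<delta> powr \<alpha> / \<alpha> < \<epsilon> / 5" "0 < \<delta>" "\<delta> < \<delta>0" "\<delta> < 1 / 2"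
      by (auto dest!: eventually_happens simp: trivial_limit_at_right_real)
    \<comment> \<open>The sign \<open>s\<close> handles both ends with one estimate: near 1 the
      substitution \<open>1 - x\<close> and periodicity turn the kernel into its value at
      \<open>- x\<close>.\<close>
    have Dle: "cmod (G x * D L (s * x)) \<le> 2 * H * x powr (\<alpha> - 1)"
      if "0 \<le> x" "x \<le> \<delta>" "cmod (G x) \<le> H * x powr \<alpha>" "s = 1 \<or> s = -1" for G x L and s :: real
    proof (cases "x = 0")
      case True
      thus ?thesis using that \<alpha> by simp
    next
      case False
      have sx: "\<bar>s * x\<bar> = x" using that by auto
      have "cmod (cis2pi (s * x) - 1) * cmod (D L (s * x)) =
          cmod (cis2pi (real (Suc L) * (s * x)) - cis2pi (- real L * (s * x)))"
        unfolding D_def norm_mult[symmetric] dirichlet_kernel ..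
      also have "\<dots> \<le> cmod (cis2pi (real (Suc L) * (s * x))) + cmod (cis2pi (- real L * (s * x)))"
        by (rule norm_triangle_ineq4)
      also have "\<dots> = 2" by simp
      finally have "x * cmod (D L (s * x)) \<le> 2"
        using mult_right_mono[OF \<delta>0(2)[of "s * x"], of "cmod (D L (s * x))"] sx \<delta> that by simp
      hence "cmod (D L (s * x)) \<le> 2 / x" using False that by (simp add: field_simps)
      hence "cmod (G x * D L (s * x)) \<le> (H * x powr \<alpha>) * (2 / x)"
        unfolding norm_mult using that H0 by (intro mult_mono) auto
      also have "\<dots> = 2 * H * x powr (\<alpha> - 1)" using False that by (simp add: powr_diff)
      finally show ?thesis .
    qed
    define k where "k x = g x / (cis2pi x - 1)" for x
    have nz: "cis2pi x \<noteq> 1" if "x \<in> {\<delta>..1-\<delta>}" for x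
    proof
      assume "cis2pi x = 1"
      then obtain n :: int where "Im (2 * pi * \<i> * of_real x) = of_int (2 * n) * pi" unfolding exp_eq_1 by blast
      hence x: "x = of_int n" by simp
      have "of_int 0 < x" "x < of_int 1" using that \<delta> by auto
      hence "0 < n" "n < 1" unfolding x of_int_less_iff by auto
      thus False by simp
    qed
    have ck: "continuous_on {\<delta>..1-\<delta>} k"
      unfolding k_def using nz by (intro continuous_intros cg) auto
    have "\<delta> \<le> 1 - \<delta>" "\<epsilon> / 5 > 0" using \<delta> \<epsilon> by auto
    from riemann_lebesgue[OF ck this] obtain N where N: "N > 0" "\<And>w. \<bar>w\<bar> \<ge> N \<Longrightarrow>
        cmod (integral {\<delta>..1-\<delta>} (\<lambda>x. k x * exp (\<i> * of_real (w * x)))) \<le> \<epsilon> / 5" by blast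
    show "\<exists>no. \<forall>L\<ge>no. cmod (integral {0..1} (\<lambda>x. g x * D L x) - 0) < \<epsilon>"
    proof (intro exI[of _ "nat \<lceil>N\<rceil>"] allI impI)
      fix L assume L: "L \<ge> nat \<lceil>N\<rceil>"
      have LN: "real L \<ge> N" using L by linarith
      define h where "h x = g x * D L x" for x
      have ch: "continuous_on S h" for S unfolding h_def by (intro continuous_intros cg cD)
      have ih: "h integrable_on {a..b}" for a b by (intro integrable_continuous_real ch)
      have "cmod (integral {0..1} h) = cmod (integral {0..\<delta>} h + integral {\<delta>..1-\<delta>} h + integral {1-\<delta>..1} h)"
        using \<delta> Henstock_Kurzweil_Integration.integral_combine[of 0 \<delta> "1-\<delta>" h] Henstock_Kurzweil_Integration.integral_combine[of 0 "1-\<delta>" 1 h] ih by simp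
      moreover have "cmod (integral {0..\<delta>} h) \<le> 2 * H * \<delta> powr \<alpha> / \<alpha>"
      proof (rule integral_powr_bound[OF ch _ \<alpha>])
        fix x assume "0 \<le> x" "x \<le> \<delta>"
        thus "cmod (h x) \<le> 2 * H * x powr (\<alpha> - 1)"
          using Dle[of x g 1 L] g0[of x] by (simp add: h_def)
      qed (use \<delta> in auto)
      moreover have "cmod (integral {1-\<delta>..1} h) \<le> 2 * H * \<delta> powr \<alpha> / \<alpha>"
      proof -
        have "integral {1-\<delta>..1} h = integral {-\<delta>+1..0+1} h" by simp
        also have "\<dots> = integral {-\<delta>..-0} (\<lambda>x. h (1 - (- x)))"
          unfolding integral_shift_Icc_real[symmetric] by (simp add: o_def)
        also have "\<dots> = integral {0..\<delta>} (\<lambda>x. h (1 - x))" by (rule Henstock_Kurzweil_Integration.integral_reflect_real[where f = "\<lambda>x. h (1 - x)"])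
        also have "cmod \<dots> \<le> 2 * H * \<delta> powr \<alpha> / \<alpha>"
        proof (rule integral_powr_bound[OF _ _ \<alpha>])
          fix x assume x: "0 \<le> x" "x \<le> \<delta>"
          have "cis2pi (- of_int l * (1 - x)) = cis2pi (of_int (- l)) * cis2pi (- of_int l * (- 1 * x))" for l
            by (subst exp_add[symmetric]) (simp add: algebra_simps)
          hence "D L (1 - x) = D L (- 1 * x)" unfolding D_def cis2pi_int by simp
          thus "cmod (h (1 - x)) \<le> 2 * H * x powr (\<alpha> - 1)"
            using Dle[of x "\<lambda>x. g (1 - x)" "- 1" L] g1[of x] x by (simp add: h_def)
        qed (use \<delta> in \<open>auto intro!: continuous_on_compose2[OF ch[of UNIV]] continuous_intros\<close>)
        finally show ?thesis .
      qed
      moreover have "cmod (integral {\<delta>..1-\<delta>} h) \<le> \<epsilon> / 5 + \<epsilon> / 5"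
      proof -
        define w1 where "w1 = 2 * pi * real (Suc L)"
        define w2 where "w2 = - 2 * pi * real L"
        have pi1: "1 * real L \<le> 2 * pi * real L" using pi_gt3 by (intro mult_right_mono) auto
        have w: "\<bar>w1\<bar> \<ge> N" "\<bar>w2\<bar> \<ge> N" using pi1 LN pi_gt3 by (auto simp: w1_def w2_def abs_mult algebra_simps)
        have hk: "h x = k x * exp (\<i> * of_real (w1 * x)) - k x * exp (\<i> * of_real (w2 * x))" if "x \<in> {\<delta>..1-\<delta>}" for x
        proof -
          have "k x * exp (\<i> * of_real (w1 * x)) - k x * exp (\<i> * of_real (w2 * x)) =
              k x * (cis2pi (real (Suc L) * x) - cis2pi (- real L * x))"
            by (simp add: w1_def w2_def algebra_simps)
          also have "\<dots> = k x * ((cis2pi x - 1) * D L x)" unfolding D_def dirichlet_kernel ..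
          also have "\<dots> = h x" using nz[OF that] by (simp add: k_def h_def)
          finally show ?thesis ..
        qed
        have "integral {\<delta>..1-\<delta>} h = integral {\<delta>..1-\<delta>} (\<lambda>x. k x * exp (\<i> * of_real (w1 * x)) - k x * exp (\<i> * of_real (w2 * x)))"
          by (rule integral_cong) (rule hk)
        also have "\<dots> = integral {\<delta>..1-\<delta>} (\<lambda>x. k x * exp (\<i> * of_real (w1 * x))) - integral {\<delta>..1-\<delta>} (\<lambda>x. k x * exp (\<i> * of_real (w2 * x)))"
          by (intro integral_diff integrable_continuous_real continuous_intros ck)
        also have "cmod \<dots> \<le> \<epsilon> / 5 + \<epsilon> / 5"
          by (intro order.trans[OF norm_triangle_ineq4] add_mono N(2) w)
        finally show ?thesis .
      qed
      ultimately have "cmod (integral {0..1} h) \<le> (2 * H * \<delta> powr \<alpha> / \<alpha>) + (\<epsilon> / 5 + \<epsilon> / 5) + (2 * H * \<delta> powr \<alpha> / \<alpha>)"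
        using norm_triangle_ineq[of "integral {0..\<delta>} h + integral {\<delta>..1-\<delta>} h" "integral {1-\<delta>..1} h"]
          norm_triangle_ineq[of "integral {0..\<delta>} h" "integral {\<delta>..1-\<delta>} h"] by linarith
      also have "\<dots> < \<epsilon>" using \<delta>(1) \<epsilon> by linarith
      finally show "cmod (integral {0..1} (\<lambda>x. g x * D L x) - 0) < \<epsilon>" by (simp add: h_def[abs_def])
    qed
  qed
  show ?thesis unfolding S using tendsto_add[OF tendsto_const[of "f u"] lim] by simp
qed

subsection \<open>Dirichlet series with polynomially bounded coefficients\<close>

lemma compact_Re_lower:
  assumes "compact K" "K \<subseteq> {s. Re s > c}"
  obtains \<sigma> B where "\<sigma> > c" "\<And>s. s \<in> K \<Longrightarrow> Re s \<ge> \<sigma>" "B \<ge> 0" "\<And>s. s \<in> K \<Longrightarrow> cmod s \<le> B"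
proof -
  have "bounded K" using assms(1) by (rule compact_imp_bounded)
  then obtain B where B: "\<And>s. s \<in> K \<Longrightarrow> cmod s \<le> B" unfolding bounded_iff by blast
  have "\<exists>\<sigma>>c. \<forall>s\<in>K. Re s \<ge> \<sigma>"
  proof (cases "K = {}")
    case True
    thus ?thesis by (intro exI[of _ "c + 1"]) auto
  next
    case False
    have "continuous_on K Re" by (intro continuous_intros)
    from continuous_attains_inf[OF assms(1) False this] obtain x where "x \<in> K" "\<forall>y\<in>K. Re x \<le> Re y" by blast
    thus ?thesis using assms(2) by (intro exI[of _ "Re x"]) auto
  qed
  thus ?thesis using B that[of _ "\<bar>B\<bar>"] by (metis abs_ge_self abs_ge_zero order.trans)
qed

lemma Mtest_uniformly_convergent:
  fixes f :: "nat \<Rightarrow> complex \<Rightarrow> complex"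
  assumes "\<And>n s. s \<in> K \<Longrightarrow> cmod (f n s) \<le> M n" "summable M"
  shows "uniformly_convergent_on K (\<lambda>N s. \<Sum>n<N. cmod (f n s))"
    "uniformly_convergent_on K (\<lambda>N s. \<Sum>n<N. f n s)"
    "uniform_limit K (\<lambda>N s. \<Sum>n<N. f n s) (\<lambda>s. \<Sum>n. f n s) sequentially"
proof -
  show "uniform_limit K (\<lambda>N s. \<Sum>n<N. f n s) (\<lambda>s. \<Sum>n. f n s) sequentially"
    by (rule Weierstrass_m_test) (use assms in auto)
  thus "uniformly_convergent_on K (\<lambda>N s. \<Sum>n<N. f n s)" by (rule uniformly_convergentI)
  have "uniform_limit K (\<lambda>N s. \<Sum>n<N. cmod (f n s)) (\<lambda>s. \<Sum>n. cmod (f n s)) sequentially"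
    by (rule Weierstrass_m_test) (use assms in auto)
  thus "uniformly_convergent_on K (\<lambda>N s. \<Sum>n<N. cmod (f n s))" by (rule uniformly_convergentI)
qed

lemma holomorphic_series:
  fixes f :: "nat \<Rightarrow> complex \<Rightarrow> complex"
  assumes "open S" "\<And>n. f n holomorphic_on S"
    and "\<And>K. compact K \<Longrightarrow> K \<subseteq> S \<Longrightarrow> \<exists>M. summable M \<and> (\<forall>n. \<forall>s\<in>K. cmod (f n s) \<le> M n)"
  shows "(\<lambda>s. \<Sum>n. f n s) holomorphic_on S"
proof (rule holomorphic_uniform_sequence[OF assms(1)])
  show "(\<lambda>s. \<Sum>n<N. f n s) holomorphic_on S" for N by (intro holomorphic_intros assms)
  fix x assume "x \<in> S"
  then obtain d where d: "d > 0" "cball x d \<subseteq> S" using assms(1) open_contains_cball by blast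
  obtain M where "summable M" "\<forall>n. \<forall>s\<in>cball x d. cmod (f n s) \<le> M n"
    using assms(3)[OF compact_cball d(2)] by blast
  thus "\<exists>d>0. cball x d \<subseteq> S \<and> uniform_limit (cball x d) (\<lambda>N s. \<Sum>n<N. f n s) (\<lambda>s. \<Sum>n. f n s) sequentially"
    using d by (intro exI[of _ d] conjI Mtest_uniformly_convergent(3)) auto
qed

text \<open>A majorant of product form bounds all partial sums in \<open>k\<close> by
  \<open>g n\<close> times one constant, so Tannery's theorem justifies the exchange.\<close>

lemma suminf_swap_product_bound:
  fixes f :: "nat \<Rightarrow> nat \<Rightarrow> complex"
  assumes b: "\<And>n k. cmod (f n k) \<le> g n * h k" and g: "summable g" and h: "summable h"
    and h0: "\<And>k. h k \<ge> 0" and g0: "\<And>n. g n \<ge> 0"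
  shows "(\<lambda>k. \<Sum>n. f n k) sums (\<Sum>n. \<Sum>k. f n k)"
proof -
  have s1: "summable (\<lambda>n. f n k)" for k
    by (rule summable_comparison_test[OF _ summable_mult2[OF g, of "h k"]]) (use b in auto)
  have s2: "summable (\<lambda>k. f n k)" for n
    by (rule summable_comparison_test[OF _ summable_mult[OF h, of "g n"]]) (use b in auto)
  have "((\<lambda>K. \<Sum>n. \<Sum>k<K. f n k) \<longlonglongrightarrow> (\<Sum>n. \<Sum>k. f n k))"
  proof (rule tannerys_theorem[THEN conjunct2, THEN conjunct2])
    show "(\<lambda>K. \<Sum>k<K. f n k) \<longlonglongrightarrow> (\<Sum>k. f n k)" for n by (rule summable_LIMSEQ[OF s2])
    show "\<forall>\<^sub>F (n, K) in sequentially \<times>\<^sub>F sequentially. cmod (\<Sum>k<K. f n k) \<le> g n * suminf h"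
    proof (intro always_eventually allI, clarify)
      fix n K
      have "cmod (\<Sum>k<K. f n k) \<le> (\<Sum>k<K. g n * h k)" by (intro sum_norm_le b)
      also have "\<dots> = g n * (\<Sum>k<K. h k)" by (simp add: sum_distrib_left)
      also have "\<dots> \<le> g n * suminf h" using h h0 g0 by (intro mult_left_mono sum_le_suminf) auto
      finally show "cmod (\<Sum>k<K. f n k) \<le> g n * suminf h" .
    qed
    show "summable (\<lambda>n. g n * suminf h)" by (rule summable_mult2[OF g])
  qed simp
  moreover have "(\<Sum>n. \<Sum>k<K. f n k) = (\<Sum>k<K. \<Sum>n. f n k)" for K
    by (rule suminf_sum) (use s1 in auto)
  ultimately show ?thesis by (simp add: sums_def)
qed

text \<open>For \<open>cmod s \<le> B\<close> each factor of the numerator is at most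
  \<open>B + i\<close>, and the resulting majorant is the series of
  \<open>(1 - cmod z) powr (- B)\<close>. The bound is uniform in \<open>s\<close>, as locally
  uniform convergence demands.\<close>

lemma gbinomial_summable_majorant:
  fixes z :: complex and B :: real
  assumes z: "cmod z < 1" and B: "B \<ge> 0"
  obtains M where "summable M" "\<And>k. M k \<ge> 0" "\<And>s k. cmod s \<le> B \<Longrightarrow> cmod ((- s gchoose k) * z ^ k) \<le> M k"
proof -
  define M where "M k = (\<Prod>i<k. B + real i) / fact k * cmod z ^ k" for k
  have "(\<lambda>k. ((-B) gchoose k) * (- cmod z) ^ k) sums (1 + (- cmod z)) powr (-B)"
    by (rule gen_binomial_real) (use z in auto)
  moreover have "((-B) gchoose k) * (- cmod z) ^ k = M k" for k
  proof -
    have "(-B) gchoose k = (\<Prod>i<k. (-1) * (B + real i)) / fact k"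
      by (simp add: gbinomial_prod_rev atLeast0LessThan)
    also have "(\<Prod>i<k. (-1) * (B + real i)) = (-1) ^ k * (\<Prod>i<k. B + real i)"
      by (subst prod.distrib) simp
    finally have "((-B) gchoose k) * (- cmod z) ^ k =
        ((-1) ^ k * (\<Prod>i<k. B + real i) / fact k) * ((-1) ^ k * cmod z ^ k)"
      by (simp only: power_minus[of "cmod z"])
    also have "\<dots> = ((-1) ^ k * (-1) ^ k) * M k" by (simp add: M_def)
    also have "(-1) ^ k * (-1) ^ k = (1::real)" by (simp flip: power_mult_distrib)
    finally show ?thesis by simp
  qed
  ultimately have "summable M" by (simp add: sums_iff)
  moreover have "M k \<ge> 0" for k using B by (auto simp: M_def intro!: mult_nonneg_nonneg divide_nonneg_nonneg prod_nonneg)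
  moreover have "cmod ((- s gchoose k) * z ^ k) \<le> M k" if "cmod s \<le> B" for s k
  proof -
    have "cmod ((- s) gchoose k) = (\<Prod>i<k. cmod (- s - of_nat i)) / fact k"
      by (simp add: gbinomial_prod_rev norm_divide prod_norm atLeast0LessThan)
    also have "\<dots> \<le> (\<Prod>i<k. B + real i) / fact k"
    proof (intro divide_right_mono prod_mono conjI)
      fix i
      have "cmod (- s - of_nat i) \<le> cmod (- s) + cmod (of_nat i :: complex)" by (rule norm_triangle_ineq4)
      thus "cmod (- s - of_nat i) \<le> B + real i" using that by simp
    qed auto
    finally show ?thesis unfolding M_def norm_mult norm_power by (intro mult_right_mono) auto
  qed
  ultimately show ?thesis by (rule that)
qed

locale dirichlet_bound =
  fixes a :: "nat \<Rightarrow> complex" and K \<rho> :: real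
  assumes a: "\<And>n. n \<ge> 1 \<Longrightarrow> cmod (a n) \<le> K * real n powr \<rho>"
begin

definition D :: "complex \<Rightarrow> complex" where
  "D s = (\<Sum>n. of_nat (Suc n) powr (- s) * a (Suc n))"

lemma K_nonneg: "K \<ge> 0"
  using order.trans[OF norm_ge_zero a[of 1]] by simp

lemma term_bound:
  assumes "Re s \<ge> \<sigma>"
  shows "cmod (of_nat (Suc n) powr (- s) * a (Suc n)) \<le> K * real (Suc n) powr (\<rho> - \<sigma>)"
proof -
  have "cmod (of_nat (Suc n) powr (- s) * a (Suc n)) = real (Suc n) powr (- Re s) * cmod (a (Suc n))"
    by (simp add: norm_mult norm_powr_real_powr del: of_nat_Suc)
  also have "\<dots> \<le> real (Suc n) powr (- \<sigma>) * (K * real (Suc n) powr \<rho>)"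
    using assms by (intro mult_mono a powr_mono) auto
  also have "\<dots> = K * real (Suc n) powr (\<rho> - \<sigma>)" by (simp add: powr_diff powr_minus field_simps)
  finally show ?thesis .
qed

lemma summable_majorant:
  assumes "\<sigma> > \<rho> + 1"
  shows "summable (\<lambda>n. K * real (Suc n) powr (\<rho> - \<sigma>))"
proof -
  have "summable (\<lambda>n. real n powr (\<rho> - \<sigma>))" using assms by (subst summable_real_powr_iff) auto
  hence "summable (\<lambda>n. real (Suc n) powr (\<rho> - \<sigma>))" by (subst summable_Suc_iff)
  thus ?thesis by (rule summable_mult)
qed

lemma dirichlet_majorant:
  assumes "compact C" "C \<subseteq> {s. Re s > \<rho> + 1}"
  shows "\<exists>M. summable M \<and> (\<forall>n. \<forall>s\<in>C. cmod (of_nat (Suc n) powr (- s) * a (Suc n)) \<le> M n)"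
proof -
  obtain \<sigma> where \<sigma>: "\<sigma> > \<rho> + 1" "\<And>s. s \<in> C \<Longrightarrow> Re s \<ge> \<sigma>" using compact_Re_lower[OF assms] by metis
  show ?thesis
    by (intro exI[of _ "\<lambda>n. K * real (Suc n) powr (\<rho> - \<sigma>)"] conjI summable_majorant \<sigma> allI ballI term_bound)
qed

lemma dirichlet_summable:
  assumes "Re s > \<rho> + 1"
  shows "summable (\<lambda>n. of_nat (Suc n) powr (- s) * a (Suc n))"
  by (rule summable_comparison_test[OF _ summable_majorant[OF assms]])
     (use term_bound[of "Re s" s] in auto)

lemma dirichlet_holomorphic: "D holomorphic_on {s. Re s > \<rho> + 1}"
  unfolding D_def
proof (rule holomorphic_series[OF open_halfspace_Re_gt _ dirichlet_majorant])
  show "(\<lambda>s. of_nat (Suc n) powr (- s) * a (Suc n)) holomorphic_on {s. \<rho> + 1 < Re s}" for n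
    by (intro holomorphic_intros)
qed

lemma dirichlet_bounded:
  assumes "\<sigma> > \<rho> + 1"
  obtains B where "B \<ge> 0" "\<And>s. Re s \<ge> \<sigma> \<Longrightarrow> cmod (D s) \<le> B"
proof (rule that)
  show "(\<Sum>n. K * real (Suc n) powr (\<rho> - \<sigma>)) \<ge> 0"
    by (rule suminf_nonneg[OF summable_majorant[OF assms]]) (simp add: K_nonneg)
  show "cmod (D s) \<le> (\<Sum>n. K * real (Suc n) powr (\<rho> - \<sigma>))" if "Re s \<ge> \<sigma>" for s
    unfolding D_def by (intro norm_suminf_le summable_majorant assms term_bound that)
qed

text \<open>A term of the binomial expansion of the series over
  \<open>((n + z) powr (- s) - n powr (- s)) * a n\<close>. The index starts at 1 because the zeroth
  term is cancelled by the subtraction.\<close>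

definition shift_term :: "complex \<Rightarrow> nat \<Rightarrow> complex \<Rightarrow> complex" where
  "shift_term z k s = ((- s) gchoose (Suc k)) * z ^ Suc k * D (s + of_nat (Suc k))"

text \<open>Even the first shift moves \<open>Re s > \<rho>\<close> into
  \<open>Re s > \<rho> + 1\<close>, where \<open>D\<close> is uniformly bounded; the binomial
  factors are summable. Hence this series converges on a half-plane wider by 1 than that of
  \<open>D\<close>.\<close>

lemma shift_majorant:
  assumes "cmod z < 1" "compact C" "C \<subseteq> {s. Re s > \<rho>}"
  shows "\<exists>M. summable M \<and> (\<forall>n. \<forall>s\<in>C. cmod (shift_term z n s) \<le> M n)"
proof -
  obtain \<sigma> B where \<sigma>: "\<sigma> > \<rho>" "\<And>s. s \<in> C \<Longrightarrow> Re s \<ge> \<sigma>" "B \<ge> 0" "\<And>s. s \<in> C \<Longrightarrow> cmod s \<le> B"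
    using compact_Re_lower[OF assms(2,3)] by metis
  obtain M where M: "summable M" "\<And>k. M k \<ge> 0" "\<And>s k. cmod s \<le> B \<Longrightarrow> cmod ((- s gchoose k) * z ^ k) \<le> M k"
    using gbinomial_summable_majorant[OF assms(1) \<sigma>(3)] by metis
  obtain E where E: "E \<ge> 0" "\<And>s. Re s \<ge> \<sigma> + 1 \<Longrightarrow> cmod (D s) \<le> E"
    using dirichlet_bounded[of "\<sigma> + 1"] \<sigma>(1) by auto
  show ?thesis
  proof (intro exI[of _ "\<lambda>k. M (Suc k) * E"] conjI allI ballI)
    show "summable (\<lambda>k. M (Suc k) * E)" using M(1) by (intro summable_mult2) (subst summable_Suc_iff)
    fix k s assume "s \<in> C"
    thus "cmod (shift_term z k s) \<le> M (Suc k) * E" unfolding shift_term_def norm_mult[of _ "D _"]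
      using \<sigma>(2)[of s] \<sigma>(4)[of s] M by (intro mult_mono E M(3)) auto
  qed
qed

lemma shift_term_holomorphic: "shift_term z k holomorphic_on {s. Re s > \<rho>}"
proof -
  have "D \<circ> (\<lambda>s. s + of_nat (Suc k)) holomorphic_on {s. Re s > \<rho>}"
    by (rule holomorphic_on_compose_gen[OF _ dirichlet_holomorphic]) (auto intro!: holomorphic_intros)
  hence "(\<lambda>s. D (s + of_nat (Suc k))) holomorphic_on {s. Re s > \<rho>}" by (simp only: o_def)
  thus ?thesis unfolding shift_term_def gbinomial_prod_rev
    by (intro holomorphic_intros) auto
qed

lemma shift_series_holomorphic:
  assumes "cmod z < 1"
  shows "(\<lambda>s. \<Sum>k. shift_term z k s) holomorphic_on {s. Re s > \<rho>}"
  by (rule holomorphic_series[OF open_halfspace_Re_gt shift_term_holomorphic shift_majorant[OF assms]])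

text \<open>Factoring out \<open>n powr (- s)\<close> leaves the binomial series of
  \<open>1 + z / n\<close>, whose argument has modulus below 1 for every \<open>n \<ge> 1\<close>.
  The double series has a product majorant, so the order of summation can be exchanged.\<close>

lemma shift_series_eq:
  assumes z: "0 \<le> z" "z < 1" and s: "Re s > \<rho> + 1"
  shows "(\<lambda>n. ((of_nat (Suc n) + of_real z) powr (- s) - of_nat (Suc n) powr (- s)) * a (Suc n)) sums
    (\<Sum>k. shift_term (of_real z) k s)"
proof -
  define c where "c k = ((- s) gchoose (Suc k)) * of_real z ^ Suc k" for k
  define f where "f n k = c k * (of_nat (Suc n) powr (- (s + of_nat (Suc k))) * a (Suc n))" for n k
  obtain M where M: "summable M" "\<And>k. M k \<ge> 0" "\<And>k. cmod ((- s gchoose k) * of_real z ^ k) \<le> M k"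
    using gbinomial_summable_majorant[of "of_real z" "cmod s"] z by (metis abs_of_nonneg norm_ge_zero norm_of_real order.refl)
  have b: "cmod (f n k) \<le> K * real (Suc n) powr (\<rho> - Re s) * M (Suc k)" for n k
  proof -
    have "cmod (f n k) = cmod (c k) * cmod (of_nat (Suc n) powr (- (s + of_nat (Suc k))) * a (Suc n))"
      by (simp only: f_def norm_mult)
    also have "\<dots> \<le> M (Suc k) * (K * real (Suc n) powr (\<rho> - Re s))"
      unfolding c_def by (intro mult_mono M(3) term_bound M) auto
    finally have "cmod (f n k) \<le> M (Suc k) * (K * real (Suc n) powr (\<rho> - Re s))" .
    thus ?thesis by (simp add: mult_ac)
  qed
  have "(\<lambda>k. \<Sum>n. f n k) sums (\<Sum>n. \<Sum>k. f n k)"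
  proof (rule suminf_swap_product_bound[OF b summable_majorant[OF s]])
    show "summable (\<lambda>k. M (Suc k))" using M(1) by (subst summable_Suc_iff)
  qed (use M K_nonneg in auto)
  hence 1: "(\<Sum>k. \<Sum>n. f n k) = (\<Sum>n. \<Sum>k. f n k)" by (rule sums_unique[symmetric])
  have "(\<Sum>n. f n k) = shift_term (of_real z) k s" for k
    unfolding f_def shift_term_def D_def c_def
    by (rule suminf_mult) (rule dirichlet_summable, use s in simp)
  hence 2: "(\<Sum>k. \<Sum>n. f n k) = (\<Sum>k. shift_term (of_real z) k s)" by simp
  have 3: "(\<lambda>k. f n k) sums (((of_nat (Suc n) + of_real z) powr (- s) - of_nat (Suc n) powr (- s)) * a (Suc n))" for n
  proof -
    define w where "w = complex_of_real z / of_nat (Suc n)"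
    have "z / real (Suc n) < 1" using z by (simp add: divide_less_eq)
    hence w: "cmod w < 1" using z unfolding w_def norm_divide norm_of_nat by simp
    have "(\<lambda>k. ((- s) gchoose k) * w ^ k) sums ((1 + w) powr (- s))" by (rule gen_binomial_complex[OF w])
    hence "(\<lambda>k. ((- s) gchoose (Suc k)) * w ^ Suc k) sums ((1 + w) powr (- s) - 1)"
      by (subst sums_Suc_iff) simp
    hence "(\<lambda>k. of_nat (Suc n) powr (- s) * a (Suc n) * (((- s) gchoose (Suc k)) * w ^ Suc k)) sums
        (of_nat (Suc n) powr (- s) * a (Suc n) * ((1 + w) powr (- s) - 1))" by (rule sums_mult)
    moreover have "of_nat (Suc n) powr (- s) * a (Suc n) * (((- s) gchoose (Suc k)) * w ^ Suc k) = f n k" for k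
    proof -
      have "- (s + of_nat (Suc k)) = - s - of_nat (Suc k)" by simp
      hence "of_nat (Suc n) powr (- (s + of_nat (Suc k))) = of_nat (Suc n) powr (- s) / (of_nat (Suc n) ^ Suc k :: complex)"
        by (simp only: powr_diff) (simp add: powr_nat' del: of_nat_Suc power_Suc)
      thus ?thesis by (simp add: f_def c_def w_def power_divide del: of_nat_Suc power_Suc)
    qed
    moreover have "of_nat (Suc n) powr (- s) * (1 + w) powr (- s) = (of_nat (Suc n) + of_real z) powr (- s)"
    proof -
      have "1 + w = of_real (1 + z / real (Suc n))" by (simp add: w_def)
      hence "of_nat (Suc n) powr (- s) * (1 + w) powr (- s) = (of_nat (Suc n) * (1 + w)) powr (- s)"
        using z by (intro powr_times_real[symmetric]) (auto simp del: of_nat_Suc of_real_add simp: Reals_of_real intro!: add_nonneg_nonneg)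
      also have "of_nat (Suc n) * (1 + w) = of_nat (Suc n) + of_real z" by (simp add: w_def field_simps del: of_nat_Suc)
      finally show ?thesis .
    qed
    ultimately show ?thesis by (simp add: algebra_simps del: of_nat_Suc)
  qed
  have 4: "summable (\<lambda>n. \<Sum>k. f n k)"
  proof (rule summable_comparison_test)
    show "summable (\<lambda>n. K * real (Suc n) powr (\<rho> - Re s) * (\<Sum>k. M (Suc k)))"
      by (intro summable_mult2 summable_majorant s)
    have sM: "summable (\<lambda>k. M (Suc k))" using M(1) by (subst summable_Suc_iff)
    have "cmod (\<Sum>k. f n k) \<le> (\<Sum>k. K * real (Suc n) powr (\<rho> - Re s) * M (Suc k))" for n
      by (intro norm_suminf_le b summable_mult sM)
    thus "\<exists>N. \<forall>n\<ge>N. cmod (\<Sum>k. f n k) \<le> K * real (Suc n) powr (\<rho> - Re s) * (\<Sum>k. M (Suc k))"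
      using sM by (simp add: suminf_mult)
  qed
  have "(\<lambda>n. \<Sum>k. f n k) sums (\<Sum>k. shift_term (of_real z) k s)"
    using summable_sums[OF 4] 1 2 by simp
  moreover have "(\<Sum>k. f n k) = ((of_nat (Suc n) + of_real z) powr (- s) - of_nat (Suc n) powr (- s)) * a (Suc n)" for n
    using 3 by (rule sums_unique[symmetric])
  ultimately show ?thesis by simp
qed

end

subsection \<open>Laplace transforms of periodic functions\<close>

definition period_laplace :: "(real \<Rightarrow> complex) \<Rightarrow> complex \<Rightarrow> complex" where
  "period_laplace f z = integral {0..1} (\<lambda>u. exp (- z * of_real u) * f u)"

text \<open>The geometric series over the periods: this is the meromorphic continuation of the Laplace
  transform of \<open>f\<close> over \<open>[0, \<infinity>)\<close>.\<close>
definition laplace_cont :: "(real \<Rightarrow> complex) \<Rightarrow> complex \<Rightarrow> complex" where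
  "laplace_cont f z = period_laplace f z / (1 - exp (- z))"

context
  fixes f :: "real \<Rightarrow> complex"
  assumes per: "\<And>u. f (u + 1) = f u" and cont: "continuous_on UNIV f"
begin

lemma moment_integral_deriv:
  "((\<lambda>z. integral {a..b} (\<lambda>u. (- of_real u) ^ k * exp (- z * of_real u) * f u)) has_field_derivative
     integral {a..b} (\<lambda>u. (- of_real u) ^ Suc k * exp (- z * of_real u) * f u)) (at z)"
proof -
  have cf: "continuous_on S f" for S using continuous_on_subset[OF cont] by auto
  have cf2: "continuous_on S (\<lambda>p. f (snd p))" for S :: "(complex \<times> real) set"
    by (rule continuous_on_compose2[OF cont]) (auto intro!: continuous_intros)
  have "((\<lambda>z. integral (cbox a b) (\<lambda>u. (- of_real u) ^ k * exp (- z * of_real u) * f u)) has_field_derivative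
     integral (cbox a b) (\<lambda>u. (- of_real u) ^ Suc k * exp (- z * of_real u) * f u)) (at z within UNIV)"
  proof (rule leibniz_rule_field_derivative)
    show "((\<lambda>z. (- of_real u) ^ k * exp (- z * of_real u) * f u) has_field_derivative
       (- of_real u) ^ Suc k * exp (- z * of_real u) * f u) (at z within UNIV)" for z u
      by (auto intro!: derivative_eq_intros)
    show "(\<lambda>u. (- of_real u) ^ k * exp (- z * of_real u) * f u) integrable_on cbox a b" for z
      by (intro integrable_continuous continuous_intros cf)
    show "continuous_on (UNIV \<times> cbox a b) (\<lambda>(z, u). (- of_real u) ^ Suc k * exp (- z * of_real u) * f u)"
      unfolding split_def by (intro continuous_intros cf2)
  qed auto
  thus ?thesis by simp
qed

lemma moment_integral_higher_deriv:
  "(deriv ^^ k) (\<lambda>z. integral {a..b} (\<lambda>u. exp (- z * of_real u) * f u)) =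
     (\<lambda>z. integral {a..b} (\<lambda>u. (- of_real u) ^ k * exp (- z * of_real u) * f u))"
proof (induction k)
  case (Suc k)
  have "(deriv ^^ Suc k) (\<lambda>z. integral {a..b} (\<lambda>u. exp (- z * of_real u) * f u)) =
      deriv (\<lambda>z. integral {a..b} (\<lambda>u. (- of_real u) ^ k * exp (- z * of_real u) * f u))"
    using Suc by simp
  thus ?case using moment_integral_deriv[THEN DERIV_imp_deriv] by (simp add: fun_eq_iff)
qed simp

lemma period_laplace_holomorphic: "period_laplace f holomorphic_on S"
proof -
  have "period_laplace f field_differentiable at z" for z
    using moment_integral_deriv[of 0 1 0 z] unfolding field_differentiable_def period_laplace_def[abs_def] by auto
  thus ?thesis unfolding holomorphic_on_def using field_differentiable_at_within by blast
qed

lemma laplace_cont_holomorphic: "laplace_cont f holomorphic_on {z. exp (- z) \<noteq> 1}"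
  unfolding laplace_cont_def[abs_def] by (intro holomorphic_intros period_laplace_holomorphic) auto

text \<open>Each period contributes the first one times a power of \<open>exp (- z)\<close>, a
  finite geometric series. The multiplied form also covers the zeros of
  \<open>1 - exp (- z)\<close>.\<close>

lemma laplace_partial:
  "integral {0..real N} (\<lambda>u. exp (- z * of_real u) * f u) * (1 - exp (- z)) =
     period_laplace f z * (1 - exp (- z * of_nat N))"
proof (induction N)
  case 0
  show ?case by simp
next
  case (Suc N)
  let ?g = "\<lambda>u. exp (- z * of_real u) * f u"
  have cg: "continuous_on S ?g" for S using continuous_on_subset[OF cont] by (intro continuous_intros) auto
  have "integral {0..real (Suc N)} ?g = integral {0..real N} ?g + integral {real N..real (Suc N)} ?g"
    by (rule Henstock_Kurzweil_Integration.integral_combine[symmetric])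
       (simp, simp, rule integrable_continuous_real[OF cg])
  also have "integral {real N..real (Suc N)} ?g = integral {0 + real N..1 + real N} ?g" by (simp add: add.commute)
  also have "\<dots> = integral {0..1} (?g \<circ> ((+) (real N)))" by (rule integral_shift_Icc_real[symmetric])
  also have "?g \<circ> ((+) (real N)) = (\<lambda>u. exp (- z * of_nat N) * ?g u)"
  proof
    fix u
    have "f (real N + u) = f u"
    proof (induction N)
      case (Suc N)
      have "f (real (Suc N) + u) = f ((real N + u) + 1)" by (simp add: algebra_simps)
      thus ?case using per[of "real N + u"] Suc by simp
    qed simp
    moreover have "exp (- z * of_real (real N + u)) = exp (- z * of_nat N) * exp (- z * of_real u)"
      by (subst exp_add[symmetric]) (simp add: algebra_simps)
    ultimately show "(?g \<circ> ((+) (real N))) u = exp (- z * of_nat N) * ?g u" by simp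
  qed
  also have "integral {0..1} \<dots> = exp (- z * of_nat N) * period_laplace f z"
    unfolding period_laplace_def by (rule integral_mult_right)
  finally have "integral {0..real (Suc N)} ?g * (1 - exp (- z)) =
      integral {0..real N} ?g * (1 - exp (- z)) + exp (- z * of_nat N) * period_laplace f z * (1 - exp (- z))"
    by (simp add: algebra_simps)
  also have "\<dots> = period_laplace f z * (1 - exp (- z * of_nat N) * exp (- z))"
    unfolding Suc by (simp add: algebra_simps)
  also have "exp (- z * of_nat N) * exp (- z) = exp (- z * of_nat (Suc N))"
    by (subst exp_add[symmetric]) (simp add: algebra_simps)
  finally show ?case .
qed

text \<open>The factor \<open>u ^ k\<close> arises from differentiating \<open>exp (- z * u)\<close>
  in \<open>z\<close>, with one sign per derivative. Uniform convergence of the undifferentiated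
  integrals on a half-plane then yields convergence of all derivatives.\<close>

lemma laplace_moment_limit:
  assumes "Re z > 0"
  shows "(\<lambda>N. integral {0..real N} (\<lambda>u. of_real u ^ k * exp (- z * of_real u) * f u)) \<longlonglongrightarrow>
           (-1) ^ k * (deriv ^^ k) (laplace_cont f) z"
proof -
  \<comment> \<open>Half of \<open>Re z\<close> leaves an open neighbourhood of \<open>z\<close> on
    which the tails are uniformly bounded by a multiple of
    \<open>exp (- \<delta>) ^ N\<close>.\<close>
  define \<delta> where "\<delta> = Re z / 2"
  define A where "A = {z. Re z > \<delta>}"
  have \<delta>: "\<delta> > 0" "z \<in> A" using assms by (auto simp: \<delta>_def A_def)
  have "open A" unfolding A_def by (rule open_halfspace_Re_gt)
  note \<delta> = \<delta> this
  have cf: "continuous_on {0..1} f" using continuous_on_subset[OF cont] by auto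
  have "bounded (f ` {0..1})" by (intro compact_imp_bounded compact_continuous_image cf) auto
  then obtain B where B: "\<And>u. u \<in> {0..1} \<Longrightarrow> cmod (f u) \<le> B" unfolding bounded_iff by blast
  define C where "C = B / (1 - exp (- \<delta>))"
  have ed: "exp (- \<delta>) < 1" using \<delta> by simp
  define F where "F N z = integral {0..real N} (\<lambda>u. exp (- z * of_real u) * f u)" for N z
  have diff: "cmod (F N w - laplace_cont f w) \<le> C * exp (- \<delta>) ^ N" if w: "w \<in> A" for w N
  proof -
    have Rw: "Re w > \<delta>" using w by (simp add: A_def)
    have ew: "cmod (exp (- w)) \<le> exp (- \<delta>)" using Rw by simp
    have dn: "cmod (1 - exp (- w)) \<ge> 1 - exp (- \<delta>)"
      using norm_triangle_ineq2[of 1 "exp (- w)"] ew unfolding norm_one by linarith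
    have nz: "1 - exp (- w) \<noteq> 0" using dn ed by auto
    have PB: "cmod (period_laplace f w) \<le> B * (1 - 0)"
      unfolding period_laplace_def
    proof (rule integral_bound)
      fix u :: real assume u: "u \<in> {0..1}"
      have "Re w * u \<ge> 0" using u Rw \<delta> by simp
      hence "cmod (exp (- w * of_real u)) \<le> 1" by simp
      hence "cmod (exp (- w * of_real u)) * cmod (f u) \<le> 1 * B" using B[OF u] by (intro mult_mono) auto
      thus "cmod (exp (- w * of_real u) * f u) \<le> B" by (simp add: norm_mult)
    qed (auto intro!: continuous_intros cf)
    have "F N w - laplace_cont f w = - (period_laplace f w * exp (- w * of_nat N)) / (1 - exp (- w))"
    proof -
      have "F N w = period_laplace f w * (1 - exp (- w * of_nat N)) / (1 - exp (- w))"
        using laplace_partial[of N w] nz by (simp add: eq_divide_eq F_def)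
      thus ?thesis unfolding laplace_cont_def by (simp add: diff_divide_distrib[symmetric] algebra_simps)
    qed
    hence "cmod (F N w - laplace_cont f w) = cmod (period_laplace f w) * cmod (exp (- w)) ^ N / cmod (1 - exp (- w))"
      by (simp add: norm_divide norm_mult flip: norm_power exp_of_nat2_mult)
    also have "\<dots> \<le> B * exp (- \<delta>) ^ N / (1 - exp (- \<delta>))"
      using PB dn ed ew B[of 0] by (intro frac_le mult_mono power_mono mult_nonneg_nonneg) (auto intro: order.trans[OF norm_ge_zero])
    finally show ?thesis by (simp add: C_def)
  qed
  have lim0: "(\<lambda>N. C * exp (- \<delta>) ^ N) \<longlonglongrightarrow> 0"
    using ed by (intro tendsto_mult_right_zero LIMSEQ_power_zero) auto
  have ul: "uniform_limit A F (laplace_cont f) sequentially"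
  proof (rule uniform_limitI)
    fix e :: real assume "e > 0"
    from order_tendstoD(2)[OF lim0 this]
    show "\<forall>\<^sub>F N in sequentially. \<forall>w\<in>A. dist (F N w) (laplace_cont f w) < e"
      by eventually_elim (use diff in \<open>auto simp: dist_norm intro: le_less_trans\<close>)
  qed
  have hol: "F N holomorphic_on A" for N
  proof -
    have "F N field_differentiable at z" for z
      using moment_integral_deriv[of 0 "real N" 0 z] unfolding field_differentiable_def F_def[abs_def] by auto
    thus ?thesis unfolding holomorphic_on_def using field_differentiable_at_within by blast
  qed
  have "(\<lambda>N. (deriv ^^ k) (F N) z) \<longlonglongrightarrow> (deriv ^^ k) (laplace_cont f) z"
    by (rule higher_deriv_complex_uniform_limit[OF ul]) (use hol \<delta> in auto)
  hence "(\<lambda>N. (-1) ^ k * (deriv ^^ k) (F N) z) \<longlonglongrightarrow> (-1) ^ k * (deriv ^^ k) (laplace_cont f) z"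
    by (intro tendsto_intros)
  moreover have "(-1) ^ k * (deriv ^^ k) (F N) z = integral {0..real N} (\<lambda>u. of_real u ^ k * exp (- z * of_real u) * f u)" for N
  proof -
    have "(-1) ^ k * (deriv ^^ k) (F N) z =
        (-1) ^ k * integral {0..real N} (\<lambda>u. (- of_real u) ^ k * exp (- z * of_real u) * f u)"
      unfolding F_def[abs_def] moment_integral_higher_deriv ..
    also have "\<dots> = integral {0..real N} (\<lambda>u. (-1) ^ k * ((- of_real u) ^ k * exp (- z * of_real u) * f u))"
      by (rule integral_mult_right[symmetric])
    also have "(\<lambda>u. (-1) ^ k * ((- of_real u) ^ k * exp (- z * of_real u) * f u)) =
        (\<lambda>u. of_real u ^ k * exp (- z * of_real u) * f u)"
      by (simp add: fun_eq_iff mult.assoc[symmetric] flip: power_mult_distrib)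
    finally show ?thesis .
  qed
  ultimately show ?thesis by simp
qed

text \<open>The denominator has derivative 1 at \<open>z0\<close>, so the quotient has at most a
  simple pole there with coefficient \<open>period_laplace f z0\<close>. After subtracting it the
  singularity is removable, and differentiating both parts gives the formula for all
  \<open>k\<close>.\<close>

lemma laplace_cont_higher_deriv_pole:
  assumes z0: "exp (- z0) = 1" and r: "r > 0"
    and ne: "\<And>z. z \<in> ball z0 r - {z0} \<Longrightarrow> exp (- z) \<noteq> 1"
  obtains g where "\<And>k. g k holomorphic_on ball z0 r" "\<And>k z. z \<in> ball z0 r - {z0} \<Longrightarrow>
    (deriv ^^ k) (laplace_cont f) z = (-1) ^ k * fact k * period_laplace f z0 / (z - z0) ^ Suc k + g k z"
proof -
  have lim1: "((\<lambda>z. (1 - exp (- z)) / (z - z0)) \<longlongrightarrow> 1) (at z0)"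
  proof -
    have "((\<lambda>z. 1 - exp (- z)) has_field_derivative 1) (at z0)"
      using z0 by (auto intro!: derivative_eq_intros)
    thus ?thesis unfolding has_field_derivative_iff using z0 by simp
  qed
  define S where "S = ball z0 r - {z0}"
  have S: "open S" by (auto simp: S_def)
  define c where "c = period_laplace f z0"
  define h where "h z = laplace_cont f z - c / (z - z0)" for z
  have hh: "h holomorphic_on ball z0 r - {z0}"
    unfolding h_def using ne
    by (intro holomorphic_intros holomorphic_on_subset[OF laplace_cont_holomorphic]) auto
  have "((\<lambda>z. (z - z0) * h z) \<longlongrightarrow> 0) (at z0)"
  proof -
    have "isCont (period_laplace f) z0"
      using holomorphic_on_imp_differentiable_at[OF period_laplace_holomorphic[of UNIV], of z0]
      by (auto intro: field_differentiable_imp_continuous_at)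
    hence "((\<lambda>z. period_laplace f z / ((1 - exp (- z)) / (z - z0)) - c) \<longlongrightarrow> period_laplace f z0 / 1 - c) (at z0)"
      by (intro tendsto_intros lim1) (auto simp: isCont_def)
    hence "((\<lambda>z. period_laplace f z / ((1 - exp (- z)) / (z - z0)) - c) \<longlongrightarrow> 0) (at z0)" by (simp add: c_def)
    moreover have "eventually (\<lambda>z. period_laplace f z / ((1 - exp (- z)) / (z - z0)) - c = (z - z0) * h z) (at z0)"
      unfolding eventually_at_filter
    proof (intro always_eventually allI impI)
      fix z assume "z \<noteq> z0"
      thus "period_laplace f z / ((1 - exp (- z)) / (z - z0)) - c = (z - z0) * h z"
        unfolding h_def right_diff_distrib[of "z - z0"] by (simp add: laplace_cont_def mult.commute)
    qed
    ultimately show ?thesis by (rule Lim_transform_eventually)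
  qed
  then obtain g where g: "g holomorphic_on ball z0 r" "\<And>z. z \<in> ball z0 r - {z0} \<Longrightarrow> g z = h z"
    using holomorphic_on_extend_lim[OF hh] r by auto
  have "\<forall>z\<in>S. (deriv ^^ k) (laplace_cont f) z = (-1) ^ k * fact k * c / (z - z0) ^ Suc k + (deriv ^^ k) g z" for k
  proof (induction k)
    case 0
    show ?case using g(2) by (auto simp: S_def h_def)
  next
    case (Suc k)
    show ?case
    proof
      fix z assume z: "z \<in> S"
      hence nz: "z \<noteq> z0" by (auto simp: S_def)
      have dg: "((deriv ^^ k) g has_field_derivative deriv ((deriv ^^ k) g) z) (at z)"
        using z by (intro holomorphic_derivI[OF holomorphic_higher_deriv[OF g(1)]]) (auto simp: S_def)
      have d1: "((\<lambda>z. (-1) ^ k * fact k * c / (z - z0) ^ Suc k) has_field_derivative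
           (-1) ^ Suc k * fact (Suc k) * c / (z - z0) ^ Suc (Suc k)) (at z)"
      proof -
        have d0: "((\<lambda>z. (-1) ^ k * fact k * c * inverse ((z - z0) ^ Suc k)) has_field_derivative
           (-1) ^ k * fact k * c * (- (inverse ((z - z0) ^ Suc k) * (of_nat (Suc k) * (z - z0) ^ k) * inverse ((z - z0) ^ Suc k)))) (at z)"
        proof -
          have p: "((\<lambda>z. (z - z0) ^ Suc k) has_field_derivative of_nat (Suc k) * (z - z0) ^ k) (at z)"
            by (rule DERIV_cong[OF DERIV_power[OF DERIV_diff[OF DERIV_ident DERIV_const]]]) simp
          have "(z - z0) ^ Suc k \<noteq> 0" using nz by simp
          from DERIV_cmult[OF DERIV_inverse_fun[OF p this], of "(-1) ^ k * fact k * c"] this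
          show ?thesis by (auto elim!: DERIV_cong simp: divide_simps simp del: of_nat_Suc power_Suc)
        qed
        have eqn: "(-1) ^ k * fact k * c * (- (inverse ((z - z0) ^ Suc k) * (of_nat (Suc k) * (z - z0) ^ k) * inverse ((z - z0) ^ Suc k))) =
           (-1) ^ Suc k * fact (Suc k) * c / (z - z0) ^ Suc (Suc k)"
        proof -
          have "b * (- (inverse (w ^ Suc k) * (n * w ^ k) * inverse (w ^ Suc k))) = - (n * b) / w ^ Suc (Suc k)"
            if "w \<noteq> 0" for b n w :: complex
            using that by (simp add: field_simps)
          moreover have "- (of_nat (Suc k) * ((-1) ^ k * fact k * c)) = (-1) ^ Suc k * fact (Suc k) * c"
            by (simp add: mult_ac del: of_nat_Suc)
          moreover have "z - z0 \<noteq> 0" using nz by simp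
          ultimately show ?thesis by metis
        qed
        show ?thesis using DERIV_cong[OF d0 eqn] by (simp only: divide_inverse)
      qed
      have "((deriv ^^ k) (laplace_cont f) has_field_derivative
          (-1) ^ Suc k * fact (Suc k) * c / (z - z0) ^ Suc (Suc k) + deriv ((deriv ^^ k) g) z) (at z)"
        by (rule has_field_derivative_transform_within_open[OF DERIV_add[OF d1 dg] S z]) (use Suc in auto)
      thus "(deriv ^^ Suc k) (laplace_cont f) z = (-1) ^ Suc k * fact (Suc k) * c / (z - z0) ^ Suc (Suc k) + (deriv ^^ Suc k) g z"
        by (simp add: DERIV_imp_deriv)
    qed
  qed
  thus ?thesis using g(1)
    by (intro that[of "\<lambda>k. (deriv ^^ k) g"]) (auto simp: S_def c_def intro!: holomorphic_higher_deriv)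
qed

end

subsection \<open>Mellin transforms and residues\<close>

text \<open>Multiplication by \<open>(s - \<zeta>) ^ k\<close> moves the coefficient of index
  \<open>k\<close> to the simple pole. Terms with smaller index become holomorphic; those with
  larger index keep a pole of order at least 2 with a constant numerator, which has no
  residue.\<close>

lemma residue_principal_part:
  assumes r: "r > 0" and A: "A holomorphic_on ball \<zeta> r"
    and f: "\<And>s. s \<in> ball \<zeta> r - {\<zeta>} \<Longrightarrow> f s = (\<Sum>j<m. c j / (s - \<zeta>) ^ Suc j) + A s" and k: "k < m"
  shows "residue (\<lambda>s. f s * (s - \<zeta>) ^ k) \<zeta> = c k"
proof -
  define T where "T j s = c j / (s - \<zeta>) ^ Suc j * (s - \<zeta>) ^ k" for j s
  have Th: "T j holomorphic_on ball \<zeta> r - {\<zeta>}" for j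
    unfolding T_def by (intro holomorphic_intros) auto
  have ev: "eventually (\<lambda>s. s \<in> ball \<zeta> r - {\<zeta>}) (at \<zeta>)"
    unfolding eventually_at using r by (intro exI[of _ r]) (auto simp: dist_commute)
  have T: "residue (T j) \<zeta> = (if j = k then c k else 0)" for j
  proof (cases j k rule: linorder_cases)
    case less
    have "residue (T j) \<zeta> = residue (\<lambda>s. c j * (s - \<zeta>) ^ (k - Suc j)) \<zeta>"
    proof (rule residue_cong[OF eventually_mono[OF ev]])
      fix s assume s: "s \<in> ball \<zeta> r - {\<zeta>}"
      have "(s - \<zeta>) ^ k = (s - \<zeta>) ^ Suc j * (s - \<zeta>) ^ (k - Suc j)"
        using less by (subst power_add[symmetric]) simp
      thus "T j s = c j * (s - \<zeta>) ^ (k - Suc j)" using s by (simp add: T_def del: power_Suc)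
    qed simp
    also have "\<dots> = 0" by (rule residue_holo[of UNIV]) (auto intro!: holomorphic_intros)
    finally show ?thesis using less by simp
  next
    case equal
    have "residue (T j) \<zeta> = residue (\<lambda>s. c k / (s - \<zeta>)) \<zeta>"
      by (rule residue_cong[OF eventually_mono[OF ev]]) (auto simp: T_def equal)
    also have "\<dots> = c k" by (rule residue_simple[of UNIV]) auto
    finally show ?thesis using equal by simp
  next
    case greater
    have "residue (T j) \<zeta> = residue (\<lambda>s. c j / (s - \<zeta>) ^ Suc (j - k)) \<zeta>"
    proof (rule residue_cong[OF eventually_mono[OF ev]])
      fix s assume s: "s \<in> ball \<zeta> r - {\<zeta>}"
      have "(s - \<zeta>) ^ Suc j = (s - \<zeta>) ^ Suc (j - k) * (s - \<zeta>) ^ k"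
        using greater by (subst power_add[symmetric]) simp
      thus "T j s = c j / (s - \<zeta>) ^ Suc (j - k)" using s by (simp add: T_def del: power_Suc)
    qed simp
    also have "\<dots> = (deriv ^^ (j - k)) (\<lambda>_. c j) \<zeta> / fact (j - k)"
      by (rule residue_holomorphic_over_power[of UNIV]) auto
    also have "\<dots> = 0" using greater by simp
    finally show ?thesis using greater by simp
  qed
  have sum: "residue (\<lambda>s. \<Sum>j<n. T j s) \<zeta> = (\<Sum>j<n. residue (T j) \<zeta>)" for n
  proof (induction n)
    case (Suc n)
    have "residue (\<lambda>s. (\<Sum>j<n. T j s) + T n s) \<zeta> = residue (\<lambda>s. \<Sum>j<n. T j s) \<zeta> + residue (T n) \<zeta>"
      by (rule residue_add[of "ball \<zeta> r"]) (use r Th in \<open>auto intro!: holomorphic_on_sum\<close>)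
    thus ?case using Suc by simp
  qed (simp add: residue_const)
  define B where "B s = A s * (s - \<zeta>) ^ k" for s
  have B: "B holomorphic_on ball \<zeta> r" unfolding B_def by (intro holomorphic_intros A)
  have "residue (\<lambda>s. f s * (s - \<zeta>) ^ k) \<zeta> = residue (\<lambda>s. (\<Sum>j<m. T j s) + B s) \<zeta>"
    by (rule residue_cong[OF eventually_mono[OF ev]]) (auto simp: f T_def B_def sum_distrib_right distrib_right)
  also have "\<dots> = residue (\<lambda>s. \<Sum>j<m. T j s) \<zeta> + residue B \<zeta>"
    by (rule residue_add[of "ball \<zeta> r"]) (use r Th B in \<open>auto intro!: holomorphic_on_sum intro: holomorphic_on_subset\<close>)
  also have "residue B \<zeta> = 0" by (rule residue_holo[OF _ _ B]) (use r in auto)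
  finally show ?thesis using k unfolding sum T by (simp add: sum.delta)
qed

lemma countable_exp_level:
  assumes "c \<noteq> 0"
  shows "countable {s :: complex. exp (s * c) = w}"
proof (cases "\<exists>s0. exp (s0 * c) = w")
  case True
  then obtain s0 where s0: "exp (s0 * c) = w" by blast
  have "{s. exp (s * c) = w} \<subseteq> (\<lambda>n::int. s0 + (of_int (2 * n) * pi) * \<i> / c) ` UNIV"
  proof
    fix s assume "s \<in> {s. exp (s * c) = w}"
    hence "exp (s * c) = exp (s0 * c)" using s0 by simp
    then obtain n :: int where "s * c = s0 * c + (of_int (2 * n) * pi) * \<i>" unfolding exp_eq by blast
    hence "s = s0 + (of_int (2 * n) * pi) * \<i> / c" using assms by (simp add: field_simps)
    thus "s \<in> (\<lambda>n::int. s0 + (of_int (2 * n) * pi) * \<i> / c) ` UNIV" by blast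
  qed
  thus ?thesis by (rule countable_subset) auto
next
  case False
  hence "{s. exp (s * c) = w} = {}" by auto
  thus ?thesis by simp
qed

text \<open>For \<open>t > 0\<close> this is the complex power \<open>t powr (- s - 1)\<close>; the
  exponential form lets derivatives in \<open>s\<close> and in \<open>t\<close> be taken by the
  standard rules.\<close>

definition mellin_kernel :: "complex \<Rightarrow> real \<Rightarrow> complex" where
  "mellin_kernel s t = exp ((- s - 1) * of_real (ln t))"

lemma mellin_kernel_continuous: "continuous_on {1..} (mellin_kernel s)"
  unfolding mellin_kernel_def by (intro continuous_intros) auto

lemma mellin_kernel_norm_le:
  assumes n: "n \<ge> 1" "real n \<le> t" "t \<le> real n + 1" and s: "Re s \<ge> \<sigma>"
  shows "cmod (mellin_kernel s t) \<le> 2 powr \<bar>\<sigma> + 1\<bar> * real n powr (- \<sigma> - 1)"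
proof -
  have t: "t \<ge> 1" using n by linarith
  have "cmod (mellin_kernel s t) = t powr (- Re s - 1)"
    using t by (simp add: mellin_kernel_def powr_def algebra_simps)
  also have "\<dots> \<le> t powr (- \<sigma> - 1)" using t s by (intro powr_mono) auto
  also have "\<dots> \<le> 2 powr \<bar>\<sigma> + 1\<bar> * real n powr (- \<sigma> - 1)"
  proof (cases "\<sigma> + 1 \<ge> 0")
    case True
    have "t powr (- \<sigma> - 1) \<le> real n powr (- \<sigma> - 1)" using n t True by (intro powr_mono2') auto
    also have "\<dots> \<le> 2 powr \<bar>\<sigma> + 1\<bar> * real n powr (- \<sigma> - 1)"
      using ge_one_powr_ge_zero[of 2 "\<bar>\<sigma> + 1\<bar>"] mult_right_mono[of 1 "2 powr \<bar>\<sigma> + 1\<bar>" "real n powr (- \<sigma> - 1)"] by simp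
    finally show ?thesis .
  next
    case False
    have "t \<le> 2 * real n" using n by linarith
    hence "t powr (- \<sigma> - 1) \<le> (2 * real n) powr (- \<sigma> - 1)" using t False by (intro powr_mono2) auto
    also have "\<dots> = 2 powr (- \<sigma> - 1) * real n powr (- \<sigma> - 1)" by (rule powr_mult)
    also have "2 powr (- \<sigma> - 1) = 2 powr \<bar>\<sigma> + 1\<bar>" using False by simp
    finally show ?thesis .
  qed
  finally show ?thesis .
qed

lemma mellin_kernel_integral:
  assumes "s \<noteq> 0" "n \<ge> 1"
  shows "integral {real n..real (Suc n)} (mellin_kernel s) = (of_nat n powr (- s) - of_nat (Suc n) powr (- s)) / s"
proof -
  have "((\<lambda>t. exp (- s * of_real (ln t)) / (- s)) has_vector_derivative mellin_kernel s t) (at t within {real n..real (Suc n)})"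
    if t: "t \<in> {real n..real (Suc n)}" for t
  proof -
    have t0: "t > 0" using t assms by auto
    have "((\<lambda>t. of_real (ln t) :: complex) has_vector_derivative of_real (1 / t)) (at t within {real n..real (Suc n)})"
      using t0 by (auto intro!: has_vector_derivative_of_real derivative_eq_intros simp flip: has_real_derivative_iff_has_vector_derivative)
    hence "((\<lambda>z. exp (- s * z) / (- s)) \<circ> (\<lambda>t. of_real (ln t)) has_vector_derivative
        of_real (1 / t) * (exp (- s * of_real (ln t)))) (at t within {real n..real (Suc n)})"
      by (rule field_vector_diff_chain_within) (use assms in \<open>auto intro!: derivative_eq_intros\<close>)
    moreover have "of_real (1 / t) * exp (- s * of_real (ln t)) = mellin_kernel s t"
    proof -
      have "of_real (1 / t) = exp (- of_real (ln t) :: complex)"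
      proof -
        have "exp (- of_real (ln t) :: complex) = of_real (exp (- ln t))" by (simp flip: exp_of_real)
        thus ?thesis using t0 by (simp add: exp_minus inverse_eq_divide)
      qed
      thus ?thesis unfolding mellin_kernel_def by (simp only: exp_add[symmetric]) (rule arg_cong[of _ _ exp], simp add: algebra_simps)
    qed
    ultimately show ?thesis by (simp add: o_def)
  qed
  hence "(mellin_kernel s has_integral (exp (- s * of_real (ln (real (Suc n)))) / (- s) - exp (- s * of_real (ln (real n))) / (- s))) {real n..real (Suc n)}"
    by (intro fundamental_theorem_of_calculus) auto
  moreover have "of_nat k powr (- s) = exp (- s * of_real (ln (real k)))" if "k \<ge> 1" for k
    using that by (simp add: powr_def Ln_of_nat)
  ultimately show ?thesis using assms by (simp add: integral_unique diff_divide_distrib del: of_nat_Suc)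
qed

text \<open>The matrices are gone: only a coefficient bound and an approximation of the partial sums
  by a function of real \<open>t\<close> remain. In \<open>approx\<close> the sum includes
  \<open>x n\<close>, so it is constant while \<open>t\<close> runs from \<open>n\<close> to
  \<open>n + 1\<close>.\<close>

locale summatory_expansion = dirichlet_bound x K \<rho> for x K \<rho> +
  fixes q :: nat and \<Lambda> :: "complex set" and m :: "complex \<Rightarrow> nat"
    and \<Phi> :: "complex \<Rightarrow> nat \<Rightarrow> real \<Rightarrow> complex" and \<rho>' c :: real and F :: "real \<Rightarrow> complex"
  assumes q: "q \<ge> 2" and fin: "finite \<Lambda>" and nz: "0 \<notin> \<Lambda>"
    and per: "\<And>lam k u. lam \<in> \<Lambda> \<Longrightarrow> k < m lam \<Longrightarrow> \<Phi> lam k (u + 1) = \<Phi> lam k u"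
    and cont: "\<And>lam k. lam \<in> \<Lambda> \<Longrightarrow> k < m lam \<Longrightarrow> continuous_on UNIV (\<Phi> lam k)"
    and F: "\<And>t. t \<ge> 1 \<Longrightarrow> F t = (\<Sum>lam\<in>\<Lambda>. exp (of_real (ln t / ln (real q)) * Ln lam) *
        (\<Sum>k<m lam. of_real (ln t / ln (real q)) ^ k * \<Phi> lam k (ln t / ln (real q))))"
    and approx: "\<And>n t. n \<ge> 1 \<Longrightarrow> real n \<le> t \<Longrightarrow> t \<le> real n + 1 \<Longrightarrow>
       cmod ((\<Sum>j<Suc n. x j) - F t) \<le> c * real n powr \<rho>'"
begin

abbreviation "L \<equiv> ln (real q)"

lemma L_pos: "L > 0" using q by simp

lemma c_nonneg: "c \<ge> 0" using order.trans[OF norm_ge_zero approx[of 1 1]] by simp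

lemma F_continuous: "continuous_on {1..} F"
proof -
  have 1: "continuous_on {1..} (\<lambda>t. ln t / L)" using L_pos by (intro continuous_intros) auto
  have "continuous_on {1..} (\<lambda>t. \<Sum>lam\<in>\<Lambda>. exp (of_real (ln t / L) * Ln lam) *
        (\<Sum>k<m lam. of_real (ln t / L) ^ k * \<Phi> lam k (ln t / L)))"
    by (intro continuous_intros 1 continuous_on_compose2[OF cont 1]) auto
  thus ?thesis by (subst continuous_on_cong[OF refl F]) auto
qed

text \<open>The contribution of one unit interval to the Mellin transform of the approximation
  error. The index is shifted because the transform starts at \<open>t = 1\<close>; the inner sum
  ends with \<open>x (Suc n)\<close>, matching the left endpoint.\<close>

definition err :: "nat \<Rightarrow> complex \<Rightarrow> complex" where
  "err n s = integral {real (Suc n)..real (Suc (Suc n))} (\<lambda>t. ((\<Sum>j<Suc (Suc n). x j) - F t) * mellin_kernel s t)"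

definition Err :: "complex \<Rightarrow> complex" where
  "Err s = (\<Sum>n. err n s)"

lemma err_bound:
  assumes "Re s \<ge> \<sigma>"
  shows "cmod (err n s) \<le> c * 2 powr \<bar>\<sigma> + 1\<bar> * real (Suc n) powr (\<rho>' - \<sigma> - 1)"
proof -
  have "cmod (err n s) \<le> (c * 2 powr \<bar>\<sigma> + 1\<bar> * real (Suc n) powr (\<rho>' - \<sigma> - 1)) * (real (Suc (Suc n)) - real (Suc n))"
    unfolding err_def
  proof (rule integral_bound)
    show "continuous_on {real (Suc n)..real (Suc (Suc n))} (\<lambda>t. ((\<Sum>j<Suc (Suc n). x j) - F t) * mellin_kernel s t)"
      by (intro continuous_intros continuous_on_subset[OF F_continuous] continuous_on_subset[OF mellin_kernel_continuous]) auto
    fix t assume t: "t \<in> {real (Suc n)..real (Suc (Suc n))}"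
    have "cmod (((\<Sum>j<Suc (Suc n). x j) - F t) * mellin_kernel s t) \<le>
        (c * real (Suc n) powr \<rho>') * (2 powr \<bar>\<sigma> + 1\<bar> * real (Suc n) powr (- \<sigma> - 1))"
      unfolding norm_mult using t assms
      by (intro mult_mono approx mellin_kernel_norm_le) (auto intro!: mult_nonneg_nonneg c_nonneg)
    also have "\<dots> = c * 2 powr \<bar>\<sigma> + 1\<bar> * (real (Suc n) powr \<rho>' * real (Suc n) powr (- \<sigma> - 1))" by simp
    also have "real (Suc n) powr \<rho>' * real (Suc n) powr (- \<sigma> - 1) = real (Suc n) powr (\<rho>' - \<sigma> - 1)"
      by (subst powr_add[symmetric]) (simp add: algebra_simps)
    finally show "cmod (((\<Sum>j<Suc (Suc n). x j) - F t) * mellin_kernel s t) \<le> c * 2 powr \<bar>\<sigma> + 1\<bar> * real (Suc n) powr (\<rho>' - \<sigma> - 1)" .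
  qed simp
  thus ?thesis by simp
qed

lemma err_majorant_summable:
  assumes "\<sigma> > \<rho>'"
  shows "summable (\<lambda>n. c * 2 powr \<bar>\<sigma> + 1\<bar> * real (Suc n) powr (\<rho>' - \<sigma> - 1))"
proof -
  have "summable (\<lambda>n. real n powr (\<rho>' - \<sigma> - 1))" using assms by (subst summable_real_powr_iff) auto
  hence "summable (\<lambda>n. real (Suc n) powr (\<rho>' - \<sigma> - 1))" by (subst summable_Suc_iff)
  thus ?thesis by (rule summable_mult)
qed

lemma err_holomorphic: "err n holomorphic_on UNIV"
proof -
  let ?X = "\<Sum>j<Suc (Suc n). x j"
  have "(\<lambda>s. integral (cbox (real (Suc n)) (real (Suc (Suc n)))) (\<lambda>t. (?X - F t) * mellin_kernel s t)) holomorphic_on UNIV"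
  proof (rule leibniz_rule_holomorphic)
    show "((\<lambda>s. (?X - F t) * mellin_kernel s t) has_field_derivative (?X - F t) * (- of_real (ln t) * mellin_kernel s t)) (at s within UNIV)" for s t
      unfolding mellin_kernel_def by (auto intro!: derivative_eq_intros)
    show "(\<lambda>t. (?X - F t) * mellin_kernel s t) integrable_on cbox (real (Suc n)) (real (Suc (Suc n)))" for s
      by (intro integrable_continuous continuous_intros continuous_on_subset[OF F_continuous] continuous_on_subset[OF mellin_kernel_continuous]) auto
    show "continuous_on (UNIV \<times> cbox (real (Suc n)) (real (Suc (Suc n)))) (\<lambda>(s, t). (?X - F t) * (- of_real (ln t) * mellin_kernel s t))"
      unfolding split_def mellin_kernel_def
      by (intro continuous_intros continuous_on_compose2[OF F_continuous]) (auto intro!: continuous_intros)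
  qed auto
  thus ?thesis by (simp add: err_def[abs_def])
qed

lemma Err_holomorphic: "Err holomorphic_on {s. Re s > \<rho>'}"
  unfolding Err_def[abs_def]
proof (rule holomorphic_series)
  show "open {s. Re s > \<rho>'}" by (rule open_halfspace_Re_gt)
  show "err n holomorphic_on {s. Re s > \<rho>'}" for n by (rule holomorphic_on_subset[OF err_holomorphic]) auto
  fix C assume C: "compact C" "C \<subseteq> {s. Re s > \<rho>'}"
  obtain \<sigma> where \<sigma>: "\<sigma> > \<rho>'" "\<And>s. s \<in> C \<Longrightarrow> Re s \<ge> \<sigma>" using compact_Re_lower[OF C] by metis
  show "\<exists>M. summable M \<and> (\<forall>n. \<forall>s\<in>C. cmod (err n s) \<le> M n)"
    using err_majorant_summable[OF \<sigma>(1)] err_bound \<sigma>(2) by blast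
qed

text \<open>A crude bound that is insensitive to the sign of \<open>\<rho>\<close>. It only has to
  kill the boundary term of partial summation far to the right.\<close>

lemma summatory_growth: "cmod (\<Sum>j<Suc n. x j) \<le> (cmod (x 0) + K) * real (Suc n) powr (\<bar>\<rho>\<bar> + 1)"
proof -
  have "cmod (\<Sum>j<Suc n. x j) \<le> (\<Sum>j<Suc n. (cmod (x 0) + K) * real (Suc n) powr \<bar>\<rho>\<bar>)"
  proof (rule sum_norm_le)
    fix j assume j: "j \<in> {..<Suc n}"
    have p1: "1 \<le> real (Suc n) powr \<bar>\<rho>\<bar>" by (rule ge_one_powr_ge_zero) auto
    show "cmod (x j) \<le> (cmod (x 0) + K) * real (Suc n) powr \<bar>\<rho>\<bar>"
    proof (cases "j = 0")
      case True
      have "cmod (x 0) * 1 \<le> (cmod (x 0) + K) * real (Suc n) powr \<bar>\<rho>\<bar>"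
        using p1 K_nonneg by (intro mult_mono) auto
      thus ?thesis using True by simp
    next
      case False
      hence "cmod (x j) \<le> K * real j powr \<rho>" by (intro a) auto
      also have "real j powr \<rho> \<le> real j powr \<bar>\<rho>\<bar>" using False by (intro powr_mono) auto
      also have "real j powr \<bar>\<rho>\<bar> \<le> real (Suc n) powr \<bar>\<rho>\<bar>" using j by (intro powr_mono2) auto
      finally have "cmod (x j) \<le> K * real (Suc n) powr \<bar>\<rho>\<bar>" using K_nonneg by (simp add: mult_left_mono)
      also have "\<dots> \<le> (cmod (x 0) + K) * real (Suc n) powr \<bar>\<rho>\<bar>" by (intro mult_right_mono) auto
      finally show ?thesis .
    qed
  qed
  also have "\<dots> = (cmod (x 0) + K) * real (Suc n) powr (\<bar>\<rho>\<bar> + 1)" by (simp add: powr_add)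
  finally show ?thesis .
qed

text \<open>The summatory function starts at index 0 and the Dirichlet series at index 1. This
  mismatch is the origin of the summand \<open>x 0\<close> in the residue formula.\<close>

lemma partial_summation:
  "x 0 + (\<Sum>n<N. of_nat (Suc n) powr (- s) * x (Suc n)) =
     (\<Sum>n<N. (\<Sum>j<Suc (Suc n). x j) * (of_nat (Suc n) powr (- s) - of_nat (Suc (Suc n)) powr (- s)))
     + (\<Sum>j<Suc N. x j) * of_nat (Suc N) powr (- s)"
proof -
  define p where "p n = complex_of_nat (Suc n) powr (- s)" for n
  define Y where "Y n = (\<Sum>j<Suc n. x j)" for n
  have "x 0 + (\<Sum>n<N. p n * x (Suc n)) = (\<Sum>n<N. Y (Suc n) * (p n - p (Suc n))) + Y N * p N"
  proof (induction N)
    case 0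
    show ?case by (simp add: p_def Y_def)
  next
    case (Suc N)
    have "Y (Suc N) = Y N + x (Suc N)" by (simp add: Y_def)
    thus ?case using Suc by (simp add: algebra_simps)
  qed
  thus ?thesis by (simp only: p_def Y_def)
qed

lemma mellin_integral_split:
  "(\<Sum>n<N. (\<Sum>j<Suc (Suc n). x j) * integral {real (Suc n)..real (Suc (Suc n))} (mellin_kernel s)) =
     integral {1..real (Suc N)} (\<lambda>t. F t * mellin_kernel s t) + (\<Sum>n<N. err n s)"
proof (induction N)
  case (Suc N)
  have i: "(\<lambda>t. F t * mellin_kernel s t) integrable_on {a..b}" "mellin_kernel s integrable_on {a..b}" if "1 \<le> a" for a b
    using that
    by (auto intro!: integrable_continuous_real continuous_intros continuous_on_subset[OF F_continuous] continuous_on_subset[OF mellin_kernel_continuous])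
  have "integral {1..real (Suc (Suc N))} (\<lambda>t. F t * mellin_kernel s t) = integral {1..real (Suc N)} (\<lambda>t. F t * mellin_kernel s t)
      + integral {real (Suc N)..real (Suc (Suc N))} (\<lambda>t. F t * mellin_kernel s t)"
    by (rule Henstock_Kurzweil_Integration.integral_combine[symmetric]) (use i in auto)
  moreover have "err N s = (\<Sum>j<Suc (Suc N). x j) * integral {real (Suc N)..real (Suc (Suc N))} (mellin_kernel s)
      - integral {real (Suc N)..real (Suc (Suc N))} (\<lambda>t. F t * mellin_kernel s t)"
    unfolding err_def left_diff_distrib using i[of "real (Suc N)"]
    by (subst integral_diff) (auto intro!: integrable_on_mult_right)
  ultimately show ?case using Suc by (simp del: of_nat_Suc add: algebra_simps)
qed simp

text \<open>The substitution \<open>t = q powr u\<close> turns the transform into Laplace integrals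
  with argument \<open>s * ln q - Ln lam\<close>. The upper limit is a power of \<open>q\<close>, so
  that they extend over whole periods.\<close>

lemma mellin_main_term:
  "integral {1..real (q ^ M)} (\<lambda>t. F t * mellin_kernel s t) =
     (\<Sum>lam\<in>\<Lambda>. \<Sum>k<m lam. of_real L * integral {0..real M} (\<lambda>u. of_real u ^ k * exp (- (s * of_real L - Ln lam) * of_real u) * \<Phi> lam k u))"
proof -
  define g where "g u = exp (L * u)" for u
  have gM: "g (real M) = real (q ^ M)" using q by (simp add: g_def exp_of_nat_mult mult.commute)
  have "((\<lambda>u. (L * g u) *\<^sub>R (F (g u) * mellin_kernel s (g u))) has_integral
      integral {g 0..g (real M)} (\<lambda>t. F t * mellin_kernel s t)) {0..real M}"
  proof (rule has_integral_substitution)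
    show "g ` {0..real M} \<subseteq> {1..g (real M)}" "g 0 \<le> g (real M)"
      using L_pos by (auto simp: g_def)
    show "continuous_on {1..g (real M)} (\<lambda>t. F t * mellin_kernel s t)"
      by (intro continuous_intros continuous_on_subset[OF F_continuous] continuous_on_subset[OF mellin_kernel_continuous]) auto
    show "(g has_field_derivative L * g u) (at u within {0..real M})" for u
      unfolding g_def[abs_def] by (auto intro!: derivative_eq_intros)
  qed auto
  hence "integral {1..real (q ^ M)} (\<lambda>t. F t * mellin_kernel s t) =
      integral {0..real M} (\<lambda>u. (L * g u) *\<^sub>R (F (g u) * mellin_kernel s (g u)))"
    unfolding gM by (simp add: integral_unique g_def)
  also have "\<dots> = integral {0..real M} (\<lambda>u. \<Sum>lam\<in>\<Lambda>. \<Sum>k<m lam. of_real L * (of_real u ^ k * exp (- (s * of_real L - Ln lam) * of_real u) * \<Phi> lam k u))"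
  proof (rule integral_cong)
    fix u :: real assume u: "u \<in> {0..real M}"
    have g1: "g u \<ge> 1" using u L_pos by (simp add: g_def)
    have lg: "ln (g u) / L = u" "ln (g u) = L * u" using L_pos by (simp_all add: g_def)
    have e: "of_real (g u) * mellin_kernel s (g u) = exp (- s * of_real L * of_real u)"
      unfolding mellin_kernel_def lg by (simp add: g_def algebra_simps flip: exp_of_real exp_add)
    have "(L * g u) *\<^sub>R (F (g u) * mellin_kernel s (g u)) = of_real L * F (g u) * (of_real (g u) * mellin_kernel s (g u))"
      by (simp add: scaleR_conv_of_real)
    also have "\<dots> = (\<Sum>lam\<in>\<Lambda>. \<Sum>k<m lam. of_real L * (of_real u ^ k * (exp (of_real u * Ln lam) * exp (- s * of_real L * of_real u)) * \<Phi> lam k u))"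
      unfolding e F[OF g1] lg by (simp add: sum_distrib_left sum_distrib_right mult_ac)
    also have "\<dots> = (\<Sum>lam\<in>\<Lambda>. \<Sum>k<m lam. of_real L * (of_real u ^ k * exp (- (s * of_real L - Ln lam) * of_real u) * \<Phi> lam k u))"
      by (intro sum.cong refl, subst exp_add[symmetric]) (simp add: algebra_simps)
    finally show "(L * g u) *\<^sub>R (F (g u) * mellin_kernel s (g u)) =
       (\<Sum>lam\<in>\<Lambda>. \<Sum>k<m lam. of_real L * (of_real u ^ k * exp (- (s * of_real L - Ln lam) * of_real u) * \<Phi> lam k u))" .
  qed
  also have "\<dots> = (\<Sum>lam\<in>\<Lambda>. \<Sum>k<m lam. of_real L * integral {0..real M} (\<lambda>u. of_real u ^ k * exp (- (s * of_real L - Ln lam) * of_real u) * \<Phi> lam k u))"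
  proof -
    have i: "(\<lambda>u. of_real L * (of_real u ^ k * exp (- (s * of_real L - Ln lam) * of_real u) * \<Phi> lam k u)) integrable_on {0..real M}"
      if "lam \<in> \<Lambda>" "k < m lam" for lam k
      by (intro integrable_continuous_real continuous_intros continuous_on_subset[OF cont[OF that]]) auto
    have "integral {0..real M} (\<lambda>u. \<Sum>lam\<in>\<Lambda>. \<Sum>k<m lam. of_real L * (of_real u ^ k * exp (- (s * of_real L - Ln lam) * of_real u) * \<Phi> lam k u)) =
        (\<Sum>lam\<in>\<Lambda>. integral {0..real M} (\<lambda>u. \<Sum>k<m lam. of_real L * (of_real u ^ k * exp (- (s * of_real L - Ln lam) * of_real u) * \<Phi> lam k u)))"
      by (rule integral_sum[OF fin]) (use i in \<open>auto intro!: integrable_sum\<close>)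
    also have "\<dots> = (\<Sum>lam\<in>\<Lambda>. \<Sum>k<m lam. integral {0..real M} (\<lambda>u. of_real L * (of_real u ^ k * exp (- (s * of_real L - Ln lam) * of_real u) * \<Phi> lam k u)))"
      by (intro sum.cong refl integral_sum) (use i in auto)
    also have "\<dots> = (\<Sum>lam\<in>\<Lambda>. \<Sum>k<m lam. of_real L * integral {0..real M} (\<lambda>u. of_real u ^ k * exp (- (s * of_real L - Ln lam) * of_real u) * \<Phi> lam k u))"
      by (intro sum.cong refl integral_mult_right)
    finally show ?thesis .
  qed
  finally show ?thesis .
qed

definition main_part :: "complex \<Rightarrow> complex" where
  "main_part s = (\<Sum>lam\<in>\<Lambda>. \<Sum>k<m lam. of_real L * ((-1) ^ k * (deriv ^^ k) (laplace_cont (\<Phi> lam k)) (s * of_real L - Ln lam)))"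

text \<open>Partial summation followed by integration of the kernel identifies
  \<open>(x 0 + D s) / s\<close> with the Mellin transform of the partial sums, which splits into
  main term and error. The hypotheses place \<open>s\<close> far enough to the right for every piece
  to converge.\<close>

lemma dirichlet_eq_main_part:
  assumes s: "Re s > \<bar>\<rho>\<bar> + 1" "Re s > \<rho>'" and lam: "\<And>lam. lam \<in> \<Lambda> \<Longrightarrow> Re s * L > ln (cmod lam)"
  shows "(x 0 + D s) / s = main_part s + Err s"
proof -
  have s0: "s \<noteq> 0" using s by auto
  define P where "P N = (x 0 + (\<Sum>n<N. of_nat (Suc n) powr (- s) * x (Suc n)) - (\<Sum>j<Suc N. x j) * of_nat (Suc N) powr (- s)) / s" for N
  have P: "P N = integral {1..real (Suc N)} (\<lambda>t. F t * mellin_kernel s t) + (\<Sum>n<N. err n s)" for N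
  proof -
    have "P N = (\<Sum>n<N. (\<Sum>j<Suc (Suc n). x j) * ((of_nat (Suc n) powr (- s) - of_nat (Suc (Suc n)) powr (- s)) / s))"
      unfolding P_def partial_summation by (simp add: sum_divide_distrib)
    also have "\<dots> = (\<Sum>n<N. (\<Sum>j<Suc (Suc n). x j) * integral {real (Suc n)..real (Suc (Suc n))} (mellin_kernel s))"
      using s0 by (intro sum.cong refl) (subst mellin_kernel_integral, auto)
    also have "\<dots> = integral {1..real (Suc N)} (\<lambda>t. F t * mellin_kernel s t) + (\<Sum>n<N. err n s)"
      by (rule mellin_integral_split)
    finally show ?thesis .
  qed
  have "(\<lambda>N. (\<Sum>j<Suc N. x j) * of_nat (Suc N) powr (- s)) \<longlonglongrightarrow> 0"
  proof (rule Lim_null_comparison)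
    show "\<forall>\<^sub>F N in sequentially. cmod ((\<Sum>j<Suc N. x j) * of_nat (Suc N) powr (- s)) \<le> (cmod (x 0) + K) * real (Suc N) powr (\<bar>\<rho>\<bar> + 1 - Re s)"
    proof (intro always_eventually allI)
      fix N
      have "cmod ((\<Sum>j<Suc N. x j) * of_nat (Suc N) powr (- s)) \<le> (cmod (x 0) + K) * real (Suc N) powr (\<bar>\<rho>\<bar> + 1) * real (Suc N) powr (- Re s)"
        unfolding norm_mult by (intro mult_mono summatory_growth) (auto simp: norm_powr_real_powr K_nonneg simp del: of_nat_Suc)
      also have "\<dots> = (cmod (x 0) + K) * real (Suc N) powr (\<bar>\<rho>\<bar> + 1 - Re s)"
        by (simp add: mult.assoc powr_add[symmetric] del: of_nat_Suc)
      finally show "cmod ((\<Sum>j<Suc N. x j) * of_nat (Suc N) powr (- s)) \<le> (cmod (x 0) + K) * real (Suc N) powr (\<bar>\<rho>\<bar> + 1 - Re s)" .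
    qed
    have "(\<lambda>N. real N powr (\<bar>\<rho>\<bar> + 1 - Re s)) \<longlonglongrightarrow> 0"
      using s by (intro tendsto_neg_powr filterlim_real_sequentially) auto
    thus "(\<lambda>N. (cmod (x 0) + K) * real (Suc N) powr (\<bar>\<rho>\<bar> + 1 - Re s)) \<longlonglongrightarrow> 0"
      by (intro tendsto_mult_right_zero LIMSEQ_Suc)
  qed
  moreover have "(\<lambda>N. \<Sum>n<N. of_nat (Suc n) powr (- s) * x (Suc n)) \<longlonglongrightarrow> D s"
    unfolding D_def by (intro summable_LIMSEQ dirichlet_summable) (use s in auto)
  ultimately have "P \<longlonglongrightarrow> (x 0 + D s - 0) / s" unfolding P_def using s0 by (intro tendsto_intros)
  hence limP: "P \<longlonglongrightarrow> (x 0 + D s) / s" by simp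
  \<comment> \<open>The Laplace limits are known along whole periods, so the limit is taken along
    this subsequence; the interval of integration then ends at \<open>q ^ M\<close>.\<close>
  define \<nu> where "\<nu> M = q ^ M - 1" for M
  have \<nu>: "strict_mono \<nu>"
    unfolding \<nu>_def strict_mono_Suc_iff using q by (auto intro!: diff_less_mono)
  have \<nu>S: "Suc (\<nu> M) = q ^ M" for M using q by (simp add: \<nu>_def)
  have "(\<lambda>M. P (\<nu> M)) \<longlonglongrightarrow> (x 0 + D s) / s" using LIMSEQ_subseq_LIMSEQ[OF limP \<nu>] by (simp add: o_def)
  moreover have "(\<lambda>M. P (\<nu> M)) \<longlonglongrightarrow> main_part s + Err s"
    unfolding P \<nu>S
  proof (intro tendsto_add)
    show "(\<lambda>M. integral {1..real (q ^ M)} (\<lambda>t. F t * mellin_kernel s t)) \<longlonglongrightarrow> main_part s"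
      unfolding mellin_main_term main_part_def
    proof (intro tendsto_sum tendsto_mult_left)
      fix lam k assume l: "lam \<in> \<Lambda>" "k \<in> {..<m lam}"
      have "lam \<noteq> 0" using l nz by auto
      hence "Re (s * of_real L - Ln lam) > 0" using lam[OF l(1)] by simp
      thus "(\<lambda>M. integral {0..real M} (\<lambda>u. of_real u ^ k * exp (- (s * of_real L - Ln lam) * of_real u) * \<Phi> lam k u)) \<longlonglongrightarrow>
          (-1) ^ k * (deriv ^^ k) (laplace_cont (\<Phi> lam k)) (s * of_real L - Ln lam)"
        using l by (intro laplace_moment_limit) (auto intro: per cont)
    qed
    have "summable (\<lambda>n. err n s)"
      by (rule summable_comparison_test[OF _ err_majorant_summable[OF s(2)]]) (use err_bound[of "Re s" s] in auto)
    hence "(\<lambda>N. \<Sum>n<N. err n s) \<longlonglongrightarrow> Err s" unfolding Err_def by (rule summable_LIMSEQ)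
    from LIMSEQ_subseq_LIMSEQ[OF this \<nu>] show "(\<lambda>M. \<Sum>n<\<nu> M. err n s) \<longlonglongrightarrow> Err s" by (simp add: o_def)
  qed
  ultimately show ?thesis using LIMSEQ_unique by blast
qed

definition pole_set :: "complex set \<Rightarrow> complex set" where
  "pole_set Sp = {s. exp (s * of_real L) \<in> Sp}"

lemma main_part_holomorphic:
  assumes \<Gamma>: "\<Gamma> \<subseteq> \<Lambda>"
  shows "(\<lambda>s. \<Sum>lam\<in>\<Gamma>. \<Sum>k<m lam. of_real L * ((-1) ^ k * (deriv ^^ k) (laplace_cont (\<Phi> lam k)) (s * of_real L - Ln lam)))
    holomorphic_on - pole_set \<Gamma>"
proof (intro holomorphic_on_sum holomorphic_on_mult holomorphic_on_const)
  fix lam k assume l': "lam \<in> \<Gamma>" "k \<in> {..<m lam}"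
  hence l: "lam \<in> \<Lambda>" "k \<in> {..<m lam}" using \<Gamma> by auto
  define U where "U = {z :: complex. exp (- z) \<noteq> 1}"
  have oU: "open U" unfolding U_def by (intro open_Collect_neq continuous_intros)
  have "(deriv ^^ k) (laplace_cont (\<Phi> lam k)) holomorphic_on U"
    unfolding U_def using l oU
    by (intro holomorphic_higher_deriv laplace_cont_holomorphic) (auto intro: per cont simp: U_def)
  hence "(deriv ^^ k) (laplace_cont (\<Phi> lam k)) \<circ> (\<lambda>s. s * of_real L - Ln lam) holomorphic_on - pole_set \<Gamma>"
  proof (rule holomorphic_on_compose_gen[rotated])
    show "(\<lambda>s. s * of_real L - Ln lam) ` (- pole_set \<Gamma>) \<subseteq> U"
    proof
      fix z assume "z \<in> (\<lambda>s. s * of_real L - Ln lam) ` (- pole_set \<Gamma>)"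
      then obtain s where s: "s \<notin> pole_set \<Gamma>" "z = s * of_real L - Ln lam" by auto
      have "lam \<noteq> 0" using l nz by auto
      hence "exp (- z) = lam / exp (s * of_real L)" unfolding s(2) by (simp add: exp_diff)
      moreover have "exp (s * of_real L) \<noteq> lam" using s(1) l' by (auto simp: pole_set_def)
      ultimately show "z \<in> U" by (auto simp: U_def divide_eq_1_iff)
    qed
  qed (auto intro!: holomorphic_intros)
  thus "(\<lambda>s. (deriv ^^ k) (laplace_cont (\<Phi> lam k)) (s * of_real L - Ln lam)) holomorphic_on - pole_set \<Gamma>"
    by (simp add: o_def)
qed

text \<open>Closedness makes the complement open, and countability keeps it connected inside a
  half-plane; both are prerequisites of the identity theorem.\<close>

lemma pole_set_props:
  assumes "finite Sp"
  shows "closed (pole_set Sp)" "countable (pole_set Sp)"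
proof -
  have "closed ((\<lambda>s. exp (s * of_real L)) -` Sp)"
    using assms by (intro closed_vimage finite_imp_closed continuous_intros)
  thus "closed (pole_set Sp)" by (simp add: pole_set_def vimage_def)
  have "pole_set Sp = (\<Union>w\<in>Sp. {s. exp (s * of_real L) = w})" by (auto simp: pole_set_def)
  moreover have "countable \<dots>"
    using assms L_pos by (intro countable_UN countable_exp_level) (auto simp: countable_finite)
  ultimately show "countable (pole_set Sp)" by simp
qed

text \<open>Far to the right \<open>(x 0 + W s) / s\<close> equals main part plus error, and
  analytic continuation brings this identity close to \<open>\<zeta>\<close>. There only the summand
  of \<open>lam\<close> is singular, and its principal part has coefficients given by the Laplace
  transforms at \<open>2 * pi * \<i> * l\<close>, which are the Fourier integrals.\<close>

theorem residue_eq_fourier_coeff: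
  fixes W :: "complex \<Rightarrow> complex" and l :: int
  assumes Sp: "finite Sp" "\<Lambda> \<subseteq> Sp"
    and WD: "\<And>s. Re s > \<rho> + 1 \<Longrightarrow> W s = D s"
    and W: "W holomorphic_on {s. Re s > \<rho>'} - pole_set Sp"
    and lam: "lam \<in> \<Lambda>" "ln (cmod lam) > \<rho>' * L" and k: "k < m lam"
    and \<zeta>: "\<zeta> = Ln lam / of_real L + 2 * of_int l * of_real pi * \<i> / of_real L"
  shows "of_real L ^ k / fact k * residue (\<lambda>s. (x 0 + W s) * (s - \<zeta>) ^ k / s) \<zeta> =
    integral {0..1} (\<lambda>u. \<Phi> lam k u * exp (- (2 * of_int l * of_real pi * \<i>) * of_real u))"
proof -
  define HP where "HP = {s. Re s > \<rho>'}"
  define \<Omega> where "\<Omega> = HP - (pole_set Sp \<union> {0})"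
  have lam0: "lam \<noteq> 0" using lam nz by auto
  have Lc: "complex_of_real L \<noteq> 0" using L_pos by simp
  have oH: "open HP" unfolding HP_def by (rule open_halfspace_Re_gt)
  have o\<Omega>: "open \<Omega>" unfolding \<Omega>_def using oH pole_set_props[OF Sp(1)] by (intro open_Diff closed_Un) auto
  have c\<Omega>: "connected \<Omega>"
    unfolding \<Omega>_def
  proof (rule connected_open_diff_countable)
    show "connected HP" unfolding HP_def by (intro convex_connected convex_halfspace_Re_gt)
  qed (use oH pole_set_props[OF Sp(1)] in auto)
  \<comment> \<open>To the right of \<open>T\<close> all convergence conditions of
    \<open>dirichlet_eq_main_part\<close> hold simultaneously.\<close>
  define T where "T = Max (insert \<rho>' (insert (\<bar>\<rho>\<bar> + 1) ((\<lambda>lam. ln (cmod lam) / L) ` \<Lambda>)))"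
  have T: "T \<ge> \<rho>'" "T \<ge> \<bar>\<rho>\<bar> + 1" "\<And>lam. lam \<in> \<Lambda> \<Longrightarrow> T \<ge> ln (cmod lam) / L"
    unfolding T_def by (rule Max_ge; use fin in auto)+
  define V where "V = \<Omega> \<inter> {s. Re s > T}"
  have oV: "open V" unfolding V_def using o\<Omega> by (intro open_Int open_halfspace_Re_gt)
  have Vne: "V \<noteq> {}"
  proof -
    have sub: "ball (of_real (T + 1)) 1 \<subseteq> {s. Re s > T}"
    proof
      fix s assume "s \<in> ball (complex_of_real (T + 1)) 1"
      hence "\<bar>Re (of_real (T + 1) - s)\<bar> < 1"
        using abs_Re_le_cmod[of "of_real (T + 1) - s"] by (simp add: dist_norm)
      thus "s \<in> {s. Re s > T}" by simp
    qed
    have "uncountable (ball (complex_of_real (T + 1)) 1)" by (rule uncountable_ball) simp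
    hence unc: "uncountable {s :: complex. Re s > T}" using countable_subset[OF sub] by blast
    have "countable (pole_set Sp \<union> {0})" using pole_set_props(2)[OF Sp(1)] by simp
    hence "\<not> {s. Re s > T} \<subseteq> pole_set Sp \<union> {0}"
      using countable_subset[of "{s. Re s > T}" "pole_set Sp \<union> {0}"] unc by blast
    then obtain s where "Re s > T" "s \<notin> pole_set Sp \<union> {0}" by auto
    hence "s \<in> V" using T(1) by (auto simp: V_def \<Omega>_def HP_def)
    thus ?thesis by auto
  qed
  have eq: "(x 0 + W s) / s = main_part s + Err s" if "s \<in> \<Omega>" for s
  proof (rule analytic_continuation_open[OF oV o\<Omega> Vne c\<Omega> _ _ _ _ that])
    show "V \<subseteq> \<Omega>" by (auto simp: V_def)
    show "(\<lambda>s. (x 0 + W s) / s) holomorphic_on \<Omega>"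
      by (intro holomorphic_intros holomorphic_on_subset[OF W]) (auto simp: \<Omega>_def HP_def)
    show "(\<lambda>s. main_part s + Err s) holomorphic_on \<Omega>"
      unfolding main_part_def[abs_def]
      by (intro holomorphic_on_add holomorphic_on_subset[OF main_part_holomorphic[OF order.refl]] holomorphic_on_subset[OF Err_holomorphic])
         (use Sp(2) in \<open>auto simp: \<Omega>_def HP_def pole_set_def\<close>)
    fix s assume s: "s \<in> V"
    have ReT: "Re s > T" using s by (simp add: V_def)
    have "Re s > \<rho> + 1" using ReT T(2) by linarith
    hence "W s = D s" by (rule WD)
    moreover have "Re s * L > ln (cmod l)" if "l \<in> \<Lambda>" for l
    proof -
      have "ln (cmod l) / L < Re s" using T(3)[OF that] ReT by linarith
      thus ?thesis using L_pos by (simp add: divide_less_eq)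
    qed
    hence "(x 0 + D s) / s = main_part s + Err s"
      using ReT T(1,2) by (intro dirichlet_eq_main_part) auto
    ultimately show "(x 0 + W s) / s = main_part s + Err s" by simp
  qed
  have \<zeta>L: "\<zeta> * of_real L = Ln lam + 2 * of_int l * of_real pi * \<i>" using Lc by (simp add: \<zeta> distrib_right)
  have e\<zeta>: "exp (\<zeta> * of_real L) = lam"
  proof -
    have "exp (\<zeta> * of_real L) = exp (Ln lam) * exp (of_int (2 * l) * of_real pi * \<i>)"
      unfolding \<zeta>L exp_add by simp
    also have "exp (of_int (2 * l) * of_real pi * \<i>) = 1" unfolding exp_eq_1 by auto
    finally show ?thesis using lam0 by simp
  qed
  have Re\<zeta>: "Re \<zeta> > \<rho>'"
  proof -
    have "Re \<zeta> * L = Re (\<zeta> * of_real L)" by simp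
    also have "\<dots> = ln (cmod lam)" unfolding \<zeta>L using lam0 by simp
    finally show ?thesis using lam(2) L_pos by (metis mult_less_cancel_right_pos)
  qed
  \<comment> \<open>A neighbourhood without poles from other eigenvalues and without the point 0,
    unless \<open>\<zeta>\<close> is 0 itself. The radius is the distance between neighbouring
    solutions of \<open>exp (s * L) = lam\<close>, so the open ball contains \<open>\<zeta>\<close>
    as the only one.\<close>
  define B where "B = HP \<inter> - pole_set (Sp - {lam}) \<inter> ball \<zeta> (2 * pi / L) \<inter> - ({0} - {\<zeta>})"
  have "open B" unfolding B_def
    using oH pole_set_props(1)[of "Sp - {lam}"] Sp(1) by (intro open_Int open_Compl) (auto simp: finite_imp_closed)
  moreover have "\<zeta> \<in> B" using Re\<zeta> e\<zeta> L_pos by (auto simp: B_def HP_def pole_set_def)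
  ultimately obtain r where r: "r > 0" "ball \<zeta> r \<subseteq> B" using open_contains_ball by blast
  have z1: "exp (- (s * of_real L - Ln lam)) \<noteq> 1" if s: "s \<in> ball \<zeta> r - {\<zeta>}" for s
  proof
    assume "exp (- (s * of_real L - Ln lam)) = 1"
    hence "exp (s * of_real L) = exp (\<zeta> * of_real L)" using lam0 e\<zeta> by (simp add: exp_diff)
    then obtain n :: int where n: "s * of_real L = \<zeta> * of_real L + (of_int (2 * n) * pi) * \<i>" unfolding exp_eq by blast
    have "dist \<zeta> s < 2 * pi / L" using s r(2) by (auto simp: B_def)
    hence "cmod (s - \<zeta>) * L < 2 * pi" using L_pos by (simp add: dist_norm norm_minus_commute field_simps)
    moreover have "(s - \<zeta>) * of_real L = of_int (2 * n) * pi * \<i>" using n by (simp add: left_diff_distrib)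
    hence "cmod ((s - \<zeta>) * of_real L) = cmod (of_int (2 * n) * pi * \<i>)" by simp
    hence "cmod (s - \<zeta>) * L = \<bar>real_of_int (2 * n)\<bar> * pi"
      by (simp only: norm_mult norm_of_real norm_of_int norm_ii mult_1_right abs_mult
          abs_of_pos[OF L_pos] abs_of_pos[OF pi_gt_zero])
    ultimately have "2 * pi * \<bar>of_int n\<bar> < 2 * pi * 1" by (simp add: abs_mult)
    hence "\<bar>of_int n :: real\<bar> < 1" using pi_gt_zero by (simp only: mult_less_cancel_left_pos)
    hence "n = 0" by linarith
    hence "s = \<zeta>" using n Lc by simp
    thus False using s by simp
  qed
  have B\<Omega>: "s \<in> \<Omega>" if s: "s \<in> ball \<zeta> r - {\<zeta>}" for s
  proof -
    have sB: "s \<in> B" using s r by auto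
    have "exp (s * of_real L) \<noteq> lam"
      using z1[OF s] lam0 by (auto simp: exp_diff)
    thus ?thesis using sB s by (auto simp: \<Omega>_def B_def pole_set_def)
  qed
  define z0 where "z0 = 2 * of_int l * of_real pi * \<i>"
  have z0: "\<zeta> * of_real L - Ln lam = z0" unfolding \<zeta>L z0_def by simp
  have ez0: "exp (- z0) = 1"
    using e\<zeta> lam0 unfolding z0[symmetric] by (simp add: exp_diff)
  have in_ball: "(s * of_real L - Ln lam) \<in> ball z0 (r * L) \<longleftrightarrow> s \<in> ball \<zeta> r" for s
  proof -
    have "z0 - (s * of_real L - Ln lam) = (\<zeta> - s) * of_real L" unfolding z0[symmetric] by (simp add: algebra_simps)
    hence "dist z0 (s * of_real L - Ln lam) = dist \<zeta> s * L" using L_pos by (simp add: dist_norm norm_mult)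
    thus ?thesis using L_pos by simp
  qed
  have sub: "s * of_real L - Ln lam - z0 = (s - \<zeta>) * of_real L" for s
    unfolding z0[symmetric] by (simp add: algebra_simps)
  have ne0: "exp (- z) \<noteq> 1" if z: "z \<in> ball z0 (r * L) - {z0}" for z
  proof -
    define s where "s = (z + Ln lam) / of_real L"
    have zs: "z = s * of_real L - Ln lam" using Lc by (simp add: s_def)
    have "s \<in> ball \<zeta> r" using z in_ball[of s] unfolding zs by simp
    moreover have "s \<noteq> \<zeta>" using z zs z0 by auto
    ultimately show ?thesis using z1[of s] unfolding zs by auto
  qed
  have "\<exists>g. g holomorphic_on ball z0 (r * L) \<and> (\<forall>z\<in>ball z0 (r * L) - {z0}.
      (deriv ^^ j) (laplace_cont (\<Phi> lam j)) z = (-1) ^ j * fact j * period_laplace (\<Phi> lam j) z0 / (z - z0) ^ Suc j + g z)"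
    if j: "j < m lam" for j
  proof -
    have "r * L > 0" using r L_pos by simp
    from laplace_cont_higher_deriv_pole[OF per[OF lam(1) j] cont[OF lam(1) j] ez0 this ne0]
    obtain g where "\<And>k. g k holomorphic_on ball z0 (r * L)" "\<And>k z. z \<in> ball z0 (r * L) - {z0} \<Longrightarrow>
      (deriv ^^ k) (laplace_cont (\<Phi> lam j)) z = (-1) ^ k * fact k * period_laplace (\<Phi> lam j) z0 / (z - z0) ^ Suc k + g k z"
      by metis
    thus ?thesis by blast
  qed
  then obtain g where g: "\<And>j. j < m lam \<Longrightarrow> g j holomorphic_on ball z0 (r * L)"
    "\<And>j z. j < m lam \<Longrightarrow> z \<in> ball z0 (r * L) - {z0} \<Longrightarrow>
      (deriv ^^ j) (laplace_cont (\<Phi> lam j)) z = (-1) ^ j * fact j * period_laplace (\<Phi> lam j) z0 / (z - z0) ^ Suc j + g j z"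
    by metis
  define rest where "rest s = (\<Sum>w\<in>\<Lambda> - {lam}. \<Sum>j<m w. of_real L * ((-1) ^ j * (deriv ^^ j) (laplace_cont (\<Phi> w j)) (s * of_real L - Ln w)))" for s
  define A where "A s = (\<Sum>j<m lam. of_real L * ((-1) ^ j * g j (s * of_real L - Ln lam))) + rest s + Err s" for s
  \<comment> \<open>The \<open>j\<close>-th derivative brings \<open>fact j\<close> and
    \<open>Suc j\<close> factors \<open>L\<close> in the denominator, one of which cancels against
    the \<open>L\<close> of the substitution; the signs cancel. The prefactor in the claim undoes
    precisely this scaling.\<close>
  define cc where "cc j = fact j * period_laplace (\<Phi> lam j) z0 / of_real L ^ j" for j
  have affine: "(\<lambda>s. g j (s * of_real L - Ln lam)) holomorphic_on ball \<zeta> r" if "j < m lam" for j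
  proof -
    have "g j \<circ> (\<lambda>s. s * of_real L - Ln lam) holomorphic_on ball \<zeta> r"
      by (rule holomorphic_on_compose_gen[OF _ g(1)[OF that]]) (use in_ball in \<open>auto intro!: holomorphic_intros\<close>)
    thus ?thesis by (simp add: o_def)
  qed
  have rest: "rest holomorphic_on ball \<zeta> r"
    unfolding rest_def[abs_def]
    by (rule holomorphic_on_subset[OF main_part_holomorphic]) (use r(2) Sp(2) in \<open>auto simp: B_def pole_set_def\<close>)
  have A: "A holomorphic_on ball \<zeta> r"
    unfolding A_def[abs_def]
    by (intro holomorphic_on_add holomorphic_on_sum holomorphic_on_mult holomorphic_on_const affine rest
          holomorphic_on_subset[OF Err_holomorphic]) (use r(2) in \<open>auto simp: B_def HP_def\<close>)
  have expand: "(x 0 + W s) / s = (\<Sum>j<m lam. cc j / (s - \<zeta>) ^ Suc j) + A s" if s: "s \<in> ball \<zeta> r - {\<zeta>}" for s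
  proof -
    define z where "z = s * of_real L - Ln lam"
    have z: "z \<in> ball z0 (r * L) - {z0}" "z - z0 = (s - \<zeta>) * of_real L"
      using in_ball[of s] sub[of s] s Lc by (auto simp: z_def)
    have t: "of_real L * ((-1) ^ j * (deriv ^^ j) (laplace_cont (\<Phi> lam j)) z) =
        cc j / (s - \<zeta>) ^ Suc j + of_real L * ((-1) ^ j * g j z)" if j: "j < m lam" for j
    proof -
      have sgn: "(-1) ^ j * (-1) ^ j = (1 :: complex)" by (simp flip: power_mult_distrib)
      have "of_real L * ((-1) ^ j * (deriv ^^ j) (laplace_cont (\<Phi> lam j)) z) =
          of_real L * (((-1) ^ j * (-1) ^ j) * (fact j * period_laplace (\<Phi> lam j) z0) / ((s - \<zeta>) * of_real L) ^ Suc j + (-1) ^ j * g j z)"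
        unfolding g(2)[OF j z(1)] z(2) by (simp add: distrib_left mult.assoc)
      also have "\<dots> = of_real L * ((fact j * period_laplace (\<Phi> lam j) z0) / ((s - \<zeta>) * of_real L) ^ Suc j) + of_real L * ((-1) ^ j * g j z)"
        unfolding sgn by (simp add: distrib_left)
      also have "of_real L * ((fact j * period_laplace (\<Phi> lam j) z0) / ((s - \<zeta>) * of_real L) ^ Suc j) = cc j / (s - \<zeta>) ^ Suc j"
        using Lc by (simp add: cc_def power_mult_distrib)
      finally show ?thesis .
    qed
    have "(x 0 + W s) / s = main_part s + Err s" by (rule eq[OF B\<Omega>[OF s]])
    also have "main_part s = (\<Sum>j<m lam. of_real L * ((-1) ^ j * (deriv ^^ j) (laplace_cont (\<Phi> lam j)) z)) + rest s"
      unfolding main_part_def rest_def z_def by (rule sum.remove[OF fin lam(1)])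
    also have "(\<Sum>j<m lam. of_real L * ((-1) ^ j * (deriv ^^ j) (laplace_cont (\<Phi> lam j)) z)) =
        (\<Sum>j<m lam. cc j / (s - \<zeta>) ^ Suc j) + (\<Sum>j<m lam. of_real L * ((-1) ^ j * g j z))"
      unfolding sum.distrib[symmetric] by (intro sum.cong refl t) auto
    finally show ?thesis by (simp add: A_def z_def)
  qed
  have "residue (\<lambda>s. (x 0 + W s) / s * (s - \<zeta>) ^ k) \<zeta> = cc k"
    by (rule residue_principal_part[OF r(1) A expand k])
  hence "residue (\<lambda>s. (x 0 + W s) * (s - \<zeta>) ^ k / s) \<zeta> = cc k" by simp
  moreover have "of_real L ^ k / fact k * cc k = period_laplace (\<Phi> lam k) z0" using Lc by (simp add: cc_def)
  ultimately show ?thesis by (simp add: period_laplace_def z0_def mult.commute)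
qed

end

subsection \<open>Norms of matrix products\<close>

lemma vec_norm_sum_unit:
  assumes nv: "is_vec_norm d nv" and x: "x \<in> carrier_vec d"
  shows "nv x \<le> (\<Sum>i<d. cmod (x $ i) * nv (unit_vec d i))"
proof -
  have tri: "\<And>x y. x \<in> carrier_vec d \<Longrightarrow> y \<in> carrier_vec d \<Longrightarrow> nv (x + y) \<le> nv x + nv y"
    and smult: "\<And>c x. x \<in> carrier_vec d \<Longrightarrow> nv (c \<cdot>\<^sub>v x) = cmod c * nv x"
    and zero: "nv (0\<^sub>v d) = 0"
    using nv unfolding is_vec_norm_def by auto
  define p where "p k = vec d (\<lambda>i. if i < k then x $ i else 0)" for k
  have pc: "p k \<in> carrier_vec d" for k by (simp add: p_def)
  have "nv (p k) \<le> (\<Sum>i<k. cmod (x $ i) * nv (unit_vec d i))" if "k \<le> d" for k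
    using that
  proof (induction k)
    case 0
    have "p 0 = 0\<^sub>v d" by (auto simp: p_def)
    thus ?case using zero by simp
  next
    case (Suc k)
    have e: "p (Suc k) = p k + x $ k \<cdot>\<^sub>v unit_vec d k"
      using Suc.prems by (auto simp: p_def unit_vec_def less_Suc_eq intro!: eq_vecI)
    have "nv (p (Suc k)) \<le> nv (p k) + nv (x $ k \<cdot>\<^sub>v unit_vec d k)"
      unfolding e by (rule tri) (auto simp: pc)
    thus ?case using Suc smult[of "unit_vec d k" "x $ k"] by simp
  qed
  moreover have "p d = x" using x by (auto simp: p_def)
  ultimately show ?thesis by (metis order.refl)
qed

lemma bounded_coordinates_convergent_subseq:
  fixes f :: "nat \<Rightarrow> nat \<Rightarrow> complex"
  assumes "\<And>n i. i < d \<Longrightarrow> cmod (f n i) \<le> B"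
  shows "\<exists>r l. strict_mono r \<and> (\<forall>i<d. (\<lambda>n. f (r n) i) \<longlonglongrightarrow> l i)"
  using assms
proof (induction d)
  case 0
  show ?case by (intro exI[of _ id]) (auto simp: strict_mono_def)
next
  case (Suc d)
  then obtain r l where r: "strict_mono r" "\<forall>i<d. (\<lambda>n. f (r n) i) \<longlonglongrightarrow> l i" by (meson less_SucI)
  have "\<forall>n. f (r n) d \<in> cball 0 B" using Suc.prems by auto
  then obtain L s where s: "strict_mono s" "((\<lambda>n. f (r n) d) \<circ> s) \<longlonglongrightarrow> L"
    using compact_cball[of 0 B] unfolding compact_def by metis
  have "(\<lambda>n. f ((r \<circ> s) n) i) \<longlonglongrightarrow> (if i = d then L else l i)" if "i < Suc d" for i
  proof (cases "i = d")
    case True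
    thus ?thesis using s(2) by (simp add: o_def)
  next
    case False
    hence "(\<lambda>n. f (r n) i) \<longlonglongrightarrow> l i" using that r by auto
    thus ?thesis using LIMSEQ_subseq_LIMSEQ[OF _ s(1)] False by (fastforce simp: o_def)
  qed
  thus ?case using strict_mono_o[OF r(1) s(1)] unfolding o_def
    by (intro exI[of _ "\<lambda>n. r (s n)"] exI[of _ "\<lambda>i. if i = d then L else l i"] conjI) auto
qed

text \<open>One half of the equivalence of norms. Otherwise there would be vectors whose norm is
  negligible compared with their largest entry; normalised by that entry they have a convergent
  subsequence, whose limit has norm 0 and hence is 0, although some entry always has modulus
  1.\<close>

lemma vec_norm_dominates_entries:
  assumes nv: "is_vec_norm d nv"
  obtains c where "c > 0" "\<And>x i. x \<in> carrier_vec d \<Longrightarrow> i < d \<Longrightarrow> cmod (x $ i) \<le> c * nv x"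
proof (rule ccontr)
  assume neg: "\<not> thesis"
  have tri: "\<And>x y. x \<in> carrier_vec d \<Longrightarrow> y \<in> carrier_vec d \<Longrightarrow> nv (x + y) \<le> nv x + nv y"
    and smult: "\<And>c x. x \<in> carrier_vec d \<Longrightarrow> nv (c \<cdot>\<^sub>v x) = cmod c * nv x"
    and pos: "\<And>x. x \<in> carrier_vec d \<Longrightarrow> nv x \<ge> 0" "\<And>x. x \<in> carrier_vec d \<Longrightarrow> nv x = 0 \<longleftrightarrow> x = 0\<^sub>v d"
    using nv unfolding is_vec_norm_def by auto
  have "\<exists>x i. x \<in> carrier_vec d \<and> i < d \<and> cmod (x $ i) > real (Suc n) * nv x" for n
    using neg that[of "real (Suc n)"] by (metis not_le of_nat_0_less_iff zero_less_Suc)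
  then obtain x i where xi: "\<And>n. x n \<in> carrier_vec d" "\<And>n. i n < d" "\<And>n. cmod (x n $ i n) > real (Suc n) * nv (x n)"
    by metis
  define m where "m n = Max ((\<lambda>j. cmod (x n $ j)) ` {..<d})" for n
  have mi: "cmod (x n $ j) \<le> m n" if "j < d" for n j
    unfolding m_def using that by (intro Max_ge) auto
  have m_pos: "m n > 0" for n
  proof -
    have "0 \<le> real (Suc n) * nv (x n)" using pos(1)[OF xi(1)] by simp
    also have "\<dots> < cmod (x n $ i n)" by (rule xi)
    also have "\<dots> \<le> m n" by (rule mi[OF xi(2)])
    finally show ?thesis .
  qed
  define z where "z n = of_real (1 / m n) \<cdot>\<^sub>v x n" for n
  have zc: "z n \<in> carrier_vec d" for n using xi(1) by (simp add: z_def)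
  have ze: "z n $ j = x n $ j / of_real (m n)" if "j < d" for n j
    using that xi(1)[of n] by (simp add: z_def)
  have z1: "cmod (z n $ j) \<le> 1" if "j < d" for n j
    using mi[OF that, of n] m_pos[of n] by (simp add: ze[OF that] norm_divide)
  have zmax: "\<exists>j<d. cmod (z n $ j) = 1" for n
  proof -
    have "m n \<in> (\<lambda>j. cmod (x n $ j)) ` {..<d}" unfolding m_def using xi(2)[of n] by (intro Max_in) auto
    then obtain j where "j < d" "cmod (x n $ j) = m n" by auto
    thus ?thesis using m_pos[of n] by (intro exI[of _ j]) (auto simp: ze norm_divide)
  qed
  have nz: "nv (z n) \<le> 1 / real (Suc n)" for n
  proof -
    have "nv (z n) = nv (x n) / m n" using smult[OF xi(1)] m_pos[of n] by (simp add: z_def norm_divide)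
    also have "real (Suc n) * nv (x n) \<le> m n" using xi(3)[of n] mi[OF xi(2)[of n], of n] by linarith
    hence "nv (x n) / m n \<le> 1 / real (Suc n)" using m_pos[of n] by (simp add: field_simps)
    finally show ?thesis .
  qed
  obtain r l where r: "strict_mono r" "\<And>j. j < d \<Longrightarrow> (\<lambda>n. z (r n) $ j) \<longlonglongrightarrow> l j"
    using bounded_coordinates_convergent_subseq[of d "\<lambda>n j. z n $ j" 1] z1 by blast
  define y where "y = vec d l"
  have yc: "y \<in> carrier_vec d" by (simp add: y_def)
  have lim: "(\<lambda>n. (\<Sum>j<d. cmod (l j - z (r n) $ j) * nv (unit_vec d j)) + 1 / real (Suc n)) \<longlonglongrightarrow> (\<Sum>j<d. cmod (l j - l j) * nv (unit_vec d j)) + 0"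
    using r(2) by (intro tendsto_intros LIMSEQ_Suc[OF lim_1_over_n]) auto
  have "nv y \<le> (\<Sum>j<d. cmod (l j - z (r n) $ j) * nv (unit_vec d j)) + 1 / real (Suc n)" for n
  proof -
    have "y = (y - z (r n)) + z (r n)" using yc zc[of "r n"] by auto
    hence "nv y \<le> nv (y - z (r n)) + nv (z (r n))" using tri[of "y - z (r n)" "z (r n)"] yc zc by (metis minus_carrier_vec)
    also have "nv (y - z (r n)) \<le> (\<Sum>j<d. cmod ((y - z (r n)) $ j) * nv (unit_vec d j))"
      using yc zc by (intro vec_norm_sum_unit[OF nv]) auto
    also have "\<dots> = (\<Sum>j<d. cmod (l j - z (r n) $ j) * nv (unit_vec d j))"
      using zc[of "r n"] by (intro sum.cong) (auto simp: y_def)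
    also have "nv (z (r n)) \<le> 1 / real (Suc n)"
    proof -
      have "real (Suc n) \<le> real (Suc (r n))" using seq_suble[OF r(1), of n] by simp
      hence "1 / real (Suc (r n)) \<le> 1 / real (Suc n)" by (intro divide_left_mono) auto
      thus ?thesis using nz[of "r n"] by linarith
    qed
    finally show ?thesis by simp
  qed
  hence "nv y \<le> (\<Sum>j<d. cmod (l j - l j) * nv (unit_vec d j)) + 0"
    using lim by (intro LIMSEQ_le_const[OF lim]) auto
  hence "nv y = 0" using pos(1)[OF yc] by simp
  hence "y = 0\<^sub>v d" using pos(2)[OF yc] by simp
  hence l0: "l j = 0" if "j < d" for j using that index_zero_vec(1)[OF that] by (metis index_vec y_def)
  have "(\<lambda>n. \<Sum>j<d. cmod (z (r n) $ j)) \<longlonglongrightarrow> (\<Sum>j<d. cmod (l j))"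
    by (intro tendsto_intros r(2)) auto
  hence "(\<lambda>n. \<Sum>j<d. cmod (z (r n) $ j)) \<longlonglongrightarrow> 0" using l0 by simp
  moreover have "1 \<le> (\<Sum>j<d. cmod (z (r n) $ j))" for n
  proof -
    obtain j where "j < d" "cmod (z (r n) $ j) = 1" using zmax by blast
    thus ?thesis using member_le_sum[of j "{..<d}" "\<lambda>j. cmod (z (r n) $ j)"] by simp
  qed
  ultimately have "(1::real) \<le> 0" by (intro LIMSEQ_le_const) auto
  thus False by simp
qed

text \<open>An entry is a coordinate of the image of a unit vector. After scaling the unit vector to
  norm 1, this image is one of the competitors in the supremum.\<close>

lemma entry_le_induced_norm:
  assumes nv: "is_vec_norm d nv"
  obtains c where "c > 0" "\<And>(M :: complex mat) i j. M \<in> carrier_mat d d \<Longrightarrow> i < d \<Longrightarrow> j < d \<Longrightarrow>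
     cmod (M $$ (i, j)) \<le> c * induced_mat_norm d nv M"
proof -
  have smult: "\<And>c x. x \<in> carrier_vec d \<Longrightarrow> nv (c \<cdot>\<^sub>v x) = cmod c * nv x"
    and pos: "\<And>x. x \<in> carrier_vec d \<Longrightarrow> nv x \<ge> 0" "\<And>x. x \<in> carrier_vec d \<Longrightarrow> nv x = 0 \<longleftrightarrow> x = 0\<^sub>v d"
    using nv unfolding is_vec_norm_def by auto
  obtain c where c: "c > 0" "\<And>x i. x \<in> carrier_vec d \<Longrightarrow> i < d \<Longrightarrow> cmod (x $ i) \<le> c * nv x"
    using vec_norm_dominates_entries[OF nv] by blast
  define u where "u = (\<Sum>j<d. nv (unit_vec d j))"
  have u: "nv (unit_vec d j) \<le> u" if "j < d" for j
    unfolding u_def using that pos(1) by (intro member_le_sum) auto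
  have u0: "u \<ge> 0" unfolding u_def using pos(1) by (intro sum_nonneg) auto
  show ?thesis
  proof (rule that[of "c * (u + 1)"])
    show "c * (u + 1) > 0" using c u0 by simp
    fix M :: "complex mat" and i j assume M: "M \<in> carrier_mat d d" "i < d" "j < d"
    define S where "S = {nv (M *\<^sub>v x) | x. x \<in> carrier_vec d \<and> nv x = 1}"
    have Mx: "M *\<^sub>v x \<in> carrier_vec d" if "x \<in> carrier_vec d" for x using M that by auto
    \<comment> \<open>A real \<open>Sup\<close> dominates the members of the set only if the set is
      bounded above; the bound on entries by the norm supplies this.\<close>
    have bdd: "bdd_above S"
    proof (rule bdd_aboveI)
      fix s assume "s \<in> S"
      then obtain x where x: "x \<in> carrier_vec d" "nv x = 1" "s = nv (M *\<^sub>v x)" by (auto simp: S_def)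
      have "s \<le> (\<Sum>i<d. cmod ((M *\<^sub>v x) $ i) * nv (unit_vec d i))"
        unfolding x(3) by (rule vec_norm_sum_unit[OF nv Mx[OF x(1)]])
      also have "\<dots> \<le> (\<Sum>i<d. (\<Sum>j<d. cmod (M $$ (i, j)) * c) * nv (unit_vec d i))"
      proof (intro sum_mono mult_right_mono pos)
        fix i assume "i \<in> {..<d}"
        hence "(M *\<^sub>v x) $ i = (\<Sum>j<d. M $$ (i, j) * x $ j)"
          using M x(1) by (auto simp: scalar_prod_def atLeast0LessThan)
        also have "cmod \<dots> \<le> (\<Sum>j<d. cmod (M $$ (i, j)) * c)"
          using c(2)[OF x(1)] x(2) by (intro sum_norm_le) (auto simp: norm_mult intro!: mult_left_mono)
        finally show "cmod ((M *\<^sub>v x) $ i) \<le> (\<Sum>j<d. cmod (M $$ (i, j)) * c)" .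
      qed auto
      finally show "s \<le> (\<Sum>i<d. (\<Sum>j<d. cmod (M $$ (i, j)) * c) * nv (unit_vec d i))" .
    qed
    define e where "e = (unit_vec d j :: complex vec)"
    have e: "e \<in> carrier_vec d" "nv e > 0"
    proof -
      show ec: "e \<in> carrier_vec d" by (simp add: e_def)
      have "e $ j \<noteq> 0\<^sub>v d $ j" using M by (simp add: e_def)
      hence "e \<noteq> 0\<^sub>v d" by metis
      thus "nv e > 0" using pos(1)[OF ec] pos(2)[OF ec] by linarith
    qed
    define e' where "e' = of_real (1 / nv e) \<cdot>\<^sub>v e"
    have e': "e' \<in> carrier_vec d" "nv e' = 1" using e smult[OF e(1)] by (auto simp: e'_def norm_divide)
    have "nv (M *\<^sub>v e') \<in> S" using e' by (auto simp: S_def)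
    hence le: "nv (M *\<^sub>v e') \<le> induced_mat_norm d nv M"
      unfolding induced_mat_norm_def S_def[symmetric] by (rule cSup_upper[OF _ bdd])
    have "M *\<^sub>v e' = of_real (1 / nv e) \<cdot>\<^sub>v (M *\<^sub>v e)"
      unfolding e'_def by (rule mult_mat_vec[OF M(1) e(1)])
    hence "nv (M *\<^sub>v e') = nv (M *\<^sub>v e) / nv e" using smult[OF Mx[OF e(1)]] e(2) by (simp add: norm_divide)
    hence "nv (M *\<^sub>v e) = nv e * nv (M *\<^sub>v e')" using e(2) by simp
    also have "\<dots> \<le> (u + 1) * induced_mat_norm d nv M"
      using le u[OF M(3)] pos(1)[OF Mx[OF e'(1)]] u0 by (intro mult_mono) (auto simp: e_def)
    finally have "c * nv (M *\<^sub>v e) \<le> c * ((u + 1) * induced_mat_norm d nv M)" using c by simp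
    moreover have "(M *\<^sub>v e) $ i = M $$ (i, j)"
      using M by (auto simp: e_def)
    moreover have "cmod ((M *\<^sub>v e) $ i) \<le> c * nv (M *\<^sub>v e)" by (rule c(2)[OF Mx[OF e(1)] M(2)])
    ultimately show "cmod (M $$ (i, j)) \<le> c * (u + 1) * induced_mat_norm d nv M" by (simp add: mult.assoc)
  qed
qed

subsection \<open>Regular sequences in a Jordan basis\<close>

lemma jordan_matrix_chain:
  fixes n_as :: "(nat \<times> complex) list"
  shows "\<exists>(ev :: nat \<Rightarrow> complex) b. \<forall>i<sum_list (map fst n_as).
    1 \<le> b i \<and> i + b i \<le> sum_list (map fst n_as) \<and> (\<forall>p<b i. ev (i + p) = ev i \<and> b (i + p) = b i - p) \<and>
    (\<exists>N. (N, ev i) \<in> set n_as \<and> b i \<le> N) \<and>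
    (\<forall>j<sum_list (map fst n_as). jordan_matrix n_as $$ (i, j) =
       (if j = i then ev i else if j = Suc i \<and> 1 < b i then 1 else 0))"
proof (induction n_as)
  case Nil
  show ?case by auto
next
  case (Cons na n_as)
  obtain n a where na: "na = (n, a)" by force
  define s where "s = sum_list (map fst n_as)"
  obtain ev b where IH: "\<And>i. i < s \<Longrightarrow> 1 \<le> b i \<and> i + b i \<le> s \<and> (\<forall>p<b i. ev (i + p) = ev i \<and> b (i + p) = b i - p) \<and>
    (\<exists>N. (N, ev i) \<in> set n_as \<and> b i \<le> N) \<and>
    (\<forall>j<s. jordan_matrix n_as $$ (i, j) = (if j = i then ev i else if j = Suc i \<and> 1 < b i then (1 :: complex) else 0))"
    using Cons.IH unfolding s_def by blast
  define ev' where "ev' i = (if i < n then a else ev (i - n))" for i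
  define b' where "b' i = (if i < n then n - i else b (i - n))" for i
  have J: "jordan_matrix (na # n_as) $$ (i, j) = (if i < n then if j < n then jordan_block n a $$ (i, j) else 0
      else if j < n then 0 else jordan_matrix n_as $$ (i - n, j - n))" if "i < n + s" "j < n + s" for i j
    unfolding na jordan_matrix_Cons using that by (subst index_mat_four_block) (auto simp: s_def)
  have "1 \<le> b' i \<and> i + b' i \<le> n + s \<and> (\<forall>p<b' i. ev' (i + p) = ev' i \<and> b' (i + p) = b' i - p) \<and>
    (\<exists>N. (N, ev' i) \<in> set (na # n_as) \<and> b' i \<le> N) \<and>
    (\<forall>j<n + s. jordan_matrix (na # n_as) $$ (i, j) = (if j = i then ev' i else if j = Suc i \<and> 1 < b' i then 1 else 0))"
    if i: "i < n + s" for i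
  proof (cases "i < n")
    case True
    have "jordan_matrix (na # n_as) $$ (i, j) = (if j = i then ev' i else if j = Suc i \<and> 1 < b' i then 1 else 0)"
      if "j < n + s" for j
      using True that i by (subst J) (auto simp: ev'_def b'_def)
    thus ?thesis using True by (auto simp: ev'_def b'_def na)
  next
    case False
    define i' where "i' = i - n"
    have i': "i = n + i'" "i' < s" using False i by (auto simp: i'_def)
    note I = IH[OF i'(2)]
    have "jordan_matrix (na # n_as) $$ (i, j) = (if j = i then ev' i else if j = Suc i \<and> 1 < b' i then 1 else 0)"
      if j: "j < n + s" for j
    proof (cases "j < n")
      case True
      thus ?thesis using i' j i by (subst J) auto
    next
      case F: False
      define j' where "j' = j - n"
      have j': "j = n + j'" "j' < s" using F j by (auto simp: j'_def)
      have "jordan_matrix (na # n_as) $$ (i, j) = jordan_matrix n_as $$ (i', j')"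
        using i j by (subst J) (auto simp: i' j')
      also have "\<dots> = (if j' = i' then ev i' else if j' = Suc i' \<and> 1 < b i' then 1 else 0)" using I j'(2) by blast
      finally show ?thesis by (simp add: i' j' ev'_def b'_def)
    qed
    thus ?thesis using I by (auto simp: i'(1) ev'_def b'_def add.assoc)
  qed
  thus ?case unfolding s_def na by (intro exI[of _ ev'] exI[of _ b']) auto
qed

lemma mat_word_prod_carrier:
  assumes "\<And>r. r < q \<Longrightarrow> A r \<in> carrier_mat d d"
  shows "set rs \<subseteq> {..<q} \<Longrightarrow> mat_word_prod d A rs \<in> carrier_mat d d"
proof (induction rs)
  case (Cons r rs)
  hence "A r \<in> carrier_mat d d" "foldr (\<lambda>r M. A r * M) rs (1\<^sub>m d) \<in> carrier_mat d d"
    using assms by (auto simp: mat_word_prod_def)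
  thus ?case by (auto simp: mat_word_prod_def)
qed (auto simp: mat_word_prod_def)

text \<open>Growth is stated for matrix entries, so the vector norm no longer occurs. Finite
  dimension makes this a consequence of the bound for the induced norm.\<close>

locale regular_sequence =
  fixes q d :: nat and A :: "nat \<Rightarrow> complex mat" and v :: "nat \<Rightarrow> complex vec" and R :: real and C :: "complex mat"
  assumes q: "q \<ge> 2" and d: "d \<ge> 1"
    and A: "\<And>r. r < q \<Longrightarrow> A r \<in> carrier_mat d d"
    and vdim: "\<And>n. v n \<in> carrier_vec d"
    and vrec: "\<And>r n. r < q \<Longrightarrow> v (q * n + r) = A r *\<^sub>v v n"
    and Rpos: "R > 0"
    and growth: "\<exists>K. \<forall>rs i j. set rs \<subseteq> {..<q} \<longrightarrow> i < d \<longrightarrow> j < d \<longrightarrow>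
        cmod (mat_word_prod d A rs $$ (i, j)) \<le> K * R ^ length rs"
    and C_def: "C = mat d d (\<lambda>(i, j). \<Sum>r<q. A r $$ (i, j))"
begin

abbreviation "\<rho> \<equiv> ln R / ln (real q)"

lemma C_carrier: "C \<in> carrier_mat d d" by (simp add: C_def)

lemma C_entry: "i < d \<Longrightarrow> j < d \<Longrightarrow> C $$ (i, j) = (\<Sum>r<q. A r $$ (i, j))" by (simp add: C_def)

lemma v_entry:
  assumes "r < q" "i < d"
  shows "v (q * n + r) $ i = (\<Sum>j<d. A r $$ (i, j) * v n $ j)"
proof -
  have "v (q * n + r) $ i = (A r *\<^sub>v v n) $ i" using vrec[OF assms(1)] by simp
  also have "\<dots> = (\<Sum>j<d. A r $$ (i, j) * v n $ j)"
    using A[OF assms(1)] vdim[of n] assms(2) by (auto simp: scalar_prod_def atLeast0LessThan)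
  finally show ?thesis .
qed

lemma word_carrier: "set rs \<subseteq> {..<q} \<Longrightarrow> mat_word_prod d A rs \<in> carrier_mat d d"
  by (rule mat_word_prod_carrier[of q]) (auto intro: A)

lemma word_Cons_vec:
  assumes "set rs \<subseteq> {..<q}" "r < q" "w \<in> carrier_vec d"
  shows "mat_word_prod d A (r # rs) *\<^sub>v w = A r *\<^sub>v (mat_word_prod d A rs *\<^sub>v w)"
  using assoc_mult_mat_vec[OF A[OF assms(2)] word_carrier[OF assms(1)] assms(3)]
  by (simp add: mat_word_prod_def)

text \<open>The word consists of the base-\<open>q\<close> digits of \<open>n\<close>, least
  significant first. Padding with leading zeros to length \<open>l\<close> is harmless because the
  recursion at 0 gives \<open>v 0 = A 0 v 0\<close>.\<close>

lemma v_eq_word: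
  "n < q ^ l \<Longrightarrow> \<exists>rs. set rs \<subseteq> {..<q} \<and> length rs = l \<and> v n = mat_word_prod d A rs *\<^sub>v v 0"
proof (induction l arbitrary: n)
  case 0
  thus ?case using vdim[of 0] by (intro exI[of _ "[]"]) (auto simp: mat_word_prod_def)
next
  case (Suc l)
  have "n div q < q ^ l" using Suc.prems q by (simp add: div_less_iff_less_mult mult.commute)
  then obtain rs where rs: "set rs \<subseteq> {..<q}" "length rs = l" "v (n div q) = mat_word_prod d A rs *\<^sub>v v 0"
    using Suc.IH by blast
  have r: "n mod q < q" using q by simp
  have "v n = A (n mod q) *\<^sub>v v (n div q)" using vrec[OF r, of "n div q"] by simp
  hence "v n = mat_word_prod d A ((n mod q) # rs) *\<^sub>v v 0"
    using word_Cons_vec[OF rs(1) r vdim[of 0]] rs(3) by simp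
  thus ?case using rs r by (intro exI[of _ "(n mod q) # rs"]) auto
qed

lemma word_vec_bound:
  assumes w: "w \<in> carrier_vec d"
  obtains B where "B \<ge> 0" "\<And>rs i. set rs \<subseteq> {..<q} \<Longrightarrow> i < d \<Longrightarrow> cmod ((mat_word_prod d A rs *\<^sub>v w) $ i) \<le> B * R ^ length rs"
proof -
  obtain K where K: "\<And>rs i j. set rs \<subseteq> {..<q} \<Longrightarrow> i < d \<Longrightarrow> j < d \<Longrightarrow>
      cmod (mat_word_prod d A rs $$ (i, j)) \<le> K * R ^ length rs" using growth by blast
  have K0: "K \<ge> 0" using order.trans[OF norm_ge_zero K[of "[]" 0 0]] d by simp
  show ?thesis
  proof (rule that[of "K * (\<Sum>j<d. cmod (w $ j))"])
    show "K * (\<Sum>j<d. cmod (w $ j)) \<ge> 0" using K0 by (simp add: sum_nonneg)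
    fix rs i assume rs: "set rs \<subseteq> {..<q}" "i < d"
    have "(mat_word_prod d A rs *\<^sub>v w) $ i = (\<Sum>j<d. mat_word_prod d A rs $$ (i, j) * w $ j)"
      using word_carrier[OF rs(1)] w rs(2) by (auto simp: scalar_prod_def atLeast0LessThan)
    also have "cmod \<dots> \<le> (\<Sum>j<d. K * R ^ length rs * cmod (w $ j))"
      using K[OF rs] by (intro sum_norm_le) (auto simp: norm_mult intro!: mult_right_mono)
    also have "\<dots> = K * (\<Sum>j<d. cmod (w $ j)) * R ^ length rs"
      by (simp add: sum_distrib_left sum_distrib_right mult_ac)
    finally show "cmod ((mat_word_prod d A rs *\<^sub>v w) $ i) \<le> K * (\<Sum>j<d. cmod (w $ j)) * R ^ length rs" .
  qed
qed

lemma v_bound: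
  obtains K where "K \<ge> 0" "\<And>n i. i < d \<Longrightarrow> cmod (v n $ i) \<le> K * real (max 1 n) powr \<rho>"
proof -
  obtain B where B: "B \<ge> 0" "\<And>rs i. set rs \<subseteq> {..<q} \<Longrightarrow> i < d \<Longrightarrow> cmod ((mat_word_prod d A rs *\<^sub>v v 0) $ i) \<le> B * R ^ length rs"
    using word_vec_bound[OF vdim] by blast
  define K where "K = B * R * max 1 (1 / R) + B"
  show ?thesis
  proof (rule that[of K])
    show "K \<ge> 0" using B Rpos by (simp add: K_def)
    fix n i assume i: "i < d"
    show "cmod (v n $ i) \<le> K * real (max 1 n) powr \<rho>"
    proof (cases "n = 0")
      case True
      have "cmod (v 0 $ i) \<le> B" using B(2)[of "[]" i] i vdim[of 0] by (simp add: mat_word_prod_def)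
      moreover have "B \<le> K" using B Rpos by (simp add: K_def)
      ultimately show ?thesis using True by simp
    next
      case False
      then obtain l where l: "q ^ l \<le> n" "n < q ^ Suc l" using ex_power_ivl1[of q n] q by auto
      obtain rs where rs: "set rs \<subseteq> {..<q}" "length rs = Suc l" "v n = mat_word_prod d A rs *\<^sub>v v 0"
        using v_eq_word[OF l(2)] by blast
      have "cmod (v n $ i) \<le> B * R ^ Suc l" using B(2)[OF rs(1) i] rs by simp
      also have "\<dots> = B * R * R ^ l" by simp
      also have "\<dots> \<le> B * R * (max 1 (1 / R) * real n powr \<rho>)"
        using B Rpos by (intro mult_left_mono power_powr_compare(1)[OF q Rpos l]) auto
      also have "\<dots> \<le> K * real n powr \<rho>" using B by (simp add: K_def algebra_simps)
      also have "real n = real (max 1 n)" using False by simp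
      finally show ?thesis .
    qed
  qed
qed

text \<open>The sum of all word products of length \<open>l\<close> is \<open>C ^ l\<close>; only
  its action on an eigenvector is needed.\<close>

lemma sum_words_eigenvector:
  assumes e: "e \<in> carrier_vec d" "C *\<^sub>v e = lam \<cdot>\<^sub>v e" and i: "i < d"
  shows "(\<Sum>rs\<in>{rs. set rs \<subseteq> {..<q} \<and> length rs = l}. (mat_word_prod d A rs *\<^sub>v e) $ i) = lam ^ l * e $ i"
  using i
proof (induction l arbitrary: i)
  case 0
  have "{rs. set rs \<subseteq> {..<q} \<and> length rs = 0} = {[]}" by auto
  thus ?case using e(1) 0 by (simp add: mat_word_prod_def)
next
  case (Suc l)
  let ?W = "{rs. set rs \<subseteq> {..<q} \<and> length rs = l}"
  have "(\<Sum>rs\<in>{rs. set rs \<subseteq> {..<q} \<and> length rs = Suc l}. (mat_word_prod d A rs *\<^sub>v e) $ i) =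
      (\<Sum>(rs, r)\<in>?W \<times> {..<q}. (mat_word_prod d A (r # rs) *\<^sub>v e) $ i)"
    unfolding lists_length_Suc_eq by (subst sum.reindex) (auto simp: inj_on_def o_def intro!: sum.cong)
  also have "\<dots> = (\<Sum>rs\<in>?W. \<Sum>r<q. (mat_word_prod d A (r # rs) *\<^sub>v e) $ i)"
    by (rule sum.cartesian_product[symmetric])
  also have "\<dots> = (\<Sum>rs\<in>?W. \<Sum>r<q. \<Sum>j<d. A r $$ (i, j) * (mat_word_prod d A rs *\<^sub>v e) $ j)"
  proof (intro sum.cong refl)
    fix rs r assume "rs \<in> ?W" "r \<in> {..<q}"
    hence rs: "set rs \<subseteq> {..<q}" "r < q" by auto
    show "(mat_word_prod d A (r # rs) *\<^sub>v e) $ i = (\<Sum>j<d. A r $$ (i, j) * (mat_word_prod d A rs *\<^sub>v e) $ j)"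
      unfolding word_Cons_vec[OF rs e(1)] using A[OF rs(2)] word_carrier[OF rs(1)] Suc.prems
      by (auto simp: scalar_prod_def atLeast0LessThan)
  qed
  also have "\<dots> = (\<Sum>rs\<in>?W. \<Sum>j<d. (\<Sum>r<q. A r $$ (i, j)) * (mat_word_prod d A rs *\<^sub>v e) $ j)"
    by (rule sum.cong[OF refl], subst sum.swap) (simp add: sum_distrib_right)
  also have "\<dots> = (\<Sum>j<d. \<Sum>rs\<in>?W. (\<Sum>r<q. A r $$ (i, j)) * (mat_word_prod d A rs *\<^sub>v e) $ j)"
    by (rule sum.swap)
  also have "\<dots> = (\<Sum>j<d. (\<Sum>r<q. A r $$ (i, j)) * (\<Sum>rs\<in>?W. (mat_word_prod d A rs *\<^sub>v e) $ j))"
    by (simp only: sum_distrib_left)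
  also have "\<dots> = (\<Sum>j<d. C $$ (i, j) * (lam ^ l * e $ j))"
    using Suc by (intro sum.cong refl) (simp add: C_entry)
  also have "\<dots> = lam ^ l * (\<Sum>j<d. C $$ (i, j) * e $ j)" by (simp add: sum_distrib_left mult_ac)
  also have "(\<Sum>j<d. C $$ (i, j) * e $ j) = (C *\<^sub>v e) $ i"
    using C_carrier e(1) Suc.prems by (auto simp: scalar_prod_def atLeast0LessThan)
  also have "\<dots> = lam * e $ i" using e Suc.prems by simp
  finally show ?case by simp
qed

text \<open>There are \<open>q ^ l\<close> words of length \<open>l\<close>, each of size
  \<open>O(R ^ l)\<close>, so \<open>cmod lam ^ l\<close> cannot outgrow \<open>(q * R) ^ l\<close>.
  This keeps the Hoelder exponents at most 1 and the candidate poles out of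
  \<open>Re s > \<rho> + 1\<close>.\<close>

lemma spectrum_bound:
  assumes "lam \<in> spectrum C"
  shows "cmod lam \<le> real q * R"
proof (rule ccontr)
  assume neg: "\<not> cmod lam \<le> real q * R"
  obtain e where e: "e \<in> carrier_vec d" "e \<noteq> 0\<^sub>v d" "C *\<^sub>v e = lam \<cdot>\<^sub>v e"
    using assms C_carrier unfolding spectrum_def eigenvalue_def eigenvector_def by auto
  obtain i where i: "i < d" "e $ i \<noteq> 0" using e(1,2) by (auto simp: vec_eq_iff)
  obtain B where B: "B \<ge> 0" "\<And>rs i. set rs \<subseteq> {..<q} \<Longrightarrow> i < d \<Longrightarrow> cmod ((mat_word_prod d A rs *\<^sub>v e) $ i) \<le> B * R ^ length rs"
    using word_vec_bound[OF e(1)] by blast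
  have qR: "real q * R > 0" using q Rpos by simp
  have le: "(cmod lam / (real q * R)) ^ l * cmod (e $ i) \<le> B" for l
  proof -
    have "cmod lam ^ l * cmod (e $ i) = cmod (\<Sum>rs\<in>{rs. set rs \<subseteq> {..<q} \<and> length rs = l}. (mat_word_prod d A rs *\<^sub>v e) $ i)"
      unfolding sum_words_eigenvector[OF e(1,3) i(1)] by (simp add: norm_mult norm_power)
    also have "\<dots> \<le> (\<Sum>rs\<in>{rs. set rs \<subseteq> {..<q} \<and> length rs = l}. B * R ^ l)"
      using B(2) i by (intro sum_norm_le) auto
    also have "\<dots> = B * (real q * R) ^ l"
      by (simp add: card_lists_length_eq power_mult_distrib)
    finally have *: "cmod lam ^ l * cmod (e $ i) \<le> B * (real q * R) ^ l" .
    have "(real q * R) ^ l > 0" using qR by (rule zero_less_power)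
    thus ?thesis using * unfolding power_divide times_divide_eq_left by (subst pos_divide_le_eq)
  qed
  have "1 < cmod lam / (real q * R)" using neg qR by (simp add: less_divide_eq)
  then obtain l where "B / cmod (e $ i) < (cmod lam / (real q * R)) ^ l" using real_arch_pow by meson
  hence "B < (cmod lam / (real q * R)) ^ l * cmod (e $ i)" using i(2) by (simp add: divide_less_eq)
  thus False using le[of l] by linarith
qed

end

text \<open>\<open>b i\<close> is the number of rows from row \<open>i\<close> to the end of its Jordan block. The block sizes
  come from the Jordan normal form chosen in \<^const>\<open>max_jordan_block\<close>, so its uniqueness is not needed.\<close>
locale regular_sequence_jordan = regular_sequence +
  fixes S T :: "nat \<Rightarrow> nat \<Rightarrow> complex" and ev :: "nat \<Rightarrow> complex" and b :: "nat \<Rightarrow> nat"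
  assumes ST: "\<And>i j. i < d \<Longrightarrow> j < d \<Longrightarrow> (\<Sum>k<d. S i k * T k j) = (if i = j then 1 else 0)"
    and TS: "\<And>i j. i < d \<Longrightarrow> j < d \<Longrightarrow> (\<Sum>k<d. T i k * S k j) = (if i = j then 1 else 0)"
    and TC: "\<And>i j. i < d \<Longrightarrow> j < d \<Longrightarrow>
      (\<Sum>k<d. T i k * C $$ (k, j)) = ev i * T i j + (if 1 < b i then T (Suc i) j else 0)"
    and b: "\<And>i. i < d \<Longrightarrow> 1 \<le> b i" "\<And>i. i < d \<Longrightarrow> i + b i \<le> d"
    and chain: "\<And>i p. i < d \<Longrightarrow> p < b i \<Longrightarrow> ev (i + p) = ev i \<and> b (i + p) = b i - p"
    and ev_spectrum: "\<And>i. i < d \<Longrightarrow> ev i \<in> spectrum C"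
    and b_max: "\<And>i. i < d \<Longrightarrow> b i \<le> max_jordan_block C (ev i)"

text \<open>If \<open>C = P J Q\<close> with \<open>Q\<close> inverse to \<open>P\<close>, then
  \<open>Q C = J Q\<close>: the rows of \<open>Q\<close> are left generalised eigenvectors. They
  serve as \<open>T\<close>, and \<open>P\<close> serves as \<open>S\<close> to return to the
  original coordinates.\<close>

lemma (in regular_sequence) jordan_basis_exists:
  "\<exists>S T ev b. regular_sequence_jordan q d A v R C S T ev b"
proof -
  define n_as where "n_as = (SOME n_as. jordan_nf C n_as)"
  have "\<exists>n_as. jordan_nf C n_as"
    using char_poly_factorized[OF C_carrier] jordan_nf_exists[OF C_carrier] by blast
  hence nf: "jordan_nf C n_as" unfolding n_as_def by (rule someI_ex)
  define J where "J = jordan_matrix n_as"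
  obtain n P Q where PQ: "{C, J, P, Q} \<subseteq> carrier_mat n n" "P * Q = 1\<^sub>m n" "Q * P = 1\<^sub>m n" "C = P * J * Q"
    using similar_matD nf unfolding jordan_nf_def J_def by metis
  have n: "n = d" using PQ(1) C_carrier by auto
  have c: "C \<in> carrier_mat d d" "J \<in> carrier_mat d d" "P \<in> carrier_mat d d" "Q \<in> carrier_mat d d"
    using PQ(1) unfolding n by auto
  have s: "sum_list (map fst n_as) = d" using c(2) by (auto simp: J_def)
  obtain ev b where J: "\<And>i. i < d \<Longrightarrow> 1 \<le> b i \<and> i + b i \<le> d \<and> (\<forall>p<b i. ev (i + p) = ev i \<and> b (i + p) = b i - p) \<and>
    (\<exists>N. (N, ev i) \<in> set n_as \<and> b i \<le> N) \<and>
    (\<forall>j<d. J $$ (i, j) = (if j = i then ev i else if j = Suc i \<and> 1 < b i then 1 else 0))"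
    using jordan_matrix_chain[of n_as] unfolding s J_def[symmetric] by blast
  have QC: "Q * C = J * Q"
  proof -
    have "Q * C = Q * (P * (J * Q))" using PQ(4) c by (simp add: assoc_mult_mat[of _ d d _ d _ d])
    also have "\<dots> = (Q * P) * (J * Q)" using c by (intro assoc_mult_mat[symmetric, of _ d d _ d _ d]) auto
    also have "\<dots> = J * Q" using PQ(3) c by (simp add: n)
    finally show ?thesis .
  qed
  have entry: "(M * N) $$ (i, j) = (\<Sum>k<d. M $$ (i, k) * N $$ (k, j))"
    if "M \<in> carrier_mat d d" "N \<in> carrier_mat d d" "i < d" "j < d" for M N :: "complex mat" and i j
    using that by (auto simp: scalar_prod_def atLeast0LessThan)
  have "regular_sequence_jordan q d A v R C (\<lambda>i j. P $$ (i, j)) (\<lambda>i j. Q $$ (i, j)) ev b"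
  proof
    fix i j assume ij: "i < d" "j < d"
    show "(\<Sum>k<d. P $$ (i, k) * Q $$ (k, j)) = (if i = j then 1 else 0)"
      using entry[OF c(3,4) ij] PQ(2) ij by (simp add: n)
    show "(\<Sum>k<d. Q $$ (i, k) * P $$ (k, j)) = (if i = j then 1 else 0)"
      using entry[OF c(4,3) ij] PQ(3) ij by (simp add: n)
    have "(\<Sum>k<d. Q $$ (i, k) * C $$ (k, j)) = (\<Sum>k<d. J $$ (i, k) * Q $$ (k, j))"
      using entry[OF c(4,1) ij] entry[OF c(2,4) ij] QC by simp
    also have "\<dots> = (\<Sum>k<d. (if k = i then ev i * Q $$ (i, j) else 0) + (if k = Suc i then (if 1 < b i then Q $$ (Suc i, j) else 0) else 0))"
      using J[OF ij(1)] by (intro sum.cong refl) auto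
    also have "\<dots> = ev i * Q $$ (i, j) + (if Suc i < d then (if 1 < b i then Q $$ (Suc i, j) else 0) else 0)"
      using ij by (simp add: sum.distrib)
    also have "\<dots> = ev i * Q $$ (i, j) + (if 1 < b i then Q $$ (Suc i, j) else 0)"
      using J[OF ij(1)] by auto
    finally show "(\<Sum>k<d. Q $$ (i, k) * C $$ (k, j)) = ev i * Q $$ (i, j) + (if 1 < b i then Q $$ (Suc i, j) else 0)" .
  next
    fix i assume i: "i < d"
    show "1 \<le> b i" "i + b i \<le> d" using J[OF i] by auto
    show "ev (i + p) = ev i \<and> b (i + p) = b i - p" if "p < b i" for p using J[OF i] that by blast
    obtain N where N: "(N, ev i) \<in> set n_as" "b i \<le> N" using J[OF i] by blast
    have "N \<noteq> 0" using N J[OF i] by auto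
    have "poly (char_poly C) (ev i) = 0"
      unfolding jordan_nf_char_poly[OF nf] poly_prod_list
      using N(1) \<open>N \<noteq> 0\<close> by (auto simp: prod_list_zero_iff intro!: image_eqI[of _ _ "(N, ev i)"])
    thus "ev i \<in> spectrum C" using spectrum_root_char_poly[OF C_carrier] by simp
    have fin: "finite {n. (n, ev i) \<in> set n_as}"
      by (rule finite_subset[of _ "fst ` set n_as"]) force+
    have "N \<le> Max (insert 0 {n. (n, ev i) \<in> set n_as})" using fin N(1) by (intro Max_ge) auto
    thus "b i \<le> max_jordan_block C (ev i)" using N(2) by (simp add: max_jordan_block_def n_as_def[symmetric])
  qed
  thus ?thesis by blast
qed

section \<open>Jordan coordinates of the summatory function\<close>

context regular_sequence_jordan
begin

definition Vsum :: "nat \<Rightarrow> nat \<Rightarrow> complex" where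
  "Vsum N j = (\<Sum>n<N. v n $ j)"

text \<open>Every row starts a chain of its own, not only the first row of a block. The chains
  overlap, but the original sum is recovered from the entries \<open>y i 0\<close> alone.\<close>

definition y :: "nat \<Rightarrow> nat \<Rightarrow> nat \<Rightarrow> complex" where
  "y i p N = (if p < b i then \<Sum>j<d. T (i + p) j * Vsum N j else 0)"

lemma Vsum_digits:
  assumes "r \<le> q"
  shows "Vsum (q * N + r) j = Vsum (q * N) j + (\<Sum>r'<r. v (q * N + r') $ j)"
proof -
  have "{..<q * N + r} = {..<q * N} \<union> {q * N..<q * N + r}" by auto
  hence "Vsum (q * N + r) j = Vsum (q * N) j + (\<Sum>n\<in>{q * N..<q * N + r}. v n $ j)"
    unfolding Vsum_def by (simp add: sum.union_disjoint ivl_disj_int)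
  also have "(\<Sum>n\<in>{q * N..<q * N + r}. v n $ j) = (\<Sum>r'<r. v (q * N + r') $ j)"
    by (rule sum.reindex_bij_witness[of _ "\<lambda>r. q * N + r" "\<lambda>n. n - q * N"]) auto
  finally show ?thesis .
qed

text \<open>The indices below \<open>q * N\<close> split into \<open>N\<close> complete digit
  blocks, and one such block contributes the sum of all \<open>A r\<close> applied to the same
  vector. Hence no remainder appears.\<close>

lemma Vsum_mult:
  assumes i: "i < d"
  shows "Vsum (q * N) i = (\<Sum>j<d. C $$ (i, j) * Vsum N j)"
proof (induction N)
  case 0
  show ?case by (simp add: Vsum_def)
next
  case (Suc N)
  have "Vsum (q * Suc N) i = Vsum (q * N + q) i" by (simp add: algebra_simps)
  also have "\<dots> = Vsum (q * N) i + (\<Sum>r<q. \<Sum>j<d. A r $$ (i, j) * v N $ j)"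
    using i by (simp add: Vsum_digits v_entry)
  also have "(\<Sum>r<q. \<Sum>j<d. A r $$ (i, j) * v N $ j) = (\<Sum>j<d. C $$ (i, j) * v N $ j)"
    by (subst sum.swap) (simp add: C_entry[OF i] sum_distrib_right)
  also have "Vsum (q * N) i + (\<Sum>j<d. C $$ (i, j) * v N $ j) = (\<Sum>j<d. C $$ (i, j) * Vsum (Suc N) j)"
    unfolding Suc by (simp add: Vsum_def algebra_simps sum.distrib)
  finally show ?case .
qed

lemma y_exact:
  assumes i: "i < d"
  shows "y i p (q * N) = ev i * y i p N + y i (Suc p) N"
proof (cases "p < b i")
  case True
  define k where "k = i + p"
  have k: "k < d" "ev k = ev i" "b k = b i - p" using True i b(2)[OF i] chain[OF i True] by (auto simp: k_def)
  have "y i p (q * N) = (\<Sum>l<d. \<Sum>j<d. T k l * C $$ (l, j) * Vsum N j)"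
    using True by (simp add: y_def k_def Vsum_mult sum_distrib_left mult.assoc)
  also have "\<dots> = (\<Sum>j<d. (\<Sum>l<d. T k l * C $$ (l, j)) * Vsum N j)"
    by (subst sum.swap) (simp add: sum_distrib_right)
  also have "\<dots> = (\<Sum>j<d. (ev k * T k j + (if 1 < b k then T (Suc k) j else 0)) * Vsum N j)"
    using k by (intro sum.cong refl) (simp add: TC)
  also have "\<dots> = ev k * (\<Sum>j<d. T k j * Vsum N j) + (if 1 < b k then \<Sum>j<d. T (Suc k) j * Vsum N j else 0)"
    by (simp add: algebra_simps sum.distrib sum_distrib_left)
  also have "\<dots> = ev i * y i p N + y i (Suc p) N"
    using True k by (auto simp: y_def k_def)
  finally show ?thesis .
qed (auto simp: y_def)

lemma Vsum_coordinates:
  assumes "i < d"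
  shows "Vsum N i = (\<Sum>k<d. S i k * y k 0 N)"
proof -
  have "(\<Sum>k<d. S i k * y k 0 N) = (\<Sum>k<d. \<Sum>j<d. S i k * T k j * Vsum N j)"
    by (intro sum.cong refl) (use b(1) in \<open>force simp: y_def sum_distrib_left mult.assoc\<close>)
  also have "\<dots> = (\<Sum>j<d. (\<Sum>k<d. S i k * T k j) * Vsum N j)"
    by (subst sum.swap) (simp add: sum_distrib_right)
  also have "\<dots> = (\<Sum>j<d. (if i = j then 1 else 0) * Vsum N j)" using assms by (simp add: ST)
  also have "\<dots> = (\<Sum>j<d. if j = i then Vsum N j else 0)" by (intro sum.cong) auto
  also have "\<dots> = Vsum N i" using assms by simp
  finally show ?thesis ..
qed

lemma y_jordan_chain: "\<exists>K. \<forall>i<d. jordan_chain q R (ev i) (b i) K (y i)"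
proof -
  obtain K where K: "K \<ge> 0" "\<And>n i. i < d \<Longrightarrow> cmod (v n $ i) \<le> K * real (max 1 n) powr \<rho>"
    using v_bound by blast
  define TT where "TT = (\<Sum>i<d. \<Sum>j<d. cmod (T i j))"
  define AA where "AA = (\<Sum>r<q. \<Sum>i<d. \<Sum>j<d. cmod (A r $$ (i, j)))"
  have TT: "(\<Sum>j<d. cmod (T k j)) \<le> TT" if "k < d" for k
    unfolding TT_def using that by (intro member_le_sum) (auto intro: sum_nonneg)
  have TT0: "TT \<ge> 0" "AA \<ge> 0" by (auto simp: TT_def AA_def intro!: sum_nonneg)
  have weighted: "cmod (\<Sum>j<d. T k j * w j) \<le> TT * B" if "k < d" "\<And>j. j < d \<Longrightarrow> cmod (w j) \<le> B" "B \<ge> 0" for k w B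
  proof -
    have "cmod (\<Sum>j<d. T k j * w j) \<le> (\<Sum>j<d. cmod (T k j) * B)"
      using that by (intro sum_norm_le) (auto simp: norm_mult intro!: mult_left_mono)
    also have "\<dots> = (\<Sum>j<d. cmod (T k j)) * B" by (simp add: sum_distrib_right)
    also have "\<dots> \<le> TT * B" using TT[OF that(1)] that(3) by (intro mult_right_mono)
    finally show ?thesis .
  qed
  \<comment> \<open>The first summand bounds an incomplete digit block, the second a single
    increment; \<open>TT\<close> is the cost of passing to Jordan coordinates.\<close>
  define K' where "K' = TT * (AA * K) + TT * K"
  have "jordan_chain q R (ev i) (b i) K' (y i)" if i: "i < d" for i
  proof
    show "q \<ge> 2" "R > 0" by (fact q Rpos)+
    show "y i p N = 0" if "b i \<le> p" for p N using that by (simp add: y_def)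
    show "y i p (q * N) = ev i * y i p N + y i (Suc p) N" for p N by (rule y_exact[OF i])
    fix p N
    define Np where "Np = real (max 1 N) powr \<rho>"
    have Np: "Np \<ge> 0" by (simp add: Np_def)
    show "cmod (y i p (Suc N) - y i p N) \<le> K' * real (max 1 N) powr \<rho>"
    proof (cases "p < b i")
      case True
      hence k: "i + p < d" using b(2)[OF i] by linarith
      have "y i p (Suc N) - y i p N = (\<Sum>j<d. T (i + p) j * v N $ j)"
        using True by (simp add: y_def Vsum_def sum_subtractf[symmetric] algebra_simps sum.distrib)
      also have "cmod \<dots> \<le> TT * (K * Np)"
        using K Np by (intro weighted[OF k]) (auto simp: Np_def)
      also have "\<dots> \<le> K' * Np" using TT0 K(1) Np by (simp add: K'_def algebra_simps)
      finally show ?thesis by (simp add: Np_def)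
    next
      case False
      thus ?thesis using TT0 K(1) by (simp add: y_def K'_def)
    qed
    fix r assume r: "r < q"
    show "cmod (y i p (q * N + r) - (ev i * y i p N + y i (Suc p) N)) \<le> K' * real (max 1 N) powr \<rho>"
    proof (cases "p < b i")
      case True
      hence k: "i + p < d" using b(2)[OF i] by linarith
      have "y i p (q * N + r) - (ev i * y i p N + y i (Suc p) N) = y i p (q * N + r) - y i p (q * N)"
        by (simp only: y_exact[OF i])
      also have "\<dots> = (\<Sum>j<d. T (i + p) j * (\<Sum>r'<r. v (q * N + r') $ j))"
        using True r by (simp add: y_def Vsum_digits distrib_left sum.distrib)
      also have "cmod \<dots> \<le> TT * (AA * K * Np)"
      proof (rule weighted[OF k])
        fix j assume j: "j < d"
        have "cmod (\<Sum>r'<r. v (q * N + r') $ j) \<le> (\<Sum>r'<r. \<Sum>l<d. cmod (A r' $$ (j, l)) * (K * Np))"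
        proof (rule sum_norm_le)
          fix r' assume "r' \<in> {..<r}"
          hence "v (q * N + r') $ j = (\<Sum>l<d. A r' $$ (j, l) * v N $ l)" using r j by (intro v_entry) auto
          also have "cmod \<dots> \<le> (\<Sum>l<d. cmod (A r' $$ (j, l)) * (K * Np))"
            using K(2) by (intro sum_norm_le) (auto simp: norm_mult Np_def intro!: mult_left_mono)
          finally show "cmod (v (q * N + r') $ j) \<le> (\<Sum>l<d. cmod (A r' $$ (j, l)) * (K * Np))" .
        qed
        also have "\<dots> = (\<Sum>r'<r. \<Sum>l<d. cmod (A r' $$ (j, l))) * (K * Np)" by (simp add: sum_distrib_right)
        also have "\<dots> \<le> AA * (K * Np)"
        proof (intro mult_right_mono)
          have "(\<Sum>r'<r. \<Sum>l<d. cmod (A r' $$ (j, l))) \<le> (\<Sum>r'<q. \<Sum>l<d. cmod (A r' $$ (j, l)))"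
            using r by (intro sum_mono2) (auto intro: sum_nonneg)
          also have "\<dots> \<le> AA"
            unfolding AA_def
          proof (rule sum_mono)
            fix r' show "(\<Sum>l<d. cmod (A r' $$ (j, l))) \<le> (\<Sum>i<d. \<Sum>l<d. cmod (A r' $$ (i, l)))"
              using j by (intro member_le_sum[of j "{..<d}" "\<lambda>i. \<Sum>l<d. cmod (A r' $$ (i, l))"]) (auto intro: sum_nonneg)
          qed
          finally show "(\<Sum>r'<r. \<Sum>l<d. cmod (A r' $$ (j, l))) \<le> AA" .
        qed (use K Np in auto)
        finally show "cmod (\<Sum>r'<r. v (q * N + r') $ j) \<le> AA * K * Np" by (simp add: mult.assoc)
      qed (use TT0 K Np in auto)
      also have "\<dots> \<le> K' * Np" using TT0 K(1) Np by (simp add: K'_def algebra_simps)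
      finally show ?thesis by (simp add: Np_def)
    next
      case False
      thus ?thesis using TT0 K(1) by (simp add: y_def K'_def)
    qed
  qed
  thus ?thesis by blast
qed

end

subsection \<open>Asymptotics of the summatory function\<close>

context regular_sequence_jordan
begin

abbreviation "\<Lambda> \<equiv> {lam \<in> spectrum C. cmod lam > R}"

abbreviation "I \<equiv> {i. i < d \<and> cmod (ev i) > R}"

lemma finite_spectrum: "finite (spectrum C)"
  using card_finite_spectrum[OF C_carrier] by simp

text \<open>This is the form of the spectral bound used by the regularity results: the restriction
  \<open>\<alpha> \<le> 1\<close> made there excludes no admissible exponent.\<close>

lemma holder_exponent_le_1:
  assumes "lam \<in> spectrum C" "cmod lam > R"
  shows "0 < ln (cmod lam / R) / ln (real q)" "ln (cmod lam / R) / ln (real q) \<le> 1"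
proof -
  have lq: "ln (real q) > 0" using q by simp
  have "cmod lam / R \<le> real q" using spectrum_bound[OF assms(1)] Rpos by (simp add: divide_le_eq)
  moreover have "1 < cmod lam / R" using assms(2) Rpos by simp
  ultimately have "0 < ln (cmod lam / R)" "ln (cmod lam / R) \<le> ln (real q)"
    by (simp, subst ln_le_cancel_iff) auto
  thus "0 < ln (cmod lam / R) / ln (real q)" "ln (cmod lam / R) / ln (real q) \<le> 1"
    using lq by simp_all
qed

definition lg :: "real \<Rightarrow> real" where "lg t = ln t / ln (real q)"

definition main_term :: "(complex \<Rightarrow> nat \<Rightarrow> real \<Rightarrow> complex) \<Rightarrow> real \<Rightarrow> complex" where
  "main_term \<Phi> t = (\<Sum>lam\<in>\<Lambda>. exp (of_real (lg t) * Ln lam) *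
     (\<Sum>k<max_jordan_block C lam. of_real (lg t) ^ k * \<Phi> lam k (lg t)))"

text \<open>Each large row has an expansion of its own; those with a common eigenvalue are added
  with the weights \<open>S 0 i\<close> that extract the first component. Since no chain is longer
  than the largest block, the powers of the logarithm stay below the block size.\<close>

lemma expansion_exists:
  "\<exists>\<Phi> G. (\<forall>lam k u. \<Phi> lam k (u + 1) = \<Phi> lam k u) \<and>
     (\<forall>lam\<in>\<Lambda>. \<forall>k \<alpha>. 0 < \<alpha> \<and> \<alpha> < ln (cmod lam / R) / ln (real q) \<longrightarrow> holder_continuous \<alpha> (\<Phi> lam k)) \<and>
     (\<forall>t\<ge>1. main_term \<Phi> t = (\<Sum>i\<in>I. S 0 i * G i t)) \<and>
     (\<forall>i\<in>I. \<forall>N\<ge>1. G i (real N) = y i 0 N) \<and>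
     (\<forall>i\<in>I. \<exists>c\<ge>0. \<forall>t\<ge>1. cmod (G i t - y i 0 (nat \<lfloor>t\<rfloor>)) \<le> c * t powr \<rho>)"
proof -
  obtain K where K: "\<And>i. i < d \<Longrightarrow> jordan_chain q R (ev i) (b i) K (y i)" using y_jordan_chain by blast
  have ex: "\<exists>(\<phi> :: nat \<Rightarrow> real \<Rightarrow> complex) G. (\<forall>k u. \<phi> k (u + 1) = \<phi> k u) \<and>
      (\<forall>k \<alpha>. 0 < \<alpha> \<and> \<alpha> \<le> 1 \<and> \<alpha> < ln (cmod (ev i) / R) / ln (real q) \<longrightarrow> holder_continuous \<alpha> (\<phi> k)) \<and>
      (\<forall>t\<ge>1. G t = exp (of_real (lg t) * Ln (ev i)) * (\<Sum>k<b i. of_real (lg t) ^ k * \<phi> k (lg t))) \<and>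
      (\<forall>N\<ge>1. G (real N) = y i 0 N) \<and>
      (\<exists>c\<ge>0. \<forall>t\<ge>1. cmod (G t - y i 0 (nat \<lfloor>t\<rfloor>)) \<le> c * t powr \<rho>)" if i: "i \<in> I" for i
  proof -
    interpret jc: large_jordan_chain q R "ev i" "b i" K "y i"
      unfolding large_jordan_chain_def large_jordan_chain_axioms_def using K[of i] i by auto
    obtain \<phi> :: "nat \<Rightarrow> real \<Rightarrow> complex" where \<phi>: "\<And>k u. \<phi> k (u + 1) = \<phi> k u"
      "\<And>k \<alpha>. 0 < \<alpha> \<Longrightarrow> \<alpha> \<le> 1 \<Longrightarrow> \<alpha> < ln (cmod (ev i) / R) / ln (real q) \<Longrightarrow> holder_continuous \<alpha> (\<phi> k)"
      "\<And>t. t \<ge> 1 \<Longrightarrow> jc.G 0 t = exp (of_real (ln t / ln (real q)) * Ln (ev i)) *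
           (\<Sum>k<b i. of_real (ln t / ln (real q)) ^ k * \<phi> k (ln t / ln (real q)))"
      using jc.expansion by blast
    show ?thesis
      using \<phi> jc.G_nat[of _ 0] jc.G_floor_bound[of 0]
      by (intro exI[of _ \<phi>] exI[of _ "jc.G 0"]) (auto simp: lg_def)
  qed
  \<comment> \<open>The two witnesses are packed into a pair so that one application of the axiom of
    choice selects them together for all rows.\<close>
  have "\<forall>i\<in>I. \<exists>\<phi>G. (\<forall>k u. fst \<phi>G k (u + 1) = fst \<phi>G k u) \<and>
      (\<forall>k \<alpha>. 0 < \<alpha> \<and> \<alpha> \<le> 1 \<and> \<alpha> < ln (cmod (ev i) / R) / ln (real q) \<longrightarrow> holder_continuous \<alpha> (fst \<phi>G k)) \<and>
      (\<forall>t\<ge>1. snd \<phi>G t = exp (of_real (lg t) * Ln (ev i)) * (\<Sum>k<b i. of_real (lg t) ^ k * fst \<phi>G k (lg t))) \<and>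
      (\<forall>N\<ge>1. snd \<phi>G (real N) = y i 0 N) \<and>
      (\<exists>c\<ge>0. \<forall>t\<ge>1. cmod (snd \<phi>G t - y i 0 (nat \<lfloor>t\<rfloor>)) \<le> c * t powr \<rho>)"
    (is "\<forall>i\<in>I. \<exists>\<phi>G. ?P i \<phi>G")
  proof
    fix i assume "i \<in> I"
    from ex[OF this] obtain \<phi> :: "nat \<Rightarrow> real \<Rightarrow> complex" and G where "?P i (\<phi>, G)" by auto
    thus "\<exists>\<phi>G. ?P i \<phi>G" by blast
  qed
  from bchoice[OF this] obtain \<phi>G :: "nat \<Rightarrow> (nat \<Rightarrow> real \<Rightarrow> complex) \<times> (real \<Rightarrow> complex)"
    where \<phi>G: "\<forall>i\<in>I. ?P i (\<phi>G i)" by blast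
  define \<phi> where "\<phi> i = fst (\<phi>G i)" for i
  define G where "G i = snd (\<phi>G i)" for i
  have \<phi>1: "\<phi> i k (u + 1) = \<phi> i k u" if "i \<in> I" for i k u using \<phi>G that unfolding \<phi>_def by blast
  have \<phi>2: "holder_continuous \<alpha> (\<phi> i k)" if "i \<in> I" "0 < \<alpha>" "\<alpha> \<le> 1" "\<alpha> < ln (cmod (ev i) / R) / ln (real q)" for i k \<alpha>
    using \<phi>G that unfolding \<phi>_def by blast
  have \<phi>3: "G i t = exp (of_real (lg t) * Ln (ev i)) * (\<Sum>k<b i. of_real (lg t) ^ k * \<phi> i k (lg t))" if "i \<in> I" "t \<ge> 1" for i t
    using \<phi>G that unfolding \<phi>_def G_def by blast
  have \<phi>4: "G i (real N) = y i 0 N" if "i \<in> I" "N \<ge> 1" for i N using \<phi>G that unfolding G_def by blast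
  have \<phi>5: "\<exists>c\<ge>0. \<forall>t\<ge>1. cmod (G i t - y i 0 (nat \<lfloor>t\<rfloor>)) \<le> c * t powr \<rho>" if "i \<in> I" for i
    using \<phi>G that unfolding G_def by blast
  define \<Phi> where "\<Phi> lam k u = (\<Sum>i\<in>{i\<in>I. ev i = lam \<and> k < b i}. S 0 i * \<phi> i k u)" for lam k u
  have "main_term \<Phi> t = (\<Sum>i\<in>I. S 0 i * G i t)" if t: "t \<ge> 1" for t
  proof -
    have inner: "(\<Sum>k<max_jordan_block C lam. of_real (lg t) ^ k * \<Phi> lam k (lg t)) =
        (\<Sum>i\<in>{i\<in>I. ev i = lam}. S 0 i * (\<Sum>k<b i. of_real (lg t) ^ k * \<phi> i k (lg t)))" for lam
    proof -
      have "(\<Sum>k<max_jordan_block C lam. of_real (lg t) ^ k * \<Phi> lam k (lg t)) =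
          (\<Sum>k<max_jordan_block C lam. \<Sum>i\<in>{i\<in>I. ev i = lam}. if k < b i then S 0 i * (of_real (lg t) ^ k * \<phi> i k (lg t)) else 0)"
      proof (rule sum.cong[OF refl])
        fix k
        have "of_real (lg t) ^ k * \<Phi> lam k (lg t) = (\<Sum>i\<in>{i\<in>I. ev i = lam \<and> k < b i}. S 0 i * (of_real (lg t) ^ k * \<phi> i k (lg t)))"
          by (simp add: \<Phi>_def sum_distrib_left mult_ac)
        also have "\<dots> = (\<Sum>i\<in>{i\<in>I. ev i = lam}. if k < b i then S 0 i * (of_real (lg t) ^ k * \<phi> i k (lg t)) else 0)"
          by (rule sum.mono_neutral_cong_left) auto
        finally show "of_real (lg t) ^ k * \<Phi> lam k (lg t) = \<dots>" .
      qed
      also have "\<dots> = (\<Sum>i\<in>{i\<in>I. ev i = lam}. \<Sum>k<max_jordan_block C lam. if k < b i then S 0 i * (of_real (lg t) ^ k * \<phi> i k (lg t)) else 0)"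
        by (rule sum.swap)
      also have "\<dots> = (\<Sum>i\<in>{i\<in>I. ev i = lam}. \<Sum>k<b i. S 0 i * (of_real (lg t) ^ k * \<phi> i k (lg t)))"
      proof (rule sum.cong[OF refl])
        fix i assume "i \<in> {i\<in>I. ev i = lam}"
        hence "b i \<le> max_jordan_block C lam" using b_max by auto
        thus "(\<Sum>k<max_jordan_block C lam. if k < b i then S 0 i * (of_real (lg t) ^ k * \<phi> i k (lg t)) else 0) =
            (\<Sum>k<b i. S 0 i * (of_real (lg t) ^ k * \<phi> i k (lg t)))"
          by (intro sum.mono_neutral_cong_right) auto
      qed
      finally show ?thesis by (simp add: sum_distrib_left)
    qed
    have "main_term \<Phi> t = (\<Sum>lam\<in>\<Lambda>. \<Sum>i\<in>{i\<in>I. ev i = lam}. S 0 i * G i t)"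
      unfolding main_term_def
    proof (rule sum.cong[OF refl])
      fix lam
      have "(\<Sum>i\<in>{i\<in>I. ev i = lam}. S 0 i * G i t) =
          (\<Sum>i\<in>{i\<in>I. ev i = lam}. exp (of_real (lg t) * Ln lam) * (S 0 i * (\<Sum>k<b i. of_real (lg t) ^ k * \<phi> i k (lg t))))"
        by (rule sum.cong[OF refl]) (use t in \<open>auto simp: \<phi>3 mult_ac\<close>)
      thus "exp (of_real (lg t) * Ln lam) * (\<Sum>k<max_jordan_block C lam. of_real (lg t) ^ k * \<Phi> lam k (lg t)) =
          (\<Sum>i\<in>{i\<in>I. ev i = lam}. S 0 i * G i t)"
        unfolding inner by (simp add: sum_distrib_left)
    qed
    also have "\<dots> = (\<Sum>i\<in>I. S 0 i * G i t)"
      by (rule sum.group) (use ev_spectrum finite_spectrum in auto)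
    finally show ?thesis .
  qed
  moreover have "\<Phi> lam k (u + 1) = \<Phi> lam k u" for lam k u
    unfolding \<Phi>_def by (rule sum.cong) (auto simp: \<phi>1)
  moreover have "holder_continuous \<alpha> (\<Phi> lam k)"
    if "lam \<in> \<Lambda>" "0 < \<alpha>" "\<alpha> < ln (cmod lam / R) / ln (real q)" for lam k \<alpha>
  proof -
    have \<alpha>: "\<alpha> \<le> 1" using holder_exponent_le_1[of lam] that by auto
    have "holder_continuous \<alpha> (\<lambda>u. S 0 i * \<phi> i k u)" if i: "i \<in> {i\<in>I. ev i = lam \<and> k < b i}" for i
    proof -
      have "holder_continuous \<alpha> (\<phi> i k)" using i \<open>0 < \<alpha>\<close> \<open>\<alpha> < _\<close> \<alpha> by (intro \<phi>2) auto
      then obtain H where H: "\<And>u w. cmod (\<phi> i k u - \<phi> i k w) \<le> H * \<bar>u - w\<bar> powr \<alpha>"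
        unfolding holder_continuous_def by blast
      have "cmod (S 0 i * \<phi> i k u - S 0 i * \<phi> i k w) \<le> cmod (S 0 i) * H * \<bar>u - w\<bar> powr \<alpha>" for u w
      proof -
        have "cmod (S 0 i * \<phi> i k u - S 0 i * \<phi> i k w) = cmod (S 0 i) * cmod (\<phi> i k u - \<phi> i k w)"
          by (simp only: norm_mult[symmetric] right_diff_distrib)
        also have "\<dots> \<le> cmod (S 0 i) * (H * \<bar>u - w\<bar> powr \<alpha>)" by (intro mult_left_mono H) auto
        finally show ?thesis by (simp add: mult.assoc)
      qed
      thus ?thesis unfolding holder_continuous_def by blast
    qed
    thus ?thesis unfolding \<Phi>_def by (rule holder_continuous_sum)
  qed
  ultimately show ?thesis using \<phi>4 \<phi>5
    by (intro exI[of _ \<Phi>] exI[of _ G]) blast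
qed

definition log_exponent :: nat where
  "log_exponent = Max (insert 0 (max_jordan_block C ` {lam\<in>spectrum C. cmod lam = R}))"

lemma small_coordinates_bound:
  assumes i: "i < d" "i \<notin> I"
  shows "\<exists>c\<ge>0. \<forall>N\<ge>3. cmod (y i 0 N) \<le> c * real N powr \<rho> * ln (real N) ^ log_exponent"
proof -
  obtain K where "jordan_chain q R (ev i) (b i) K (y i)" using y_jordan_chain i by blast
  then interpret jc: jordan_chain q R "ev i" "b i" K "y i" .
  have "cmod (ev i) \<le> R" using i by auto
  from jc.small_eigenvalue_bound[OF this, of 0] obtain c where c: "c \<ge> 0"
    "\<And>N. N \<ge> 3 \<Longrightarrow> cmod (y i 0 N) \<le> c * real N powr \<rho> * ln (real N) ^ (if cmod (ev i) = R then b i else 0)" by blast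
  have e: "(if cmod (ev i) = R then b i else 0) \<le> log_exponent"
  proof (cases "cmod (ev i) = R")
    case True
    hence "max_jordan_block C (ev i) \<le> log_exponent"
      unfolding log_exponent_def using ev_spectrum[OF i(1)] finite_spectrum by (intro Max_ge) auto
    thus ?thesis using b_max[OF i(1)] True by simp
  qed simp
  have "cmod (y i 0 N) \<le> c * real N powr \<rho> * ln (real N) ^ log_exponent" if N: "N \<ge> 3" for N
  proof -
    have "exp 1 \<le> (3::real)" using exp_le by simp
    also have "3 \<le> real N" using N by simp
    finally have "ln (real N) \<ge> 1" using N by (subst ln_ge_iff) auto
    hence "ln (real N) ^ (if cmod (ev i) = R then b i else 0) \<le> ln (real N) ^ log_exponent"
      by (rule power_increasing[OF e])
    hence "c * real N powr \<rho> * ln (real N) ^ (if cmod (ev i) = R then b i else 0) \<le> c * real N powr \<rho> * ln (real N) ^ log_exponent"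
      using c(1) by (intro mult_left_mono) auto
    thus ?thesis using c(2)[OF N] by linarith
  qed
  thus ?thesis using c(1) by blast
qed

lemma small_coordinates_powr_bound:
  assumes i: "i < d" "i \<notin> I" and \<rho>': "\<rho>' > \<rho>"
  shows "\<exists>c\<ge>0. \<forall>N\<ge>1. cmod (y i 0 N) \<le> c * real N powr \<rho>'"
proof -
  obtain c where c: "c \<ge> 0" "\<And>N. N \<ge> 3 \<Longrightarrow> cmod (y i 0 N) \<le> c * real N powr \<rho> * ln (real N) ^ log_exponent"
    using small_coordinates_bound[OF i] by blast
  \<comment> \<open>Small enough for \<open>log_exponent\<close> factors bounded by
    \<open>N powr \<delta> / \<delta>\<close> to fit into the gap between \<open>\<rho>\<close> and
    \<open>\<rho>'\<close>. The added 1 avoids division by zero.\<close>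
  define \<delta> where "\<delta> = (\<rho>' - \<rho>) / (real log_exponent + 1)"
  have \<delta>: "\<delta> > 0" "\<delta> * real log_exponent \<le> \<rho>' - \<rho>"
  proof -
    show "\<delta> > 0" using \<rho>' unfolding \<delta>_def by (intro divide_pos_pos) auto
    hence "\<delta> * real log_exponent \<le> \<delta> * (real log_exponent + 1)" by simp
    also have "\<dots> = \<rho>' - \<rho>" unfolding \<delta>_def by (rule nonzero_eq_divide_eq[THEN iffD1]) auto
    finally show "\<delta> * real log_exponent \<le> \<rho>' - \<rho>" .
  qed
  define c' where "c' = c * (1 / \<delta>) ^ log_exponent"
  have c': "c' \<ge> 0" using c \<delta> by (simp add: c'_def)
  have large: "cmod (y i 0 N) \<le> c' * real N powr \<rho>'" if N: "N \<ge> 3" for N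
  proof -
    have "ln (real N) \<le> real N powr \<delta> / \<delta>" using N \<delta> by (intro ln_powr_bound) auto
    hence "ln (real N) ^ log_exponent \<le> (real N powr \<delta> / \<delta>) ^ log_exponent"
      using N by (intro power_mono) auto
    also have "\<dots> = (1 / \<delta>) ^ log_exponent * real N powr (\<delta> * real log_exponent)"
      using N by (simp add: power_divide powr_power mult.commute[of \<delta>])
    also have "\<dots> \<le> (1 / \<delta>) ^ log_exponent * real N powr (\<rho>' - \<rho>)"
      using N \<delta> by (intro mult_left_mono powr_mono) auto
    finally have l: "ln (real N) ^ log_exponent \<le> (1 / \<delta>) ^ log_exponent * real N powr (\<rho>' - \<rho>)" .
    have "cmod (y i 0 N) \<le> c * real N powr \<rho> * ln (real N) ^ log_exponent" by (rule c(2)[OF N])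
    also have "\<dots> \<le> c * real N powr \<rho> * ((1 / \<delta>) ^ log_exponent * real N powr (\<rho>' - \<rho>))"
      using c(1) l by (intro mult_left_mono) auto
    also have "\<dots> = c' * (real N powr \<rho> * real N powr (\<rho>' - \<rho>))" by (simp add: c'_def mult_ac)
    also have "real N powr \<rho> * real N powr (\<rho>' - \<rho>) = real N powr \<rho>'" by (simp add: powr_add[symmetric])
    finally show ?thesis .
  qed
  define c'' where "c'' = c' + cmod (y i 0 1) + cmod (y i 0 2) / 2 powr \<rho>'"
  have "cmod (y i 0 N) \<le> c'' * real N powr \<rho>'" if N: "N \<ge> 1" for N
  proof -
    consider "N = 1" | "N = 2" | "N \<ge> 3" using N by linarith
    thus ?thesis
    proof cases
      case 1
      thus ?thesis using c' by (simp add: c''_def)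
    next
      case 2
      have "cmod (y i 0 2) = cmod (y i 0 2) / 2 powr \<rho>' * 2 powr \<rho>'" by simp
      also have "\<dots> \<le> c'' * 2 powr \<rho>'" using c' by (intro mult_right_mono) (auto simp: c''_def)
      finally show ?thesis using 2 by simp
    next
      case 3
      have "c' * real N powr \<rho>' \<le> c'' * real N powr \<rho>'" by (intro mult_right_mono) (auto simp: c''_def)
      thus ?thesis using large[OF 3] by linarith
    qed
  qed
  moreover have "c'' \<ge> 0" using c' by (simp add: c''_def)
  ultimately show ?thesis by blast
qed

lemma Vsum_split: "Vsum N 0 = (\<Sum>i\<in>I. S 0 i * y i 0 N) + (\<Sum>i\<in>{..<d} - I. S 0 i * y i 0 N)"
proof -
  have "Vsum N 0 = (\<Sum>i<d. S 0 i * y i 0 N)" using d by (intro Vsum_coordinates) simp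
  also have "\<dots> = (\<Sum>i\<in>{..<d} - I. S 0 i * y i 0 N) + (\<Sum>i\<in>I. S 0 i * y i 0 N)"
    by (rule sum.subset_diff) auto
  finally show ?thesis by simp
qed

lemma weighted_sum_bound:
  fixes f :: "nat \<Rightarrow> 'a \<Rightarrow> complex"
  assumes "finite Q" "\<And>i. i \<in> Q \<Longrightarrow> \<exists>c\<ge>0. \<forall>N. P N \<longrightarrow> cmod (f i N) \<le> c * g N"
  shows "\<exists>c\<ge>0. \<forall>N. P N \<longrightarrow> cmod (\<Sum>i\<in>Q. w i * f i N) \<le> c * g N"
proof -
  obtain c where c: "\<And>i. i \<in> Q \<Longrightarrow> c i \<ge> 0" "\<And>i N. i \<in> Q \<Longrightarrow> P N \<Longrightarrow> cmod (f i N) \<le> c i * g N"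
    using assms(2) by metis
  show ?thesis
  proof (intro exI[of _ "\<Sum>i\<in>Q. cmod (w i) * c i"] conjI allI impI)
    show "(\<Sum>i\<in>Q. cmod (w i) * c i) \<ge> 0" using c(1) by (intro sum_nonneg) auto
    fix N assume N: "P N"
    have "cmod (\<Sum>i\<in>Q. w i * f i N) \<le> (\<Sum>i\<in>Q. cmod (w i) * (c i * g N))"
      using c(2) N by (intro sum_norm_le) (auto simp: norm_mult intro!: mult_left_mono)
    thus "cmod (\<Sum>i\<in>Q. w i * f i N) \<le> (\<Sum>i\<in>Q. cmod (w i) * c i) * g N"
      by (simp add: sum_distrib_right mult.assoc)
  qed
qed

text \<open>The first four properties give the expansion at integers and its regularity. The last
  one compares with the main term at real arguments, with the logarithm traded for a larger
  exponent; it is the input of the Mellin transform.\<close>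

theorem summatory_asymptotics:
  obtains \<Phi> where "\<And>lam k u. \<Phi> lam k (u + 1) = \<Phi> lam k u"
    "\<And>lam k \<alpha>. lam \<in> \<Lambda> \<Longrightarrow> 0 < \<alpha> \<Longrightarrow> \<alpha> < ln (cmod lam / R) / ln (real q) \<Longrightarrow> holder_continuous \<alpha> (\<Phi> lam k)"
    "\<exists>c. \<forall>N\<ge>3. cmod (Vsum N 0 - main_term \<Phi> (real N)) \<le> c * (real N powr \<rho> * ln (real N) ^ log_exponent)"
    "\<And>N. (\<forall>lam\<in>spectrum C. cmod lam > R) \<Longrightarrow> N \<ge> 1 \<Longrightarrow> Vsum N 0 = main_term \<Phi> (real N)"
    "\<And>\<rho>'. \<rho>' > \<rho> \<Longrightarrow> \<exists>c. \<forall>n\<ge>1. \<forall>t. real n \<le> t \<and> t \<le> real n + 1 \<longrightarrow>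
       cmod (Vsum (Suc n) 0 - main_term \<Phi> t) \<le> c * real n powr \<rho>'"
proof -
  obtain \<Phi> G where PG: "(\<forall>lam k u. \<Phi> lam k (u + 1) = \<Phi> lam k u) \<and>
     (\<forall>lam\<in>\<Lambda>. \<forall>k \<alpha>. 0 < \<alpha> \<and> \<alpha> < ln (cmod lam / R) / ln (real q) \<longrightarrow> holder_continuous \<alpha> (\<Phi> lam k)) \<and>
     (\<forall>t\<ge>1. main_term \<Phi> t = (\<Sum>i\<in>I. S 0 i * G i t)) \<and>
     (\<forall>i\<in>I. \<forall>N\<ge>1. G i (real N) = y i 0 N) \<and>
     (\<forall>i\<in>I. \<exists>c\<ge>0. \<forall>t\<ge>1. cmod (G i t - y i 0 (nat \<lfloor>t\<rfloor>)) \<le> c * t powr \<rho>)"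
    using expansion_exists by (elim exE) (rule that)
  have G: "\<And>lam k u. \<Phi> lam k (u + 1) = \<Phi> lam k u"
     "\<And>lam k \<alpha>. lam \<in> \<Lambda> \<Longrightarrow> 0 < \<alpha> \<Longrightarrow> \<alpha> < ln (cmod lam / R) / ln (real q) \<Longrightarrow> holder_continuous \<alpha> (\<Phi> lam k)"
     "\<And>t. t \<ge> 1 \<Longrightarrow> main_term \<Phi> t = (\<Sum>i\<in>I. S 0 i * G i t)"
     "\<And>i N. i \<in> I \<Longrightarrow> N \<ge> 1 \<Longrightarrow> G i (real N) = y i 0 N"
     "\<And>i. i \<in> I \<Longrightarrow> \<exists>c\<ge>0. \<forall>t\<ge>1. cmod (G i t - y i 0 (nat \<lfloor>t\<rfloor>)) \<le> c * t powr \<rho>"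
    using PG by blast+
  have mt: "main_term \<Phi> (real N) = (\<Sum>i\<in>I. S 0 i * y i 0 N)" if "N \<ge> 1" for N
    using that G(3)[of "real N"] G(4) by simp
  have diff: "Vsum N 0 - main_term \<Phi> (real N) = (\<Sum>i\<in>{..<d} - I. S 0 i * y i 0 N)" if "N \<ge> 1" for N
    unfolding Vsum_split mt[OF that] by simp
  show ?thesis
  proof (rule that[OF G(1,2)])
    have "\<exists>c\<ge>0. \<forall>N. 3 \<le> N \<longrightarrow> cmod (\<Sum>i\<in>{..<d} - I. S 0 i * y i 0 N) \<le> c * (real N powr \<rho> * ln (real N) ^ log_exponent)"
      by (rule weighted_sum_bound) (use small_coordinates_bound in \<open>auto simp: mult.assoc\<close>)
    thus "\<exists>c. \<forall>N\<ge>3. cmod (Vsum N 0 - main_term \<Phi> (real N)) \<le> c * (real N powr \<rho> * ln (real N) ^ log_exponent)"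
      by (auto simp: diff)
    show "Vsum N 0 = main_term \<Phi> (real N)" if "\<forall>lam\<in>spectrum C. cmod lam > R" "N \<ge> 1" for N
    proof -
      have "(\<Sum>i\<in>{..<d} - I. S 0 i * y i 0 N) = 0"
        by (rule sum.neutral) (use that(1) ev_spectrum in auto)
      thus ?thesis using diff[OF that(2)] by simp
    qed
    fix \<rho>' assume \<rho>': "\<rho>' > \<rho>"
    have "\<exists>c\<ge>0. \<forall>N. 1 \<le> N \<longrightarrow> cmod (\<Sum>i\<in>{..<d} - I. S 0 i * y i 0 N) \<le> c * real N powr \<rho>'"
      by (rule weighted_sum_bound) (use small_coordinates_powr_bound[OF _ _ \<rho>'] in auto)
    then obtain c1 where c1: "c1 \<ge> 0" "\<And>N. N \<ge> 1 \<Longrightarrow> cmod (Vsum N 0 - main_term \<Phi> (real N)) \<le> c1 * real N powr \<rho>'"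
      using diff by (metis (no_types, lifting))
    have "\<exists>c\<ge>0. \<forall>t. 1 \<le> t \<longrightarrow> cmod (\<Sum>i\<in>I. S 0 i * (G i t - y i 0 (nat \<lfloor>t\<rfloor>))) \<le> c * t powr \<rho>"
      by (rule weighted_sum_bound) (use G(5) in auto)
    then obtain c2 where c2: "c2 \<ge> 0" "\<And>t. t \<ge> 1 \<Longrightarrow> cmod (\<Sum>i\<in>I. S 0 i * (G i t - y i 0 (nat \<lfloor>t\<rfloor>))) \<le> c2 * t powr \<rho>" by blast
    obtain K where K: "K \<ge> 0" "\<And>n i. i < d \<Longrightarrow> cmod (v n $ i) \<le> K * real (max 1 n) powr \<rho>"
      using v_bound by blast
    define c where "c = c1 * 2 powr \<bar>\<rho>'\<bar> + c2 * 2 powr \<bar>\<rho>'\<bar> + c1 + K"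
    show "\<exists>c. \<forall>n\<ge>1. \<forall>t. real n \<le> t \<and> t \<le> real n + 1 \<longrightarrow>
       cmod (Vsum (Suc n) 0 - main_term \<Phi> t) \<le> c * real n powr \<rho>'"
    proof (intro exI[of _ c] allI impI)
      fix n :: nat and t :: real assume n: "n \<ge> 1" and t: "real n \<le> t \<and> t \<le> real n + 1"
      have p2: "s powr \<rho>' \<le> 2 powr \<bar>\<rho>'\<bar> * real n powr \<rho>'" if s: "real n \<le> s" "s \<le> real n + 1" for s
      proof (cases "\<rho>' \<ge> 0")
        case True
        have "s powr \<rho>' \<le> (2 * real n) powr \<rho>'" using s n True by (intro powr_mono2) auto
        thus ?thesis using True by (simp add: powr_mult)
      next
        case False
        have "s powr \<rho>' \<le> real n powr \<rho>'" using s n False by (intro powr_mono2') auto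
        also have "\<dots> \<le> 2 powr \<bar>\<rho>'\<bar> * real n powr \<rho>'"
          using mult_right_mono[OF ge_one_powr_ge_zero[of 2 "\<bar>\<rho>'\<bar>"], of "real n powr \<rho>'"] by simp
        finally show ?thesis .
      qed
      have np: "real n powr \<rho>' \<ge> 0" by simp
      show "cmod (Vsum (Suc n) 0 - main_term \<Phi> t) \<le> c * real n powr \<rho>'"
      \<comment> \<open>At the right endpoint the integer part has already jumped to
        \<open>n + 1\<close>, so the estimate at integers applies directly. Elsewhere it is
        \<open>n\<close>, and the sum up to \<open>Suc n\<close> differs by the single term
        \<open>v n\<close>.\<close>
      proof (cases "t = real (Suc n)")
        case True
        have "cmod (Vsum (Suc n) 0 - main_term \<Phi> t) \<le> c1 * t powr \<rho>'" unfolding True by (rule c1(2)) simp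
        also have "\<dots> \<le> c1 * (2 powr \<bar>\<rho>'\<bar> * real n powr \<rho>')" using p2[of t] t c1 by (intro mult_left_mono) auto
        also have "\<dots> \<le> c * real n powr \<rho>'" using c1 c2 K(1) by (simp add: c_def algebra_simps)
        finally show ?thesis .
      next
        case False
        hence fl: "nat \<lfloor>t\<rfloor> = n" using t by (simp add: floor_eq_iff nat_eq_iff)
        have t1: "t \<ge> 1" using t n by linarith
        have "Vsum (Suc n) 0 - main_term \<Phi> t = v n $ 0 + (Vsum n 0 - main_term \<Phi> (real n)) + (main_term \<Phi> (real n) - main_term \<Phi> t)"
          by (simp add: Vsum_def)
        moreover have "main_term \<Phi> (real n) - main_term \<Phi> t = - (\<Sum>i\<in>I. S 0 i * (G i t - y i 0 (nat \<lfloor>t\<rfloor>)))"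
          unfolding mt[OF n] G(3)[OF t1] fl by (simp add: right_diff_distrib sum_subtractf)
        ultimately have "cmod (Vsum (Suc n) 0 - main_term \<Phi> t) \<le> cmod (v n $ 0) + cmod (Vsum n 0 - main_term \<Phi> (real n)) +
            cmod (\<Sum>i\<in>I. S 0 i * (G i t - y i 0 (nat \<lfloor>t\<rfloor>)))"
          using norm_triangle_ineq[of "v n $ 0 + (Vsum n 0 - main_term \<Phi> (real n))" "- (\<Sum>i\<in>I. S 0 i * (G i t - y i 0 (nat \<lfloor>t\<rfloor>)))"]
            norm_triangle_ineq[of "v n $ 0" "Vsum n 0 - main_term \<Phi> (real n)"] by simp
        also have "\<dots> \<le> K * real n powr \<rho>' + c1 * real n powr \<rho>' + c2 * (2 powr \<bar>\<rho>'\<bar> * real n powr \<rho>')"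
        proof (intro add_mono c1(2) n)
          have "cmod (v n $ 0) \<le> K * real n powr \<rho>" using K(2)[of 0 n] d n by simp
          also have "\<dots> \<le> K * real n powr \<rho>'" using K(1) n \<rho>' by (intro mult_left_mono powr_mono) auto
          finally show "cmod (v n $ 0) \<le> K * real n powr \<rho>'" .
          have "cmod (\<Sum>i\<in>I. S 0 i * (G i t - y i 0 (nat \<lfloor>t\<rfloor>))) \<le> c2 * t powr \<rho>" by (rule c2(2)[OF t1])
          also have "\<dots> \<le> c2 * t powr \<rho>'" using c2(1) t1 \<rho>' by (intro mult_left_mono powr_mono) auto
          also have "\<dots> \<le> c2 * (2 powr \<bar>\<rho>'\<bar> * real n powr \<rho>')" using p2[of t] t c2(1) by (intro mult_left_mono) auto
          finally show "cmod (\<Sum>i\<in>I. S 0 i * (G i t - y i 0 (nat \<lfloor>t\<rfloor>))) \<le> c2 * (2 powr \<bar>\<rho>'\<bar> * real n powr \<rho>')" .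
        qed
        also have "\<dots> \<le> c * real n powr \<rho>'" using c1(1) by (simp add: c_def algebra_simps)
        finally show ?thesis .
      qed
    qed
  qed
qed

end

subsection \<open>Meromorphic continuation\<close>

context regular_sequence_jordan
begin

abbreviation "Dser j \<equiv> dirichlet_bound.D (\<lambda>n. v n $ j)"
abbreviation "shift_ser j r s \<equiv> (\<Sum>k. dirichlet_bound.shift_term (\<lambda>n. v n $ j) (of_nat r / of_nat q) k s)"
abbreviation "HP \<equiv> {s. Re s > \<rho>}"

lemma dirichlet_v:
  obtains K where "\<And>j. j < d \<Longrightarrow> dirichlet_bound (\<lambda>n. v n $ j) K \<rho>"
proof -
  obtain K where K: "K \<ge> 0" "\<And>n i. i < d \<Longrightarrow> cmod (v n $ i) \<le> K * real (max 1 n) powr \<rho>"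
    using v_bound by blast
  show ?thesis
  proof (rule that[of K])
    fix j assume "j < d"
    thus "dirichlet_bound (\<lambda>n. v n $ j) K \<rho>"
      using K(2)[of j] by unfold_locales (metis max_def_raw)
  qed
qed

lemma r_over_q: "r < q \<Longrightarrow> complex_of_nat r / of_nat q = of_real (real r / real q)"
  "r < q \<Longrightarrow> real r / real q < 1" "cmod (complex_of_nat r / of_nat q) = real r / real q"
  using q by (simp_all add: norm_divide)

text \<open>On \<open>Re s > \<rho>\<close> this involves the Dirichlet series only at points of
  absolute convergence. It is therefore available before any continuation has been
  constructed.\<close>

definition rhs :: "nat \<Rightarrow> complex \<Rightarrow> complex" where
  "rhs i s = (\<Sum>n\<in>{1..<q}. of_nat n powr (- s) * v n $ i) +
     of_nat q powr (- s) * (\<Sum>r<q. \<Sum>j<d. A r $$ (i, j) * shift_ser j r s)"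

lemma rhs_holomorphic: "rhs i holomorphic_on HP"
proof -
  have sh: "shift_ser j r holomorphic_on HP" if j: "j < d" and r: "r < q" for j r
  proof -
    obtain K where "dirichlet_bound (\<lambda>n. v n $ j) K \<rho>" using dirichlet_v j by blast
    then interpret dirichlet_bound "\<lambda>n. v n $ j" K \<rho> .
    show ?thesis by (rule shift_series_holomorphic) (use r_over_q(2)[OF r] r_over_q(3)[of r] in simp)
  qed
  show ?thesis unfolding rhs_def[abs_def]
    by (intro holomorphic_on_add holomorphic_on_mult holomorphic_on_sum holomorphic_on_const sh)
       (use q in \<open>auto intro!: holomorphic_intros\<close>)
qed

text \<open>The series is grouped into digit blocks. The first block is the finite sum in
  \<open>rhs\<close>; in the others \<open>(q * n + r) powr (- s)\<close> factors into
  \<open>q powr (- s)\<close> and \<open>(n + r / q) powr (- s)\<close>, and removing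
  \<open>n powr (- s)\<close> from the latter leaves the shift series.\<close>

lemma functional_equation:
  assumes s: "Re s > \<rho> + 1" and i: "i < d"
  shows "Dser i s - of_nat q powr (- s) * (\<Sum>j<d. C $$ (i, j) * Dser j s) = rhs i s"
proof -
  obtain K where K: "\<And>j. j < d \<Longrightarrow> dirichlet_bound (\<lambda>n. v n $ j) K \<rho>" using dirichlet_v by blast
  define Q where "Q = complex_of_nat q powr (- s)"
  define f where "f n = of_nat n powr (- s) * v n $ i" for n
  have f0: "f 0 = 0" by (simp add: f_def)
  have "(\<lambda>n. f (Suc n)) sums Dser i s"
    unfolding f_def dirichlet_bound.D_def[OF K[OF i]]
    by (intro summable_sums dirichlet_bound.dirichlet_summable[OF K[OF i] s])
  hence "f sums Dser i s" using sums_Suc_iff[of f "Dser i s"] f0 by simp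
  hence "(\<lambda>n. sum f {n * q..<n * q + q}) sums Dser i s" by (rule sums_group) (use q in simp)
  moreover have g0: "sum f {0 * q..<0 * q + q} = (\<Sum>n\<in>{1..<q}. f n)"
    using q f0 by (simp add: sum.atLeast_Suc_lessThan atLeast0LessThan[symmetric])
  ultimately have grp: "(\<lambda>n. sum f {Suc n * q..<Suc n * q + q}) sums (Dser i s - (\<Sum>n\<in>{1..<q}. f n))"
    by (subst sums_Suc_iff) simp
  have "(\<lambda>n. \<Sum>r<q. \<Sum>j<d. Q * A r $$ (i, j) * ((of_nat (Suc n) + of_real (real r / real q)) powr (- s) * v (Suc n) $ j)) sums
      (\<Sum>r<q. \<Sum>j<d. Q * A r $$ (i, j) * (shift_ser j r s + Dser j s))"
  proof (intro sums_sum sums_mult)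
    fix r j assume r: "r \<in> {..<q}" and "j \<in> {..<d}"
    hence j: "j < d" by simp
    have r': "r < q" using r by simp
    have "(\<lambda>n. ((of_nat (Suc n) + of_real (real r / real q)) powr (- s) - of_nat (Suc n) powr (- s)) * v (Suc n) $ j) sums
      (\<Sum>k. dirichlet_bound.shift_term (\<lambda>n. v n $ j) (of_real (real r / real q)) k s)"
      by (rule dirichlet_bound.shift_series_eq[OF K[OF j] _ _ s]) (use r_over_q(2)[OF r'] in auto)
    moreover have "(\<lambda>n. of_nat (Suc n) powr (- s) * v (Suc n) $ j) sums Dser j s"
      unfolding dirichlet_bound.D_def[OF K[OF j]]
      by (intro summable_sums dirichlet_bound.dirichlet_summable[OF K[OF j] s])
    ultimately have "(\<lambda>n. ((of_nat (Suc n) + of_real (real r / real q)) powr (- s) - of_nat (Suc n) powr (- s)) * v (Suc n) $ j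
        + of_nat (Suc n) powr (- s) * v (Suc n) $ j) sums (shift_ser j r s + Dser j s)"
      unfolding r_over_q(1)[OF r'] by (rule sums_add)
    thus "(\<lambda>n. (of_nat (Suc n) + of_real (real r / real q)) powr (- s) * v (Suc n) $ j) sums (shift_ser j r s + Dser j s)"
      by (simp add: left_diff_distrib del: of_nat_Suc of_real_divide)
  qed
  moreover have "(\<Sum>r<q. \<Sum>j<d. Q * A r $$ (i, j) * ((of_nat (Suc n) + of_real (real r / real q)) powr (- s) * v (Suc n) $ j)) =
      sum f {Suc n * q..<Suc n * q + q}" for n
  proof -
    have "sum f {Suc n * q..<Suc n * q + q} = (\<Sum>r<q. f (q * Suc n + r))"
      by (rule sum.reindex_bij_witness[of _ "\<lambda>r. q * Suc n + r" "\<lambda>m. m - q * Suc n"]) (auto simp: mult.commute)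
    also have "\<dots> = (\<Sum>r<q. \<Sum>j<d. Q * A r $$ (i, j) * ((of_nat (Suc n) + of_real (real r / real q)) powr (- s) * v (Suc n) $ j))"
    proof (rule sum.cong[OF refl])
      fix r assume "r \<in> {..<q}"
      hence r: "r < q" by simp
      have "of_nat (q * Suc n + r) = of_real (real q) * complex_of_real (real (Suc n) + real r / real q)"
        using q by (simp add: field_simps)
      hence "of_nat (q * Suc n + r) powr (- s) = of_real (real q) powr (- s) * complex_of_real (real (Suc n) + real r / real q) powr (- s)"
        by (simp only:) (rule powr_times_real, auto intro!: add_nonneg_nonneg simp del: of_nat_Suc of_real_add)
      hence p: "of_nat (q * Suc n + r) powr (- s) = Q * (of_nat (Suc n) + of_real (real r / real q)) powr (- s)"
        by (simp add: Q_def)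
      have "f (q * Suc n + r) = Q * (of_nat (Suc n) + of_real (real r / real q)) powr (- s) * (\<Sum>j<d. A r $$ (i, j) * v (Suc n) $ j)"
        unfolding f_def p v_entry[OF r i] ..
      thus "f (q * Suc n + r) = (\<Sum>j<d. Q * A r $$ (i, j) * ((of_nat (Suc n) + of_real (real r / real q)) powr (- s) * v (Suc n) $ j))"
        by (simp only: sum_distrib_left mult_ac)
    qed
    finally show ?thesis ..
  qed
  ultimately have "Dser i s - (\<Sum>n\<in>{1..<q}. f n) = (\<Sum>r<q. \<Sum>j<d. Q * A r $$ (i, j) * (shift_ser j r s + Dser j s))"
    using sums_unique2[OF grp] by simp
  also have "\<dots> = Q * (\<Sum>r<q. \<Sum>j<d. A r $$ (i, j) * shift_ser j r s) + Q * (\<Sum>r<q. \<Sum>j<d. A r $$ (i, j) * Dser j s)"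
    by (simp add: sum_distrib_left distrib_left sum.distrib mult.assoc)
  also have "(\<Sum>r<q. \<Sum>j<d. A r $$ (i, j) * Dser j s) = (\<Sum>j<d. C $$ (i, j) * Dser j s)"
    by (subst sum.swap) (simp add: C_entry[OF i] sum_distrib_right)
  finally show ?thesis unfolding rhs_def f_def Q_def by (simp add: algebra_simps)
qed

definition pole_points :: "complex set" where
  "pole_points = {s. of_nat q powr s \<in> spectrum C}"

lemma q_powr: "complex_of_nat q powr s = exp (s * of_real (ln (real q)))"
  using q by (simp add: powr_def Ln_of_nat)

lemma q_powr_minus: "complex_of_nat q powr (- s) = 1 / of_nat q powr s"
  by (simp add: powr_minus inverse_eq_divide)

lemma pole_points_props: "closed pole_points" "countable pole_points"
proof -
  have "closed ((\<lambda>s. exp (s * of_real (ln (real q)))) -` spectrum C)"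
    by (intro closed_vimage finite_imp_closed finite_spectrum continuous_intros)
  thus "closed pole_points" by (simp add: pole_points_def vimage_def q_powr)
  have "pole_points = (\<Union>w\<in>spectrum C. {s. exp (s * of_real (ln (real q))) = w})"
    by (auto simp: pole_points_def q_powr)
  moreover have "countable \<dots>"
    using q by (intro countable_UN countable_exp_level countable_finite finite_spectrum) auto
  ultimately show "countable pole_points" by simp
qed

lemma denominator_nonzero:
  assumes "s \<notin> pole_points" "i < d"
  shows "1 - of_nat q powr (- s) * ev i \<noteq> 0"
proof
  assume "1 - of_nat q powr (- s) * ev i = 0"
  hence "of_nat q powr s = ev i" using q by (simp add: q_powr_minus)
  thus False using assms ev_spectrum by (simp add: pole_points_def)
qed

text \<open>By \<open>spectrum_bound\<close>, an eigenvalue of the form \<open>q powr s\<close> has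
  modulus at most \<open>q * R = q powr (\<rho> + 1)\<close>.\<close>

lemma pole_points_bound:
  assumes "Re s > \<rho> + 1"
  shows "s \<notin> pole_points"
proof
  assume "s \<in> pole_points"
  hence "cmod (of_nat q powr s) \<le> real q * R" using spectrum_bound by (simp add: pole_points_def)
  also have "cmod (of_nat q powr s) = real q powr Re s" by (simp add: norm_powr_real_powr)
  also have "real q * R = real q powr (\<rho> + 1)"
  proof -
    have "real q powr \<rho> = R" using q Rpos by (simp add: powr_def)
    thus ?thesis using q by (simp add: powr_add)
  qed
  finally show False using assms q by simp
qed

definition jordan_rhs :: "nat \<Rightarrow> complex \<Rightarrow> complex" where
  "jordan_rhs m s = (\<Sum>j<d. T m j * rhs j s)"

text \<open>With \<open>Q = q powr (- s)\<close> and \<open>N\<close> the nilpotent part of a block,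
  the inverse of \<open>I - Q J\<close> is the finite Neumann series of
  \<open>Q ^ p * N ^ p / (1 - Q * ev m) ^ Suc p\<close>; this is row \<open>m\<close> of that
  inverse applied to the right side.\<close>

definition jordan_sol :: "nat \<Rightarrow> complex \<Rightarrow> complex" where
  "jordan_sol m s = (\<Sum>p<b m. (of_nat q powr (- s)) ^ p * jordan_rhs (m + p) s / (1 - of_nat q powr (- s) * ev m) ^ Suc p)"

definition U :: "nat \<Rightarrow> complex \<Rightarrow> complex" where
  "U i s = (\<Sum>k<d. S i k * jordan_sol k s)"

text \<open>A candidate point where the formula for \<open>U\<close> happens to have no pole
  receives its limit as value. Without this, the absence of a pole would not imply
  analyticity.\<close>

definition W :: "nat \<Rightarrow> complex \<Rightarrow> complex" where
  "W i = remove_sings (U i)"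

lemma jordan_sol_eq:
  assumes m: "m < d" and nz: "1 - of_nat q powr (- s) * ev m \<noteq> 0"
  shows "jordan_sol m s * (1 - of_nat q powr (- s) * ev m) =
    jordan_rhs m s + (if 1 < b m then of_nat q powr (- s) * jordan_sol (Suc m) s else 0)"
proof -
  define Q where "Q = complex_of_nat q powr (- s)"
  define D where "D = 1 - Q * ev m"
  have D: "D \<noteq> 0" using nz by (simp add: D_def Q_def)
  obtain n where n: "b m = Suc n" using b(1)[OF m] by (cases "b m") auto
  have "jordan_sol m s * D = (\<Sum>p<Suc n. Q ^ p * jordan_rhs (m + p) s / D ^ Suc p * D)"
    by (simp only: jordan_sol_def n Q_def[symmetric] D_def[symmetric] sum_distrib_right)
  also have "\<dots> = (\<Sum>p<Suc n. Q ^ p * jordan_rhs (m + p) s / D ^ p)"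
    using D by (intro sum.cong refl) simp
  also have "\<dots> = jordan_rhs m s + (\<Sum>p<n. Q ^ Suc p * jordan_rhs (m + Suc p) s / D ^ Suc p)"
    by (subst sum.lessThan_Suc_shift) simp
  also have "(\<Sum>p<n. Q ^ Suc p * jordan_rhs (m + Suc p) s / D ^ Suc p) = (if 1 < b m then Q * jordan_sol (Suc m) s else 0)"
  proof (cases "1 < b m")
    case True
    have c: "ev (Suc m) = ev m" "b (Suc m) = n" using chain[OF m True] n by auto
    have "Q * jordan_sol (Suc m) s = (\<Sum>p<n. Q * (Q ^ p * jordan_rhs (Suc m + p) s / D ^ Suc p))"
      by (simp only: jordan_sol_def c Q_def[symmetric] D_def[symmetric] sum_distrib_left)
    thus ?thesis using True by (simp add: mult_ac)
  qed (use n in simp)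
  finally show ?thesis by (simp add: D_def Q_def)
qed

lemma T_combination:
  assumes "m < d"
  shows "(\<Sum>i<d. T m i * (\<Sum>k<d. S i k * z k)) = z m"
proof -
  have "(\<Sum>i<d. T m i * (\<Sum>k<d. S i k * z k)) = (\<Sum>k<d. (\<Sum>i<d. T m i * S i k) * z k)"
    by (simp add: sum_distrib_left sum_distrib_right mult.assoc) (rule sum.swap)
  also have "\<dots> = (\<Sum>k<d. if k = m then z k else 0)" using assms by (intro sum.cong refl) (auto simp: TS)
  finally show ?thesis using assms by simp
qed

lemma T_injective:
  assumes "\<And>m. m < d \<Longrightarrow> (\<Sum>i<d. T m i * f i) = (\<Sum>i<d. T m i * g i)" "i < d"
  shows "f i = g i"
proof -
  have r: "f i = (\<Sum>k<d. S i k * (\<Sum>j<d. T k j * f j))" for f :: "nat \<Rightarrow> complex"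
  proof -
    have "(\<Sum>k<d. S i k * (\<Sum>j<d. T k j * f j)) = (\<Sum>j<d. (\<Sum>k<d. S i k * T k j) * f j)"
      by (simp add: sum_distrib_left sum_distrib_right mult.assoc) (rule sum.swap)
    also have "\<dots> = (\<Sum>j<d. if j = i then f j else 0)" using assms(2) by (intro sum.cong refl) (auto simp: ST)
    finally show ?thesis using assms(2) by simp
  qed
  show ?thesis unfolding r[of f] r[of g] using assms(1) by simp
qed

text \<open>In Jordan coordinates \<open>I - Q C\<close> couples a row only to the next one, so
  equations can be solved from the end of each block backwards.\<close>

lemma T_operator:
  assumes m: "m < d"
  shows "(\<Sum>i<d. T m i * (f i - Q * (\<Sum>j<d. C $$ (i, j) * f j))) =
    (\<Sum>j<d. T m j * f j) - Q * (ev m * (\<Sum>j<d. T m j * f j) + (if 1 < b m then \<Sum>j<d. T (Suc m) j * f j else 0))"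
proof -
  have "(\<Sum>i<d. T m i * (f i - Q * (\<Sum>j<d. C $$ (i, j) * f j))) =
      (\<Sum>i<d. T m i * f i) - Q * (\<Sum>i<d. T m i * (\<Sum>j<d. C $$ (i, j) * f j))"
    by (simp add: right_diff_distrib sum_subtractf sum_distrib_left mult_ac)
  also have "(\<Sum>i<d. T m i * (\<Sum>j<d. C $$ (i, j) * f j)) = (\<Sum>j<d. (\<Sum>i<d. T m i * C $$ (i, j)) * f j)"
    by (simp add: sum_distrib_left sum_distrib_right mult.assoc) (rule sum.swap)
  also have "\<dots> = (\<Sum>j<d. ev m * (T m j * f j) + (if 1 < b m then T (Suc m) j * f j else 0))"
    using m by (intro sum.cong refl) (simp add: TC algebra_simps)
  also have "\<dots> = ev m * (\<Sum>j<d. T m j * f j) + (if 1 < b m then \<Sum>j<d. T (Suc m) j * f j else 0)"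
    by (simp add: sum.distrib sum_distrib_left)
  finally show ?thesis .
qed

lemma Suc_in_block: "m < d \<Longrightarrow> 1 < b m \<Longrightarrow> Suc m < d"
  using b(2)[of m] by linarith

lemma U_equation:
  assumes s: "s \<notin> pole_points" and i: "i < d"
  shows "U i s - of_nat q powr (- s) * (\<Sum>j<d. C $$ (i, j) * U j s) = rhs i s"
proof (rule T_injective[OF _ i])
  fix m assume m: "m < d"
  have TU: "(\<Sum>j<d. T k j * U j s) = jordan_sol k s" if "k < d" for k
    unfolding U_def using that by (rule T_combination)
  have "(\<Sum>i<d. T m i * (U i s - of_nat q powr (- s) * (\<Sum>j<d. C $$ (i, j) * U j s))) =
     jordan_sol m s - of_nat q powr (- s) * (ev m * jordan_sol m s + (if 1 < b m then jordan_sol (Suc m) s else 0))"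
    unfolding T_operator[OF m] using TU m Suc_in_block[OF m] by simp
  also have "\<dots> = jordan_rhs m s"
    using jordan_sol_eq[OF m denominator_nonzero[OF s m]] by (simp add: algebra_simps split: if_splits)
  finally show "(\<Sum>i<d. T m i * (U i s - of_nat q powr (- s) * (\<Sum>j<d. C $$ (i, j) * U j s))) = (\<Sum>i<d. T m i * rhs i s)"
    by (simp add: jordan_rhs_def)
qed

text \<open>Both sides solve the same linear system. In the half-plane of convergence there are no
  candidate poles, so the solution is unique; the coordinates are compared by induction from the
  last row of a block.\<close>

lemma U_eq_Dser:
  assumes s: "Re s > \<rho> + 1" and i: "i < d"
  shows "U i s = Dser i s"
proof (rule T_injective[OF _ i])
  have sp: "s \<notin> pole_points" by (rule pole_points_bound[OF s])
  define z where "z m = (\<Sum>j<d. T m j * Dser j s)" for m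
  have z: "z m * (1 - of_nat q powr (- s) * ev m) = jordan_rhs m s + (if 1 < b m then of_nat q powr (- s) * z (Suc m) else 0)"
    if m: "m < d" for m
  proof -
    have "jordan_rhs m s = (\<Sum>i<d. T m i * (Dser i s - of_nat q powr (- s) * (\<Sum>j<d. C $$ (i, j) * Dser j s)))"
      unfolding jordan_rhs_def by (intro sum.cong refl) (simp add: functional_equation[OF s])
    also have "\<dots> = z m - of_nat q powr (- s) * (ev m * z m + (if 1 < b m then z (Suc m) else 0))"
      unfolding T_operator[OF m] z_def ..
    finally show ?thesis by (cases "1 < b m") (simp_all add: algebra_simps)
  qed
  have eq: "z m = jordan_sol m s" if "m < d" for m
    using that
  proof (induction "b m" arbitrary: m rule: less_induct)
    case less
    note nz = denominator_nonzero[OF sp less.prems]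
    have nxt: "z (Suc m) = jordan_sol (Suc m) s" if "1 < b m"
      using chain[OF less.prems that] that Suc_in_block[OF less.prems that] by (intro less.hyps) auto
    have "z m * (1 - of_nat q powr (- s) * ev m) = jordan_sol m s * (1 - of_nat q powr (- s) * ev m)"
      unfolding z[OF less.prems] jordan_sol_eq[OF less.prems nz] using nxt by simp
    thus ?case using nz by simp
  qed
  fix m assume m: "m < d"
  have "(\<Sum>i<d. T m i * U i s) = jordan_sol m s" unfolding U_def using m by (rule T_combination)
  thus "(\<Sum>i<d. T m i * U i s) = (\<Sum>i<d. T m i * Dser i s)" using eq[OF m] by (simp add: z_def)
qed

lemma jordan_rhs_holomorphic: "jordan_rhs m holomorphic_on HP"
  unfolding jordan_rhs_def[abs_def] by (intro holomorphic_intros rhs_holomorphic)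

lemma open_HP: "open HP" by (rule open_halfspace_Re_gt)

lemma U_holomorphic: "U i holomorphic_on HP - pole_points"
proof -
  have "jordan_sol k holomorphic_on HP - pole_points" if k: "k < d" for k
    unfolding jordan_sol_def[abs_def]
  proof (intro holomorphic_on_sum holomorphic_on_divide holomorphic_on_mult holomorphic_on_power)
    show "(\<lambda>s. of_nat q powr (- s)) holomorphic_on HP - pole_points" using q by (intro holomorphic_intros) auto
    show "jordan_rhs (k + p) holomorphic_on HP - pole_points" for p
      by (rule holomorphic_on_subset[OF jordan_rhs_holomorphic]) auto
    show "(\<lambda>s. 1 - of_nat q powr (- s) * ev k) holomorphic_on HP - pole_points" using q by (intro holomorphic_intros) auto
    show "(1 - of_nat q powr (- s) * ev k) ^ Suc p \<noteq> 0" if "s \<in> HP - pole_points" for s p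
      using denominator_nonzero[of s k] that k by simp
  qed
  thus ?thesis unfolding U_def[abs_def] by (intro holomorphic_on_sum holomorphic_on_mult holomorphic_on_const) auto
qed

lemma U_meromorphic: "U i meromorphic_on HP"
proof -
  have mq: "(\<lambda>s. of_nat q powr (- s)) meromorphic_on HP"
    using q open_HP by (intro analytic_on_imp_meromorphic_on analytic_on_open[THEN iffD2] holomorphic_intros) auto
  have mr: "jordan_rhs k meromorphic_on HP" for k
    using open_HP jordan_rhs_holomorphic by (intro analytic_on_imp_meromorphic_on) (simp add: analytic_on_open)
  show ?thesis unfolding U_def[abs_def] jordan_sol_def
    by (intro meromorphic_intros mq mr)
qed

lemma W_eq_U:
  assumes "s \<in> HP - pole_points"
  shows "W i s = U i s" "W i analytic_on {s}"
proof -
  have "open (HP - pole_points)" using open_HP pole_points_props(1) by (rule open_Diff)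
  hence "U i analytic_on {s}"
    using assms U_holomorphic analytic_at by blast
  thus "W i s = U i s" "W i analytic_on {s}"
    unfolding W_def by (simp_all add: remove_sings_analytic_on)
qed

lemma W_holomorphic: "W i holomorphic_on HP - pole_points"
  using U_holomorphic by (rule holomorphic_transform) (simp add: W_eq_U)

lemma W_eq_Dser: "Re s > \<rho> + 1 \<Longrightarrow> i < d \<Longrightarrow> W i s = Dser i s"
  using W_eq_U(1)[of s i] U_eq_Dser[of s i] pole_points_bound[of s] by simp

lemma W_meromorphic: "W i meromorphic_on HP"
  unfolding W_def by (intro remove_sings_meromorphic U_meromorphic)

lemma W_analytic: "s \<in> HP \<Longrightarrow> \<not> is_pole (W i) s \<Longrightarrow> W i analytic_on {s}"
  using nicely_meromorphic_on_imp_analytic_at[OF remove_sings_nicely_meromorphic[OF U_meromorphic]]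
  unfolding W_def by blast

lemma W_pole: "s \<in> HP \<Longrightarrow> is_pole (W i) s \<Longrightarrow> of_nat q powr s \<in> spectrum C"
  using W_eq_U(2)[of s i] analytic_at_imp_no_pole[of "W i" s] by (auto simp: pole_points_def)

text \<open>Off the countable set of candidate poles the equation holds by construction, and it extends by continuity.\<close>
lemma W_equation:
  assumes s: "s \<in> HP" and np: "\<And>j. j < d \<Longrightarrow> \<not> is_pole (W j) s" and i: "i < d"
  shows "W i s - of_nat q powr (- s) * (\<Sum>j<d. C $$ (i, j) * W j s) = rhs i s"
proof (rule ccontr)
  define E where "E w = W i w - of_nat q powr (- w) * (\<Sum>j<d. C $$ (i, j) * W j w) - rhs i w" for w
  assume "W i s - of_nat q powr (- s) * (\<Sum>j<d. C $$ (i, j) * W j s) \<noteq> rhs i s"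
  hence Es: "E s \<noteq> 0" by (simp add: E_def)
  have cW: "isCont (W j) s" if "j < d" for j
    using W_analytic[OF s np[OF that]] by (rule analytic_at_imp_isCont)
  have cr: "isCont (rhs i) s"
    using rhs_holomorphic open_HP s by (meson continuous_on_eq_continuous_at holomorphic_on_imp_continuous_on)
  have cq: "isCont (\<lambda>w. of_nat q powr (- w)) s" unfolding q_powr by (intro continuous_intros)
  have "isCont E s" unfolding E_def using i by (intro continuous_intros cW cr cq) auto
  hence "E \<midarrow>s\<rightarrow> E s" by (simp add: isCont_def)
  hence "eventually (\<lambda>w. E w \<noteq> 0) (at s)" using Es by (rule tendsto_imp_eventually_ne)
  then obtain e1 where e1: "e1 > 0" "\<And>w. w \<noteq> s \<Longrightarrow> dist w s < e1 \<Longrightarrow> E w \<noteq> 0" unfolding eventually_at by auto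
  obtain e2 where e2: "e2 > 0" "ball s e2 \<subseteq> HP" using open_HP s open_contains_ball by blast
  have "ball s (min e1 e2) \<subseteq> pole_points \<union> {s}"
  proof
    fix w assume w: "w \<in> ball s (min e1 e2)"
    show "w \<in> pole_points \<union> {s}"
    proof (rule ccontr)
      assume nw: "w \<notin> pole_points \<union> {s}"
      have "w \<in> HP - pole_points" using w e2 nw by auto
      hence "E w = 0" using U_equation[of w i] i nw by (simp add: E_def W_eq_U(1))
      thus False using e1(2)[of w] nw w by (simp add: dist_commute)
    qed
  qed
  moreover have "countable (pole_points \<union> {s})" using pole_points_props(2) by simp
  ultimately have "countable (ball s (min e1 e2))" by (rule countable_subset)
  moreover have "uncountable (ball s (min e1 e2))" by (rule uncountable_ball) (use e1 e2 in simp)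
  ultimately show False by blast
qed

end

subsection \<open>Fourier coefficients as residues\<close>

context regular_sequence_jordan
begin

lemma R_exponent_less:
  assumes "lam \<in> \<Lambda>"
  shows "\<rho> < ln (cmod lam) / ln (real q)"
proof -
  have "ln R < ln (cmod lam)" using assms Rpos by (subst ln_less_cancel_iff) auto
  thus ?thesis using q by (intro divide_strict_right_mono) auto
qed

text \<open>Two facts are joined: the Hoelder property makes the Fourier series converge pointwise,
  and its coefficients are the residues by \<open>residue_eq_fourier_coeff\<close>.\<close>

lemma fourier_expansion:
  fixes \<Phi> :: "complex \<Rightarrow> nat \<Rightarrow> real \<Rightarrow> complex"
  assumes per: "\<And>lam k u. \<Phi> lam k (u + 1) = \<Phi> lam k u"
    and hol: "\<And>lam k \<alpha>. lam \<in> \<Lambda> \<Longrightarrow> 0 < \<alpha> \<Longrightarrow> \<alpha> < ln (cmod lam / R) / ln (real q) \<Longrightarrow> holder_continuous \<alpha> (\<Phi> lam k)"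
    and cont: "\<And>lam k. lam \<in> \<Lambda> \<Longrightarrow> continuous_on UNIV (\<Phi> lam k)"
    and approx: "\<And>\<rho>'. \<rho>' > \<rho> \<Longrightarrow> \<exists>c. \<forall>n\<ge>1. \<forall>t. real n \<le> t \<and> t \<le> real n + 1 \<longrightarrow>
       cmod (Vsum (Suc n) 0 - main_term \<Phi> t) \<le> c * real n powr \<rho>'"
    and lam: "lam \<in> \<Lambda>" and k: "k < max_jordan_block C lam"
  shows "(\<lambda>L. \<Sum>l\<in>{- int L..int L}.
     (of_real (ln (real q)) ^ k / fact k *
        residue (\<lambda>s. (v 0 $ 0 + W 0 s) * (s - (Ln lam / of_real (ln (real q)) + 2 * of_int l * of_real pi * \<i> / of_real (ln (real q)))) ^ k / s)
          (Ln lam / of_real (ln (real q)) + 2 * of_int l * of_real pi * \<i> / of_real (ln (real q)))) *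
     exp (2 * of_int l * of_real pi * \<i> * of_real u)) \<longlonglongrightarrow> \<Phi> lam k u"
proof -
  \<comment> \<open>Above \<open>\<rho>\<close> the error is a pure power; below
    \<open>log_q (cmod lam)\<close> the points carrying the residues lie inside the half-plane where
    its Mellin transform is holomorphic.\<close>
  obtain \<rho>' where \<rho>': "\<rho> < \<rho>'" "\<rho>' < ln (cmod lam) / ln (real q)"
    using dense[OF R_exponent_less[OF lam]] by blast
  obtain c where c: "\<And>n t. n \<ge> 1 \<Longrightarrow> real n \<le> t \<and> t \<le> real n + 1 \<Longrightarrow>
       cmod (Vsum (Suc n) 0 - main_term \<Phi> t) \<le> c * real n powr \<rho>'"
    using approx[OF \<rho>'(1)] by blast
  obtain K where K: "\<And>j. j < d \<Longrightarrow> dirichlet_bound (\<lambda>n. v n $ j) K \<rho>" using dirichlet_v by blast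
  have d0: "0 < d" using d by simp
  interpret se: summatory_expansion "\<lambda>n. v n $ 0" K \<rho> q \<Lambda> "max_jordan_block C" \<Phi> \<rho>' c "main_term \<Phi>"
  proof (intro summatory_expansion.intro summatory_expansion_axioms.intro)
    show "dirichlet_bound (\<lambda>n. v n $ 0) K \<rho>" by (rule K[OF d0])
    show "2 \<le> q" "finite \<Lambda>" "0 \<notin> \<Lambda>" using q finite_spectrum Rpos by auto
    show "main_term \<Phi> t = (\<Sum>lam\<in>\<Lambda>. exp (of_real (ln t / ln (real q)) * Ln lam) *
        (\<Sum>k<max_jordan_block C lam. of_real (ln t / ln (real q)) ^ k * \<Phi> lam k (ln t / ln (real q))))" for t
      by (simp add: main_term_def lg_def)
    show "cmod ((\<Sum>j<Suc n. v j $ 0) - main_term \<Phi> t) \<le> c * real n powr \<rho>'" if "1 \<le> n" "real n \<le> t" "t \<le> real n + 1" for n t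
      using c[of n t] that by (simp add: Vsum_def)
  qed (use per cont in auto)
  have ps: "se.pole_set (spectrum C) = pole_points" by (simp add: se.pole_set_def pole_points_def q_powr)
  have lnlam: "ln (cmod lam) > \<rho>' * ln (real q)" using \<rho>'(2) q by (simp add: less_divide_eq)
  have res: "of_real (ln (real q)) ^ k / fact k *
      residue (\<lambda>s. (v 0 $ 0 + W 0 s) * (s - (Ln lam / of_real (ln (real q)) + 2 * of_int l * of_real pi * \<i> / of_real (ln (real q)))) ^ k / s)
          (Ln lam / of_real (ln (real q)) + 2 * of_int l * of_real pi * \<i> / of_real (ln (real q)))
     = integral {0..1} (\<lambda>u. \<Phi> lam k u * exp (- (2 * of_int l * of_real pi * \<i>) * of_real u))" for l :: int
  proof (rule se.residue_eq_fourier_coeff[OF finite_spectrum _ _ _ lam lnlam k refl])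
    show "\<Lambda> \<subseteq> spectrum C" by auto
    show "W 0 s = Dser 0 s" if "\<rho> + 1 < Re s" for s using that d0 by (rule W_eq_Dser)
    show "W 0 holomorphic_on {s. \<rho>' < Re s} - se.pole_set (spectrum C)"
      unfolding ps by (rule holomorphic_on_subset[OF W_holomorphic]) (use \<rho>'(1) in auto)
  qed
  define \<alpha> where "\<alpha> = ln (cmod lam / R) / ln (real q) / 2"
  have \<alpha>: "0 < \<alpha>" "\<alpha> < ln (cmod lam / R) / ln (real q)"
    using holder_exponent_le_1(1)[of lam] lam by (auto simp: \<alpha>_def)
  have "(\<lambda>L. \<Sum>l\<in>{- int L..int L}. integral {0..1} (\<lambda>x. \<Phi> lam k x * cis2pi (- of_int l * x)) * cis2pi (of_int l * u)) \<longlonglongrightarrow> \<Phi> lam k u"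
    by (rule fourier_series_holder[OF hol[OF lam \<alpha>] \<alpha>(1) per cont[OF lam]])
  moreover have "(\<lambda>x. \<Phi> lam k x * cis2pi (- of_int l * x)) = (\<lambda>u. \<Phi> lam k u * exp (- (2 * of_int l * of_real pi * \<i>) * of_real u))" for l
    by (simp add: fun_eq_iff mult_ac)
  moreover have "cis2pi (of_int l * u) = exp (2 * of_int l * of_real pi * \<i> * of_real u)" for l
    by (simp add: mult_ac)
  ultimately show ?thesis unfolding res by simp
qed

lemma main_term_nat:
  assumes per: "\<And>lam k u. \<Phi> lam k (u + 1) = \<Phi> lam k u" and N: "N \<ge> 1"
  shows "(\<Sum>lam\<in>\<Lambda>. of_nat N powr (Ln lam / of_real (ln (real q))) *
      (\<Sum>k<max_jordan_block C lam. of_real (ln (real N) / ln (real q)) ^ k * \<Phi> lam k (frac (ln (real N) / ln (real q)))))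
    = main_term \<Phi> (real N)"
proof -
  have "\<Phi> lam k (frac u) = \<Phi> lam k u" for lam k u
    using periodic_int_shift[of "\<Phi> lam k" "frac u" "\<lfloor>u\<rfloor>"] per by (simp add: frac_def)
  moreover have "of_nat N powr (Ln lam / of_real (ln (real q))) = exp (of_real (ln (real N) / ln (real q)) * Ln lam)" for lam
    using N by (simp add: powr_def Ln_of_nat mult.commute)
  ultimately show ?thesis by (simp add: main_term_def lg_def)
qed

end

section \<open>From the induced matrix norm to the four claims\<close>

lemma regular_sequence_from_norm:
  assumes "q \<ge> 2" "d \<ge> 1" "\<And>r. r < q \<Longrightarrow> A r \<in> carrier_mat d d" "\<And>n. v n \<in> carrier_vec d"
    "\<And>r n. r < q \<Longrightarrow> v (q * n + r) = A r *\<^sub>v v n" "R > 0" and nv: "is_vec_norm d nv"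
    and growth: "\<exists>K. \<forall>rs. set rs \<subseteq> {..<q} \<longrightarrow> induced_mat_norm d nv (mat_word_prod d A rs) \<le> K * R ^ length rs"
  shows "regular_sequence q d A v R (mat d d (\<lambda>(i, j). \<Sum>r<q. A r $$ (i, j)))"
proof
  obtain c where c: "c > 0" "\<And>(M :: complex mat) i j. M \<in> carrier_mat d d \<Longrightarrow> i < d \<Longrightarrow> j < d \<Longrightarrow>
     cmod (M $$ (i, j)) \<le> c * induced_mat_norm d nv M"
    using entry_le_induced_norm[OF nv] by blast
  obtain K where K: "\<And>rs. set rs \<subseteq> {..<q} \<Longrightarrow> induced_mat_norm d nv (mat_word_prod d A rs) \<le> K * R ^ length rs"
    using growth by blast
  have carrier: "mat_word_prod d A rs \<in> carrier_mat d d" if "set rs \<subseteq> {..<q}" for rs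
    by (rule mat_word_prod_carrier[of q]) (use assms(3) that in auto)
  have "cmod (mat_word_prod d A rs $$ (i, j)) \<le> c * K * R ^ length rs"
    if "set rs \<subseteq> {..<q}" "i < d" "j < d" for rs i j
  proof -
    have "cmod (mat_word_prod d A rs $$ (i, j)) \<le> c * induced_mat_norm d nv (mat_word_prod d A rs)"
      by (rule c(2)[OF carrier]) fact+
    also have "\<dots> \<le> c * (K * R ^ length rs)" using c(1) K[OF that(1)] by (intro mult_left_mono) auto
    finally show ?thesis by (simp add: mult.assoc)
  qed
  thus "\<exists>K. \<forall>rs i j. set rs \<subseteq> {..<q} \<longrightarrow> i < d \<longrightarrow> j < d \<longrightarrow>
        cmod (mat_word_prod d A rs $$ (i, j)) \<le> K * R ^ length rs" by blast
qed (fact assms refl)+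

theorem theorem1p3:
  fixes q d :: nat and A :: "nat \<Rightarrow> complex mat" and v :: "nat \<Rightarrow> complex vec"
    and nv :: "complex vec \<Rightarrow> real" and R :: real
  defines "X \<equiv> (\<lambda>N. \<Sum>n<N. v n $ 0)"
    and "C \<equiv> mat d d (\<lambda>(i, j). \<Sum>r<q. A r $$ (i, j))"
    and "Vser \<equiv> (\<lambda>i s. \<Sum>n. of_nat (Suc n) powr (- s) * v (Suc n) $ i)"
    and "H \<equiv> {s. Re s > ln R / ln q}"
  assumes q: "q \<ge> 2" and d: "d \<ge> 1"
    and A: "\<And>r. r < q \<Longrightarrow> A r \<in> carrier_mat d d"
    and vdim: "\<And>n. v n \<in> carrier_vec d"
    and vrec: "\<And>r n. r < q \<Longrightarrow> v (q * n + r) = A r *\<^sub>v v n"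
    and nv: "is_vec_norm d nv"
    and Rpos: "R > 0"
    and growth: "\<exists>K. \<forall>rs. set rs \<subseteq> {..<q} \<longrightarrow>
                   induced_mat_norm d nv (mat_word_prod d A rs) \<le> K * R ^ length rs"
  shows "\<exists>(\<Phi> :: complex \<Rightarrow> nat \<Rightarrow> real \<Rightarrow> complex) (W :: nat \<Rightarrow> complex \<Rightarrow> complex).
     \<comment> \<open>(1)\<close>
     (\<forall>lam\<in>spectrum C. \<forall>k<max_jordan_block C lam. cmod lam > R \<longrightarrow>
        (\<forall>u. \<Phi> lam k (u + 1) = \<Phi> lam k u) \<and> continuous_on UNIV (\<Phi> lam k)) \<and>
     (\<lambda>N. X N - (\<Sum>lam\<in>{lam\<in>spectrum C. cmod lam > R}.
          of_nat N powr (Ln lam / ln q) *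
          (\<Sum>k<max_jordan_block C lam. of_real (ln (real N) / ln q) ^ k * \<Phi> lam k (frac (ln (real N) / ln q)))))
       \<in> O(\<lambda>N. of_real (real N powr (ln R / ln q) *
              ln (real N) ^ Max (insert 0 (max_jordan_block C ` {lam\<in>spectrum C. cmod lam = R})))) \<and>
     ((\<forall>lam\<in>spectrum C. cmod lam > R) \<longrightarrow>
        (\<forall>N\<ge>1. X N = (\<Sum>lam\<in>{lam\<in>spectrum C. cmod lam > R}.
          of_nat N powr (Ln lam / ln q) *
          (\<Sum>k<max_jordan_block C lam. of_real (ln (real N) / ln q) ^ k * \<Phi> lam k (frac (ln (real N) / ln q)))))) \<and>
     \<comment> \<open>(2)\<close>
     (\<forall>lam\<in>spectrum C. \<forall>k<max_jordan_block C lam. cmod lam > R \<longrightarrow>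
        (\<forall>\<alpha>. 0 < \<alpha> \<and> \<alpha> < ln (cmod lam / R) / ln q \<longrightarrow> holder_continuous \<alpha> (\<Phi> lam k))) \<and>
     \<comment> \<open>(3)\<close>
     (\<forall>i<d. \<forall>K. compact K \<and> K \<subseteq> {s. Re s > ln R / ln q + 1} \<longrightarrow>
        uniformly_convergent_on K (\<lambda>N s. \<Sum>n<N. cmod (of_nat (Suc n) powr (- s) * v (Suc n) $ i)) \<and>
        uniformly_convergent_on K (\<lambda>N s. \<Sum>n<N. of_nat (Suc n) powr (- s) * v (Suc n) $ i)) \<and>
     (\<forall>i<d. W i meromorphic_on H \<and>
        (\<forall>s. Re s > ln R / ln q + 1 \<longrightarrow> W i s = Vser i s) \<and>
        (\<forall>s\<in>H. \<not> is_pole (W i) s \<longrightarrow> W i analytic_on {s}) \<and>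
        (\<forall>s\<in>H. is_pole (W i) s \<longrightarrow> of_nat q powr s \<in> spectrum C)) \<and>
     (\<forall>r<q. \<forall>j<d. \<forall>K. compact K \<and> K \<subseteq> H \<longrightarrow>
        uniformly_convergent_on K (\<lambda>N s. \<Sum>k<N.
           cmod (((- s) gchoose (Suc k)) * (of_nat r / of_nat q) ^ Suc k * W j (s + of_nat (Suc k)))) \<and>
        uniformly_convergent_on K (\<lambda>N s. \<Sum>k<N.
           ((- s) gchoose (Suc k)) * (of_nat r / of_nat q) ^ Suc k * W j (s + of_nat (Suc k)))) \<and>
     (\<forall>s\<in>H. (\<forall>j<d. \<not> is_pole (W j) s) \<longrightarrow>
        (\<forall>i<d. W i s - of_nat q powr (- s) * (\<Sum>j<d. C $$ (i, j) * W j s) =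
           (\<Sum>n\<in>{1..<q}. of_nat n powr (- s) * v n $ i) +
           of_nat q powr (- s) * (\<Sum>r<q. \<Sum>j<d. A r $$ (i, j) *
              (\<Sum>k. ((- s) gchoose (Suc k)) * (of_nat r / of_nat q) ^ Suc k * W j (s + of_nat (Suc k)))))) \<and>
     \<comment> \<open>(4)\<close>
     (\<forall>lam\<in>spectrum C. cmod lam > max R (1 / real q) \<longrightarrow> (\<forall>k<max_jordan_block C lam. \<forall>u::real.
        (\<lambda>L. \<Sum>l\<in>{-int L..int L}.
            (of_real (ln q) ^ k / of_nat (fact k) *
             residue (\<lambda>s. (v 0 $ 0 + W 0 s) *
                 (s - (Ln lam / ln q + 2 * of_int l * pi * \<i> / ln q)) ^ k / s)
               (Ln lam / ln q + 2 * of_int l * pi * \<i> / ln q)) *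
            exp (2 * of_int l * pi * \<i> * of_real u))
        \<longlonglongrightarrow> \<Phi> lam k u))"
proof -
  interpret rs: regular_sequence q d A v R C
    unfolding C_def by (rule regular_sequence_from_norm) fact+
  obtain S T ev b where "regular_sequence_jordan q d A v R C S T ev b"
    using rs.jordan_basis_exists by blast
  then interpret rj: regular_sequence_jordan q d A v R C S T ev b .
  obtain \<Phi> where \<Phi>: "\<And>lam k u. \<Phi> lam k (u + 1) = \<Phi> lam k u"
    "\<And>lam k \<alpha>. lam \<in> rj.\<Lambda> \<Longrightarrow> 0 < \<alpha> \<Longrightarrow> \<alpha> < ln (cmod lam / R) / ln (real q) \<Longrightarrow> holder_continuous \<alpha> (\<Phi> lam k)"
    "\<exists>c. \<forall>N\<ge>3. cmod (rj.Vsum N 0 - rj.main_term \<Phi> (real N)) \<le> c * (real N powr rs.\<rho> * ln (real N) ^ rj.log_exponent)"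
    "\<And>N. (\<forall>lam\<in>spectrum C. cmod lam > R) \<Longrightarrow> N \<ge> 1 \<Longrightarrow> rj.Vsum N 0 = rj.main_term \<Phi> (real N)"
    "\<And>\<rho>'. \<rho>' > rs.\<rho> \<Longrightarrow> \<exists>c. \<forall>n\<ge>1. \<forall>t. real n \<le> t \<and> t \<le> real n + 1 \<longrightarrow>
       cmod (rj.Vsum (Suc n) 0 - rj.main_term \<Phi> t) \<le> c * real n powr \<rho>'"
    by (rule rj.summatory_asymptotics) (rule that)
  have cont: "continuous_on UNIV (\<Phi> lam k)" if "lam \<in> rj.\<Lambda>" for lam k
  proof -
    define \<alpha> where "\<alpha> = ln (cmod lam / R) / ln (real q) / 2"
    have \<alpha>: "0 < \<alpha>" "\<alpha> < ln (cmod lam / R) / ln (real q)"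
      using rj.holder_exponent_le_1(1)[of lam] that by (auto simp: \<alpha>_def)
    show ?thesis by (rule holder_continuous_imp_continuous_on[OF \<Phi>(2)[OF that \<alpha>] \<alpha>(1)])
  qed
  obtain K where K: "\<And>j. j < d \<Longrightarrow> dirichlet_bound (\<lambda>n. v n $ j) K rs.\<rho>" using rj.dirichlet_v by blast
  have X: "X N = rj.Vsum N 0" for N by (simp add: X_def rj.Vsum_def)
  have Vser: "Vser i s = rj.Dser i s" if "i < d" for i s
    by (simp add: Vser_def dirichlet_bound.D_def[OF K[OF that]])
  \<comment> \<open>The shifted argument lies to the right of \<open>\<rho> + 1\<close>, where the
    continuation agrees with the Dirichlet series. The claim speaks of \<open>W\<close>, while the
    estimates were proved for the series.\<close>
  have shift: "((- s) gchoose (Suc k)) * (of_nat r / of_nat q) ^ Suc k * rj.W j (s + of_nat (Suc k)) =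
      dirichlet_bound.shift_term (\<lambda>n. v n $ j) (of_nat r / of_nat q) k s" if "s \<in> H" "j < d" for s k r j
  proof -
    have "Re (s + of_nat (Suc k)) > rs.\<rho> + 1" using that(1) by (simp add: H_def)
    thus ?thesis using rj.W_eq_Dser[OF _ that(2)] by (simp add: dirichlet_bound.shift_term_def[OF K[OF that(2)]] del: of_nat_Suc power_Suc)
  qed
  show ?thesis
  proof (intro exI[of _ \<Phi>] exI[of _ rj.W] conjI)
    show "\<forall>lam\<in>spectrum C. \<forall>k<max_jordan_block C lam. cmod lam > R \<longrightarrow>
        (\<forall>u. \<Phi> lam k (u + 1) = \<Phi> lam k u) \<and> continuous_on UNIV (\<Phi> lam k)"
      using \<Phi>(1) cont by auto
    show "\<forall>lam\<in>spectrum C. \<forall>k<max_jordan_block C lam. cmod lam > R \<longrightarrow>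
        (\<forall>\<alpha>. 0 < \<alpha> \<and> \<alpha> < ln (cmod lam / R) / ln q \<longrightarrow> holder_continuous \<alpha> (\<Phi> lam k))"
      using \<Phi>(2) by auto
    show "(\<lambda>N. X N - (\<Sum>lam\<in>{lam\<in>spectrum C. cmod lam > R}.
          of_nat N powr (Ln lam / ln q) *
          (\<Sum>k<max_jordan_block C lam. of_real (ln (real N) / ln q) ^ k * \<Phi> lam k (frac (ln (real N) / ln q)))))
       \<in> O(\<lambda>N. of_real (real N powr (ln R / ln q) *
              ln (real N) ^ Max (insert 0 (max_jordan_block C ` {lam\<in>spectrum C. cmod lam = R}))))"
    proof -
      obtain c where c: "\<And>N. N \<ge> 3 \<Longrightarrow> cmod (rj.Vsum N 0 - rj.main_term \<Phi> (real N)) \<le> c * (real N powr rs.\<rho> * ln (real N) ^ rj.log_exponent)"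
        using \<Phi>(3) by blast
      show ?thesis
      proof (rule bigoI[of _ c], rule eventually_sequentiallyI[of 3])
        fix N :: nat assume N: "3 \<le> N"
        show "cmod (X N - (\<Sum>lam\<in>{lam\<in>spectrum C. cmod lam > R}.
          of_nat N powr (Ln lam / ln q) *
          (\<Sum>k<max_jordan_block C lam. of_real (ln (real N) / ln q) ^ k * \<Phi> lam k (frac (ln (real N) / ln q)))))
          \<le> c * norm (complex_of_real (real N powr (ln R / ln q) *
              ln (real N) ^ Max (insert 0 (max_jordan_block C ` {lam\<in>spectrum C. cmod lam = R}))))"
          using c[OF N] N rj.main_term_nat[of \<Phi> N, OF \<Phi>(1)]
          unfolding X rj.log_exponent_def norm_of_real by (simp add: abs_mult)
      qed
    qed
    show "(\<forall>lam\<in>spectrum C. cmod lam > R) \<longrightarrow>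
        (\<forall>N\<ge>1. X N = (\<Sum>lam\<in>{lam\<in>spectrum C. cmod lam > R}.
          of_nat N powr (Ln lam / ln q) *
          (\<Sum>k<max_jordan_block C lam. of_real (ln (real N) / ln q) ^ k * \<Phi> lam k (frac (ln (real N) / ln q)))))"
      using \<Phi>(4) rj.main_term_nat[of \<Phi>, OF \<Phi>(1)] unfolding X by simp
    show "\<forall>i<d. \<forall>K. compact K \<and> K \<subseteq> {s. Re s > ln R / ln q + 1} \<longrightarrow>
        uniformly_convergent_on K (\<lambda>N s. \<Sum>n<N. cmod (of_nat (Suc n) powr (- s) * v (Suc n) $ i)) \<and>
        uniformly_convergent_on K (\<lambda>N s. \<Sum>n<N. of_nat (Suc n) powr (- s) * v (Suc n) $ i)"
    proof (intro allI impI)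
      fix i B assume i: "i < d" and B: "compact B \<and> B \<subseteq> {s. Re s > ln R / ln q + 1}"
      from dirichlet_bound.dirichlet_majorant[OF K[OF i] conjunct1[OF B] conjunct2[OF B]]
      obtain M where M: "summable M" "\<forall>n. \<forall>s\<in>B. cmod (of_nat (Suc n) powr (- s) * v (Suc n) $ i) \<le> M n"
        by (elim exE conjE) (rule that)
      have "cmod (of_nat (Suc n) powr (- s) * v (Suc n) $ i) \<le> M n" if "s \<in> B" for n s
        by (rule M(2)[THEN spec, THEN bspec, OF that])
      from Mtest_uniformly_convergent(1,2)[OF this M(1)]
      show "uniformly_convergent_on B (\<lambda>N s. \<Sum>n<N. cmod (of_nat (Suc n) powr (- s) * v (Suc n) $ i)) \<and>
        uniformly_convergent_on B (\<lambda>N s. \<Sum>n<N. of_nat (Suc n) powr (- s) * v (Suc n) $ i)" by (rule conjI)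
    qed
    show "\<forall>i<d. rj.W i meromorphic_on H \<and>
        (\<forall>s. Re s > ln R / ln q + 1 \<longrightarrow> rj.W i s = Vser i s) \<and>
        (\<forall>s\<in>H. \<not> is_pole (rj.W i) s \<longrightarrow> rj.W i analytic_on {s}) \<and>
        (\<forall>s\<in>H. is_pole (rj.W i) s \<longrightarrow> of_nat q powr s \<in> spectrum C)"
    proof (intro allI impI conjI ballI)
      fix i assume i: "i < d"
      show "rj.W i meromorphic_on H" unfolding H_def by (rule rj.W_meromorphic)
      show "rj.W i s = Vser i s" if "Re s > ln R / ln q + 1" for s
        unfolding Vser[OF i] by (rule rj.W_eq_Dser[OF that i])
      show "rj.W i analytic_on {s}" if "s \<in> H" "\<not> is_pole (rj.W i) s" for s
        using that unfolding H_def by (rule rj.W_analytic)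
      show "of_nat q powr s \<in> spectrum C" if "s \<in> H" "is_pole (rj.W i) s" for s
        using that unfolding H_def by (rule rj.W_pole)
    qed
    show "\<forall>r<q. \<forall>j<d. \<forall>K. compact K \<and> K \<subseteq> H \<longrightarrow>
        uniformly_convergent_on K (\<lambda>N s. \<Sum>k<N.
           cmod (((- s) gchoose (Suc k)) * (of_nat r / of_nat q) ^ Suc k * rj.W j (s + of_nat (Suc k)))) \<and>
        uniformly_convergent_on K (\<lambda>N s. \<Sum>k<N.
           ((- s) gchoose (Suc k)) * (of_nat r / of_nat q) ^ Suc k * rj.W j (s + of_nat (Suc k)))"
    proof (intro allI impI)
      fix r j B assume r: "r < q" and j: "j < d" and B: "compact B \<and> B \<subseteq> H"
      have "cmod (of_nat r / of_nat q) < 1" using rj.r_over_q(2)[OF r] rj.r_over_q(3)[of r] by simp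
      from dirichlet_bound.shift_majorant[OF K[OF j] this conjunct1[OF B] conjunct2[OF B, unfolded H_def]]
      obtain M where M: "summable M" "\<forall>k. \<forall>s\<in>B. cmod (dirichlet_bound.shift_term (\<lambda>n. v n $ j) (of_nat r / of_nat q) k s) \<le> M k"
        by (elim exE conjE) (rule that)
      have "cmod (((- s) gchoose (Suc k)) * (of_nat r / of_nat q) ^ Suc k * rj.W j (s + of_nat (Suc k))) \<le> M k" if s: "s \<in> B" for k s
        unfolding shift[OF subsetD[OF conjunct2[OF B] s] j] by (rule M(2)[THEN spec, THEN bspec, OF s])
      from Mtest_uniformly_convergent(1,2)[OF this M(1)]
      show "uniformly_convergent_on B (\<lambda>N s. \<Sum>k<N.
           cmod (((- s) gchoose (Suc k)) * (of_nat r / of_nat q) ^ Suc k * rj.W j (s + of_nat (Suc k)))) \<and>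
        uniformly_convergent_on B (\<lambda>N s. \<Sum>k<N.
           ((- s) gchoose (Suc k)) * (of_nat r / of_nat q) ^ Suc k * rj.W j (s + of_nat (Suc k)))" by (rule conjI)
    qed
    show "\<forall>s\<in>H. (\<forall>j<d. \<not> is_pole (rj.W j) s) \<longrightarrow>
        (\<forall>i<d. rj.W i s - of_nat q powr (- s) * (\<Sum>j<d. C $$ (i, j) * rj.W j s) =
           (\<Sum>n\<in>{1..<q}. of_nat n powr (- s) * v n $ i) +
           of_nat q powr (- s) * (\<Sum>r<q. \<Sum>j<d. A r $$ (i, j) *
              (\<Sum>k. ((- s) gchoose (Suc k)) * (of_nat r / of_nat q) ^ Suc k * rj.W j (s + of_nat (Suc k)))))"
    proof (intro ballI allI impI)
      fix s i assume s: "s \<in> H" and np: "\<forall>j<d. \<not> is_pole (rj.W j) s" and i: "i < d"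
      have "rj.W i s - of_nat q powr (- s) * (\<Sum>j<d. C $$ (i, j) * rj.W j s) = rj.rhs i s"
        using s np i unfolding H_def by (intro rj.W_equation) auto
      also have "\<dots> = (\<Sum>n\<in>{1..<q}. of_nat n powr (- s) * v n $ i) +
           of_nat q powr (- s) * (\<Sum>r<q. \<Sum>j<d. A r $$ (i, j) *
              (\<Sum>k. ((- s) gchoose (Suc k)) * (of_nat r / of_nat q) ^ Suc k * rj.W j (s + of_nat (Suc k))))"
        unfolding rj.rhs_def
        by (intro arg_cong2[of _ _ _ _ "(+)"] arg_cong2[of _ _ _ _ "(*)"] sum.cong refl suminf_cong)
           (simp only: shift[OF s] lessThan_iff)
      finally show "rj.W i s - of_nat q powr (- s) * (\<Sum>j<d. C $$ (i, j) * rj.W j s) =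
           (\<Sum>n\<in>{1..<q}. of_nat n powr (- s) * v n $ i) +
           of_nat q powr (- s) * (\<Sum>r<q. \<Sum>j<d. A r $$ (i, j) *
              (\<Sum>k. ((- s) gchoose (Suc k)) * (of_nat r / of_nat q) ^ Suc k * rj.W j (s + of_nat (Suc k))))" .
    qed
    show "\<forall>lam\<in>spectrum C. cmod lam > max R (1 / real q) \<longrightarrow> (\<forall>k<max_jordan_block C lam. \<forall>u::real.
        (\<lambda>L. \<Sum>l\<in>{-int L..int L}.
            (of_real (ln q) ^ k / of_nat (fact k) *
             residue (\<lambda>s. (v 0 $ 0 + rj.W 0 s) *
                 (s - (Ln lam / ln q + 2 * of_int l * pi * \<i> / ln q)) ^ k / s)
               (Ln lam / ln q + 2 * of_int l * pi * \<i> / ln q)) *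
            exp (2 * of_int l * pi * \<i> * of_real u))
        \<longlonglongrightarrow> \<Phi> lam k u)"
    proof (intro ballI impI allI)
      fix lam k u assume lam: "lam \<in> spectrum C" "cmod lam > max R (1 / real q)" and k: "k < max_jordan_block C lam"
      have "lam \<in> rj.\<Lambda>" using lam by auto
      from rj.fourier_expansion[OF \<Phi>(1) \<Phi>(2) cont \<Phi>(5) this k, of u]
      show "(\<lambda>L. \<Sum>l\<in>{-int L..int L}.
            (of_real (ln q) ^ k / of_nat (fact k) *
             residue (\<lambda>s. (v 0 $ 0 + rj.W 0 s) *
                 (s - (Ln lam / ln q + 2 * of_int l * pi * \<i> / ln q)) ^ k / s)
               (Ln lam / ln q + 2 * of_int l * pi * \<i> / ln q)) *
            exp (2 * of_int l * pi * \<i> * of_real u))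
        \<longlonglongrightarrow> \<Phi> lam k u" by simp
    qed
  qed
qed

end
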